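(* Let $n\ge 3$ be an integer, let $p>n/2$ (with $p=\infty$ allowed), and let $q$ be the conjugate exponent, $\frac1p+\frac1q=1$, so that $1\le q<\frac{n}{n-2}$. Then the operator norm $\|\mathcal G\|$ of $\mathcal G:L^p(B^n)\to L^\infty(B^n)$ is $$\|\mathcal G\|=c_n\left(\frac{\pi^{n/2}\,\Gamma(1+q)\,\Gamma\!\left(\frac{n-q(n-2)}{n-2}\right)}{\Gamma\!\left(1+\frac n2\right)\Gamma\!\left(\frac{n}{n-2}\right)}\right)^{1/q}.$$ In particular, for $p=\infty$, the norm $\|\mathcal G\|_\infty$ of $\mathcal G:L^\infty(B^n)\to L^\infty(B^n)$ is $\|\mathcal G\|_\infty=\frac1{2n}$.
   Context: $B^n$ is the open unit ball and $S^{n-1}$ the unit sphere of $\mathbb R^n$, $|\cdot|$ is the Euclidean norm, $L^p(B^n)$ is taken with respect to (unnormalized) Lebesgue measure $dy$. Let $\omega_{n-1}$ be the $(n-1)$-dimensional Hausdorff measure of $S^{n-1}$ and $c_n=\frac{1}{(n-2)\omega_{n-1}}$. The Green function of $B^n$ is $$G(x,y)=c_n\left(\frac1{|x-y|^{n-2}}-\frac1{[x,y]^{n-2}}\right),\qquad [x,y]=\big|\,|y|x-y/|y|\,\big|=\big|\,|x|y-x/|x|\,\big|,$$ equivalently $[x,y]=\sqrt{1-2\langle x,y\rangle+|x|^2|y|^2}$ (which also covers $x=0$ or $y=0$). The solution operator is $\mathcal G[g](x)=\int_{B^n}G(x,y)g(y)\,dy$, $x\in B^n$. The norm of an operator $T:X\to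 Y$ between normed spaces is $\|T\|=\sup\{\|Tx\|:\|x\|=1\}$. *)

theory Defs
  imports "HOL-Probability.Essential_Supremum"
begin

text \<open>Hausdorff outer measure of integer dimension \<open>k\<close>, normalized by the volume of the
  \<open>k\<close>-dimensional unit ball, so that it agrees with Lebesgue measure on \<open>\<real>\<^sup>k\<close>.
  Boundedness is required of the covering sets because \<^const>\<open>diameter\<close> is unspecified on
  unbounded sets; the case split makes the empty set contribute nothing when \<open>k = 0\<close>.\<close>

definition hausdorff_premeasure :: "nat \<Rightarrow> real \<Rightarrow> 'a::metric_space set \<Rightarrow> ennreal" where
  "hausdorff_premeasure k \<delta> A =
     (INF C\<in>{C :: nat \<Rightarrow> 'a set. A \<subseteq> (\<Union>i. C i) \<and> (\<forall>i. bounded (C i) \<and> diameter (C i) \<le> \<delta>)}.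
        \<Sum>i. if C i = {} then 0
             else ennreal (unit_ball_vol (real k) * (diameter (C i) / 2) ^ k))"

definition hausdorff_measure :: "nat \<Rightarrow> 'a::metric_space set \<Rightarrow> ennreal" where
  "hausdorff_measure k A = (SUP \<delta>\<in>{0<..}. hausdorff_premeasure k \<delta> A)"

definition unit_sphere_area :: "'a::euclidean_space itself \<Rightarrow> real" where
  "unit_sphere_area _ = enn2real (hausdorff_measure (DIM('a) - 1) (sphere (0::'a) 1))"

definition green_const :: "'a::euclidean_space itself \<Rightarrow> real" where
  "green_const T = 1 / ((real DIM('a) - 2) * unit_sphere_area T)"

definition green_bracket :: "'a::euclidean_space \<Rightarrow> 'a \<Rightarrow> real" where
  "green_bracket x y = sqrt (1 - 2 * (x \<bullet> y) + (norm x)\<^sup>2 * (norm y)\<^sup>2)"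

lemma green_bracket_commute: "green_bracket x y = green_bracket y x"
  by (simp add: green_bracket_def inner_commute mult.commute)

lemma green_bracket_eq_norm:
  assumes "y \<noteq> 0"
  shows "green_bracket x y = norm (norm y *\<^sub>R x - y /\<^sub>R norm y)"
proof -
  have "(norm (norm y *\<^sub>R x - y /\<^sub>R norm y))\<^sup>2 = 1 - 2 * (x \<bullet> y) + (norm x)\<^sup>2 * (norm y)\<^sup>2"
    using assms
    by (simp add: power2_norm_eq_inner inner_diff_left inner_diff_right inner_commute[of y x])
       (simp add: field_simps power2_norm_eq_inner[symmetric] power2_eq_square)
  then show ?thesis
    by (metis green_bracket_def norm_ge_zero real_sqrt_unique)
qed

text \<open>On the diagonal, where the Green function is infinite, division by zero gives a finite
  value; this does not affect integrals in \<open>y\<close>.\<close>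

definition green_fun :: "'a::euclidean_space \<Rightarrow> 'a \<Rightarrow> real" where
  "green_fun x y = green_const TYPE('a) *
     (1 / norm (x - y) ^ (DIM('a) - 2) - 1 / green_bracket x y ^ (DIM('a) - 2))"

abbreviation ball_measure :: "'a::euclidean_space measure" where
  "ball_measure \<equiv> lebesgue_on (ball 0 1)"

definition green_op :: "('a::euclidean_space \<Rightarrow> real) \<Rightarrow> 'a \<Rightarrow> real" where
  "green_op g x = (LINT y|ball_measure. green_fun x y * g y)"

text \<open>\<open>L\<^sup>p\<close> for \<open>0 < p \<le> \<infinity>\<close>, as a set of representatives (functions equal almost everywhere
  are not identified). The norm is extended-valued; it is only meaningful for measurable functions.\<close>

definition Lp_norm :: "ennreal \<Rightarrow> 'a measure \<Rightarrow> ('a \<Rightarrow> real) \<Rightarrow> ennreal" where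
  "Lp_norm p M f =
     (if p = \<infinity> then esssup M (\<lambda>x. ennreal \<bar>f x\<bar>)
      else let I = (\<integral>\<^sup>+x. ennreal (\<bar>f x\<bar> powr enn2real p) \<partial>M)
           in if I = \<infinity> then \<infinity> else ennreal (enn2real I powr (1 / enn2real p)))"

definition Lp_space :: "ennreal \<Rightarrow> 'a measure \<Rightarrow> ('a \<Rightarrow> real) set" where
  "Lp_space p M = {f \<in> borel_measurable M. Lp_norm p M f < \<infinity>}"

definition Lp_operator_norm ::
  "ennreal \<Rightarrow> 'a measure \<Rightarrow> ennreal \<Rightarrow> 'b measure \<Rightarrow> (('a \<Rightarrow> real) \<Rightarrow> 'b \<Rightarrow> real) \<Rightarrow> ennreal" where
  "Lp_operator_norm p M r N T =
     (SUP f\<in>{f \<in> Lp_space p M. Lp_norm p M f = 1}. Lp_norm r N (T f))"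

end

theory Submission
  imports Defs
begin

text \<open>By duality the norm is the supremum over \<open>x\<close> of the \<open>L\<^sup>q\<close> norm of the Green function with
  pole \<open>x\<close>. With \<open>t = \<rho> powr (2 - n) - 1\<close>, the set where
  \<open>|x - y| powr (2 - n) - [x, y] powr (2 - n) > t\<close> lies in a ball of radius \<open>\<rho>\<close> (centred at a suitable
  multiple of \<open>x\<close>), while for \<open>x = 0\<close> it is exactly the ball of radius \<open>\<rho>\<close>. So every
  \<open>L\<^sup>q\<close> norm is largest at \<open>x = 0\<close>, where it is a Beta integral; the bound is attained in the
  limit by Fatou's lemma for the extremal function of Hoelder's inequality at \<open>x = 0\<close>.

  The value \<open>1 / (2 n)\<close> also needs the Hausdorff measure of the sphere. The lower bound rests on the
  isodiametric inequality: a piece of the sphere of small diameter \<open>d\<close> is thickened to a shell \<open>E\<close>,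
  and Prekopa--Leindler bounds the volume of \<open>E\<close> by that of \<open>(E - E) / 2\<close>, which sits in a flat
  cylinder of radius about \<open>d / 2\<close>. The upper bound comes from coverings by small disjoint caps.\<close>

section \<open>Prekopa--Leindler inequality\<close>

text \<open>The kernel with pole x is not dominated pointwise by the kernel with pole 0, and the
  Moebius map carrying x to 0 does not preserve volume. Comparing volumes of superlevel sets avoids
  both obstacles and serves every exponent \<open>q\<close> at once: the level sets for pole 0 are
  balls up to a point, while those for pole x only have to fit into balls of equal radius, whatever
  the centres. For the sphere, an arbitrary cover reveals nothing about its members except their
  diameters, so a sharp lower bound needs an isodiametric inequality with the exact constant.
  Passing to half differences does not decrease volume and turns a bound on mutual distances into a
  bound on norms. Prekopa--Leindler is the form of Brunn--Minkowski that lends itself to induction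
  on the number of coordinates. Surface area is encoded as volume throughout: a piece of the sphere
  is measured by the cone over it, and n times the cone volume is the area.\<close>

lemma emeasure_lborel_sumset_bounded:
  fixes A B C :: "real set"
  assumes [measurable]: "A \<in> sets borel" "B \<in> sets borel" "C \<in> sets borel"
    and ne: "A \<noteq> {}" "B \<noteq> {}" and bdd: "bdd_above A" "bdd_below B"
    and sum: "\<And>a b. a \<in> A \<Longrightarrow> b \<in> B \<Longrightarrow> a + b \<in> C"
  shows "emeasure lborel A + emeasure lborel B \<le> emeasure lborel C"
proof (rule ennreal_le_epsilon)
  fix e :: real assume e: "e > 0"
  obtain a where a: "a \<in> A" "Sup A - e / 2 < a"
    using less_cSup_iff[OF ne(1) bdd(1), of "Sup A - e / 2"] e by auto
  obtain b where b: "b \<in> B" "b < Inf B + e / 2"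
    using cInf_less_iff[OF ne(2) bdd(2), of "Inf B + e / 2"] e by auto
  \<comment> \<open>The translates of \<open>A\<close> by \<open>b\<close> and of \<open>B\<close>
    by \<open>a\<close> both lie in \<open>C\<close>. As \<open>a\<close> is nearly the top of
    \<open>A\<close> and \<open>b\<close> nearly the bottom of \<open>B\<close>, they overlap in an
    interval of length at most \<open>e\<close>. Working with any Borel \<open>C\<close> containing
    the sums avoids measurability of the sumset itself.\<close>
  define A' where "A' = (+) (- b) -` A"
  define B' where "B' = (+) (- a) -` B"
  have [measurable]: "A' \<in> sets borel" "B' \<in> sets borel"
    unfolding A'_def B'_def
    by (rule measurable_sets_borel[OF _ assms(1)], simp) (rule measurable_sets_borel[OF _ assms(2)], simp)
  have tr: "emeasure lborel ((+) c -` X) = emeasure lborel X" if "X \<in> sets borel" for c and X :: "real set"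
    using that by (subst (2) lborel_distr_plus[of c, symmetric]) (simp add: emeasure_distr)
  have "emeasure lborel A + emeasure lborel B = emeasure lborel A' + emeasure lborel B'"
    unfolding A'_def B'_def by (simp add: tr)
  also have "\<dots> = emeasure lborel (A' \<union> B') + emeasure lborel (A' \<inter> B')"
    by (rule emeasure_Un_Int) auto
  also have "\<dots> \<le> emeasure lborel C + emeasure lborel {a + Inf B .. Sup A + b}"
  proof (intro add_mono emeasure_mono)
    show "A' \<union> B' \<subseteq> C"
      using sum[OF _ b(1)] sum[OF a(1)] by (force simp: A'_def B'_def)
    show "A' \<inter> B' \<subseteq> {a + Inf B .. Sup A + b}"
      using cSup_upper[OF _ bdd(1)] cInf_lower[OF _ bdd(2)] by (force simp: A'_def B'_def)
  qed auto
  also have "emeasure lborel {a + Inf B .. Sup A + b} \<le> ennreal e"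
    using a b by (cases "a + Inf B \<le> Sup A + b") (auto intro!: ennreal_leI)
  finally show "emeasure lborel A + emeasure lborel B \<le> emeasure lborel C + ennreal e"
    by (simp add: add_left_mono)
qed

lemma emeasure_lborel_sumset:
  fixes A B C :: "real set"
  assumes [measurable]: "A \<in> sets borel" "B \<in> sets borel" "C \<in> sets borel"
    and ne: "A \<noteq> {}" "B \<noteq> {}"
    and sum: "\<And>a b. a \<in> A \<Longrightarrow> b \<in> B \<Longrightarrow> a + b \<in> C"
  shows "emeasure lborel A + emeasure lborel B \<le> emeasure lborel C"
proof -
  obtain a b where ab: "a \<in> A" "b \<in> B" using ne by auto
  define A' where "A' = (\<lambda>k::nat. A \<inter> {..a + real k})"
  define B' where "B' = (\<lambda>k::nat. B \<inter> {b - real k..})"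
  have *: "(\<Union>k. A' k) = A" "(\<Union>k. B' k) = B"
  proof -
    have "\<exists>k. x \<le> a + real k" for x
      using real_arch_simple[of "x - a"] by (simp add: algebra_simps)
    then show "(\<Union>k. A' k) = A" by (auto simp: A'_def)
    have "\<exists>k. b \<le> x + real k" for x
      using real_arch_simple[of "b - x"] by (simp add: algebra_simps)
    then show "(\<Union>k. B' k) = B" by (auto simp: B'_def diff_le_eq)
  qed
  have "(\<lambda>k. emeasure lborel (A' k) + emeasure lborel (B' k)) \<longlonglongrightarrow>
        emeasure lborel (\<Union>k. A' k) + emeasure lborel (\<Union>k. B' k)"
    by (intro tendsto_add Lim_emeasure_incseq) (auto simp: A'_def B'_def incseq_def)
  moreover have "emeasure lborel (A' k) + emeasure lborel (B' k) \<le> emeasure lborel C" for k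
  proof (rule emeasure_lborel_sumset_bounded)
    show "A' k \<noteq> {}" "B' k \<noteq> {}" using ab by (auto simp: A'_def B'_def)
    show "bdd_above (A' k)" "bdd_below (B' k)" by (auto simp: A'_def B'_def)
  qed (auto simp: A'_def B'_def sum)
  ultimately show ?thesis unfolding * by (auto intro: LIMSEQ_le_const2)
qed

section \<open>Layer cake formula and the inequality in one dimension\<close>

lemma emeasure_lborel_ennreal_interval:
  "emeasure lborel {t. 0 \<le> t \<and> ennreal t < c} = c"
proof (cases c)
  case (real r)
  have "{t. 0 \<le> t \<and> ennreal t < c} = {0..<r}" using real by (auto simp: ennreal_less_iff)
  then show ?thesis using real by simp
next
  case top
  have "{t. 0 \<le> t \<and> ennreal t < c} = {0..}" using top by auto
  moreover have "emeasure lborel {0::real..} = top"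
  proof (cases "emeasure lborel {0::real..}")
    case (real r)
    then have "ennreal (r + 1) = emeasure lborel {0..r + 1}" by simp
    also have "\<dots> \<le> emeasure lborel {0::real..}" by (rule emeasure_mono) auto
    finally show ?thesis using real by (simp add: ennreal_le_iff)
  qed
  ultimately show ?thesis using top by simp
qed

text \<open>Tonelli for the region under the graph. The factor \<open>indicator {0..} t\<close>
  matters: \<open>ennreal t\<close> is 0 for every negative \<open>t\<close>.\<close>

lemma nn_integral_layer_cake:
  fixes f :: "'a \<Rightarrow> ennreal"
  assumes "sigma_finite_measure M" and [measurable]: "f \<in> borel_measurable M"
  shows "(\<integral>\<^sup>+x. f x \<partial>M) =
    (\<integral>\<^sup>+t. indicator {0..} t * emeasure M {x \<in> space M. ennreal t < f x} \<partial>lborel)"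
proof -
  interpret sigma_finite_measure M by fact
  interpret pair_sigma_finite M "lborel :: real measure" by standard
  have "(\<integral>\<^sup>+x. f x \<partial>M) = (\<integral>\<^sup>+x. (\<integral>\<^sup>+t. indicator {t. 0 \<le> t \<and> ennreal t < f x} t \<partial>lborel) \<partial>M)"
    by (intro nn_integral_cong) (simp add: emeasure_lborel_ennreal_interval)
  also have "\<dots> = (\<integral>\<^sup>+x. (\<integral>\<^sup>+t. indicator {(x, t). 0 \<le> t \<and> ennreal t < f x} (x, t) \<partial>lborel) \<partial>M)"
    by (simp add: indicator_def)
  also have "\<dots> = (\<integral>\<^sup>+t. (\<integral>\<^sup>+x. indicator {(x, t). 0 \<le> t \<and> ennreal t < f x} (x, t) \<partial>M) \<partial>lborel)"
    by (rule Fubini'[symmetric]) measurable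
  also have "\<dots> = (\<integral>\<^sup>+t. indicator {0..} t * (\<integral>\<^sup>+x. indicator {x \<in> space M. ennreal t < f x} x \<partial>M) \<partial>lborel)"
    by (intro nn_integral_cong, subst nn_integral_cmult[symmetric])
       (auto intro!: nn_integral_cong simp: indicator_def)
  also have "\<dots> = (\<integral>\<^sup>+t. indicator {0..} t * emeasure M {x \<in> space M. ennreal t < f x} \<partial>lborel)"
    by simp
  finally show ?thesis .
qed

text \<open>Suprema equal to 1 make the level sets of \<open>f\<close> and \<open>g\<close> nonempty
  for the same levels t < 1, so one-dimensional Brunn--Minkowski applies at each of them; at higher
  levels both are empty. Integrating over t yields an arithmetic mean, stronger than the geometric
  mean wanted afterwards.\<close>

lemma Prekopa_Leindler_real_normalized:
  fixes f g h :: "real \<Rightarrow> ennreal"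
  assumes [measurable]: "f \<in> borel_measurable borel" "g \<in> borel_measurable borel" "h \<in> borel_measurable borel"
    and le: "\<And>x y. f x * g y \<le> (h ((x + y) / 2))\<^sup>2"
    and sup: "(SUP x. f x) = 1" "(SUP x. g x) = 1"
  shows "(\<integral>\<^sup>+x. f x \<partial>lborel) + (\<integral>\<^sup>+x. g x \<partial>lborel) \<le> 2 * (\<integral>\<^sup>+x. h x \<partial>lborel)"
proof -
  have lev: "emeasure lborel {x. ennreal t < f x} + emeasure lborel {x. ennreal t < g x}
      \<le> 2 * emeasure lborel {x. ennreal t < h x}" if t: "0 \<le> t" for t
  proof (cases "t < 1")
    case True
    then have t1: "ennreal t < 1" by (simp add: t ennreal_less_one_iff)
    have ne: "{x. ennreal t < f x} \<noteq> {}" "{x. ennreal t < g x} \<noteq> {}"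
      using t1 sup less_SUP_iff[of "ennreal t" f UNIV] less_SUP_iff[of "ennreal t" g UNIV] by auto
    have "emeasure lborel {x. ennreal t < f x} + emeasure lborel {x. ennreal t < g x}
      \<le> emeasure lborel ((\<lambda>x. x / 2) -` {x. ennreal t < h x})"
    proof (rule emeasure_lborel_sumset)
      fix x y assume "x \<in> {x. ennreal t < f x}" "y \<in> {x. ennreal t < g x}"
      then have "ennreal t < f x" "ennreal t < g y" by auto
      then have "ennreal t * ennreal t < f x * g y"
        using sup SUP_upper[of x UNIV f] SUP_upper[of y UNIV g] t
        by (cases "f x"; cases "g y")
           (auto simp: ennreal_mult[symmetric] ennreal_less_iff top_unique intro!: mult_strict_mono')
      also have "\<dots> \<le> (h ((x + y) / 2))\<^sup>2" by (rule le)
      finally have "ennreal t < h ((x + y) / 2)"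
        by (metis linorder_not_less mult_mono power2_eq_square zero_le)
      then show "x + y \<in> (\<lambda>x. x / 2) -` {x. ennreal t < h x}" by simp
    qed (use ne in \<open>auto intro!: measurable_sets_borel\<close>)
    also have "\<dots> = 2 * emeasure lborel {x. ennreal t < h x}"
    proof -
      have "emeasure lborel {x. ennreal t < h x} = (\<integral>\<^sup>+x. indicator {x. ennreal t < h x} x \<partial>lborel)"
        by simp
      also have "\<dots> = ennreal (1/2) * (\<integral>\<^sup>+x. indicator {x. ennreal t < h x} (x / 2) \<partial>lborel)"
        by (subst nn_integral_real_affine[where c="1/2" and t=0]) auto
      also have "(\<integral>\<^sup>+x. indicator {x. ennreal t < h x} (x / 2) \<partial>lborel) =
          (\<integral>\<^sup>+x. indicator ((\<lambda>x. x / 2) -` {x. ennreal t < h x}) x \<partial>lborel)"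
        by (simp add: indicator_def)
      also have "\<dots> = emeasure lborel ((\<lambda>x. x / 2) -` {x. ennreal t < h x})"
        by (intro nn_integral_indicator) (auto intro!: measurable_sets_borel)
      finally have "2 * emeasure lborel {x. ennreal t < h x} =
          (ennreal 2 * ennreal (1/2)) * emeasure lborel ((\<lambda>x. x / 2) -` {x. ennreal t < h x})"
        by (simp add: mult.assoc)
      also have "ennreal 2 * ennreal (1/2) = 1"
        by (subst ennreal_mult[symmetric]) auto
      finally show ?thesis by simp
    qed
    finally show ?thesis .
  next
    case False
    then have "ennreal t \<ge> f x" "ennreal t \<ge> g x" for x
      using sup SUP_upper[of x UNIV f] SUP_upper[of x UNIV g]
      by (metis UNIV_I ennreal_1 ennreal_leI le_less_linear order_trans)+
    then have "{x. ennreal t < f x} = {}" "{x. ennreal t < g x} = {}" by (auto simp: leD)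
    then show ?thesis by simp
  qed
  have *: "(\<integral>\<^sup>+x. u x \<partial>lborel) = (\<integral>\<^sup>+t. indicator {0..} t * emeasure lborel {x. ennreal t < u x} \<partial>lborel)"
    if [measurable]: "u \<in> borel_measurable borel" for u :: "real \<Rightarrow> ennreal"
    using nn_integral_layer_cake[of lborel u] by (simp add: lborel.sigma_finite_measure_axioms)
  have "(\<integral>\<^sup>+x. f x \<partial>lborel) + (\<integral>\<^sup>+x. g x \<partial>lborel) =
    (\<integral>\<^sup>+t. indicator {0..} t * (emeasure lborel {x. ennreal t < f x} + emeasure lborel {x. ennreal t < g x}) \<partial>lborel)"
    by (simp add: *[of f] *[of g] distrib_left nn_integral_add)
  also have "\<dots> \<le> (\<integral>\<^sup>+t. 2 * (indicator {0..} t * emeasure lborel {x. ennreal t < h x}) \<partial>lborel)"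
    using lev by (intro nn_integral_mono) (auto simp: indicator_def)
  also have "\<dots> = 2 * (\<integral>\<^sup>+x. h x \<partial>lborel)"
    by (simp add: *[of h] nn_integral_cmult)
  finally show ?thesis .
qed

lemma ennreal_arith_geo_mean: "4 * (a * b) \<le> (a + b :: ennreal)\<^sup>2"
proof (cases "a = top \<or> b = top")
  case False
  then obtain x y where "a = ennreal x" "b = ennreal y" "x \<ge> 0" "y \<ge> 0"
    by (metis ennreal_cases)
  moreover have "4 * (x * y) \<le> (x + y)\<^sup>2"
    using zero_le_power2[of "x - y"] by (simp add: power2_eq_square algebra_simps)
  ultimately show ?thesis
    by (simp add: ennreal_mult[symmetric] ennreal_plus[symmetric] ennreal_power numeral_mult_ennreal ennreal_leI del: ennreal_plus)
qed (auto simp: power2_eq_square ennreal_top_mult ennreal_mult_top)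

text \<open>Dividing \<open>f\<close> and \<open>g\<close> by their suprema and \<open>h\<close> by
  the geometric mean of the suprema leaves the hypothesis invariant; the arithmetic-geometric mean
  inequality then turns the normalized sum into a product.\<close>

lemma Prekopa_Leindler_real_bounded:
  fixes f g h :: "real \<Rightarrow> ennreal"
  assumes [measurable]: "f \<in> borel_measurable borel" "g \<in> borel_measurable borel" "h \<in> borel_measurable borel"
    and le: "\<And>x y. f x * g y \<le> (h ((x + y) / 2))\<^sup>2"
    and bdd: "(SUP x. f x) < top" "(SUP x. g x) < top"
  shows "(\<integral>\<^sup>+x. f x \<partial>lborel) * (\<integral>\<^sup>+x. g x \<partial>lborel) \<le> (\<integral>\<^sup>+x. h x \<partial>lborel)\<^sup>2"
proof (cases "(SUP x. f x) = 0 \<or> (SUP x. g x) = 0")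
  case True
  then have "(\<forall>x. f x = 0) \<or> (\<forall>x. g x = 0)"
    by (simp add: SUP_eq_iff bot_ennreal)
  then show ?thesis by auto
next
  case False
  define a where "a = enn2real (SUP x. f x)"
  define b where "b = enn2real (SUP x. g x)"
  have a: "(SUP x. f x) = ennreal a" "a > 0" and b: "(SUP x. g x) = ennreal b" "b > 0"
    using False bdd by (auto simp: a_def b_def enn2real_positive_iff zero_less_iff_neq_zero)
  define s where "s = sqrt (a * b)"
  have s: "s > 0" "s\<^sup>2 = a * b" using a b by (auto simp: s_def)
  define f' where "f' = (\<lambda>x. ennreal (1 / a) * f x)"
  define g' where "g' = (\<lambda>x. ennreal (1 / b) * g x)"
  define h' where "h' = (\<lambda>x. ennreal (1 / s) * h x)"
  have [measurable]: "f' \<in> borel_measurable borel" "g' \<in> borel_measurable borel" "h' \<in> borel_measurable borel"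
    by (auto simp: f'_def g'_def h'_def)
  have "(\<integral>\<^sup>+x. f' x \<partial>lborel) + (\<integral>\<^sup>+x. g' x \<partial>lborel) \<le> 2 * (\<integral>\<^sup>+x. h' x \<partial>lborel)"
  proof (rule Prekopa_Leindler_real_normalized)
    fix x y
    have "f' x * g' y = ennreal ((1 / s)\<^sup>2) * (f x * g y)"
      using a b s by (simp add: f'_def g'_def mult_ac ennreal_mult[symmetric] power_divide)
    also have "\<dots> \<le> ennreal ((1 / s)\<^sup>2) * (h ((x + y) / 2))\<^sup>2"
      by (intro mult_left_mono le) auto
    also have "\<dots> = (h' ((x + y) / 2))\<^sup>2"
      using s by (simp add: h'_def power_mult_distrib ennreal_power)
    finally show "f' x * g' y \<le> (h' ((x + y) / 2))\<^sup>2" .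
  next
    show "(SUP x. f' x) = 1"
      using a by (simp add: f'_def SUP_mult_left_ennreal[symmetric] ennreal_mult[symmetric])
    show "(SUP x. g' x) = 1"
      using b by (simp add: g'_def SUP_mult_left_ennreal[symmetric] ennreal_mult[symmetric])
  qed auto
  then have *: "ennreal (1 / a) * (\<integral>\<^sup>+x. f x \<partial>lborel) + ennreal (1 / b) * (\<integral>\<^sup>+x. g x \<partial>lborel)
     \<le> 2 * (ennreal (1 / s) * (\<integral>\<^sup>+x. h x \<partial>lborel))"
    by (simp add: f'_def g'_def h'_def nn_integral_cmult)
  define F G H where "F = (\<integral>\<^sup>+x. f x \<partial>lborel)" and "G = (\<integral>\<^sup>+x. g x \<partial>lborel)" and "H = (\<integral>\<^sup>+x. h x \<partial>lborel)"
  have "4 * ((ennreal (1 / a) * F) * (ennreal (1 / b) * G)) \<le> (2 * (ennreal (1 / s) * H))\<^sup>2"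
    using order_trans[OF ennreal_arith_geo_mean power_mono[OF *]] by (simp add: F_def G_def H_def)
  also have "\<dots> = 4 * (ennreal ((1 / s)\<^sup>2) * H\<^sup>2)"
    using s by (simp add: power_mult_distrib ennreal_power)
  also have "(ennreal (1 / a) * F) * (ennreal (1 / b) * G) = ennreal ((1 / s)\<^sup>2) * (F * G)"
    using a b s by (simp add: mult_ac power_divide)
         (simp add: mult.assoc[symmetric] ennreal_mult[symmetric])
  finally have "ennreal (4 * (1/s)\<^sup>2) * (F * G) \<le> ennreal (4 * (1/s)\<^sup>2) * H\<^sup>2"
    by (simp add: ennreal_mult mult.assoc)
  then have "F * G \<le> H\<^sup>2"
    using s by (subst (asm) ennreal_mult_le_mult_iff) auto
  then show ?thesis by (simp add: F_def G_def H_def)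
qed

text \<open>Capping \<open>f\<close> and \<open>g\<close> at a constant preserves the hypothesis
  with the same \<open>h\<close>; monotone convergence removes the cap, infinite integrals
  included.\<close>

lemma Prekopa_Leindler_real:
  fixes f g h :: "real \<Rightarrow> ennreal"
  assumes [measurable]: "f \<in> borel_measurable borel" "g \<in> borel_measurable borel" "h \<in> borel_measurable borel"
    and le: "\<And>x y. f x * g y \<le> (h ((x + y) / 2))\<^sup>2"
  shows "(\<integral>\<^sup>+x. f x \<partial>lborel) * (\<integral>\<^sup>+x. g x \<partial>lborel) \<le> (\<integral>\<^sup>+x. h x \<partial>lborel)\<^sup>2"
proof -
  have sup: "(SUP k::nat. min (c::ennreal) (of_nat k)) = c" for c
  proof (cases "c = top")
    case True
    then show ?thesis by (simp add: ennreal_SUP_of_nat_eq_top)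
  next
    case False
    then obtain k :: nat where "c < of_nat k" using ennreal_Ex_less_of_nat[of c] by (auto simp: less_top)
    then have "c = min c (of_nat k)" by (simp add: min_absorb1 less_imp_le)
    then have "c \<le> (SUP k::nat. min c (of_nat k))" by (metis SUP_upper UNIV_I)
    then show ?thesis by (intro antisym SUP_least) auto
  qed
  have mono: "(SUP k::nat. (\<integral>\<^sup>+x. min (u x) (of_nat k) \<partial>lborel)) = (\<integral>\<^sup>+x. u x \<partial>lborel)"
    and inc: "incseq (\<lambda>k::nat. (\<integral>\<^sup>+x. min (u x) (of_nat k) \<partial>lborel))"
    if [measurable]: "u \<in> borel_measurable borel" for u :: "real \<Rightarrow> ennreal"
  proof -
    have min_mono: "min c (of_nat i) \<le> min c (of_nat j)" if "i \<le> j" for i j and c :: ennreal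
      by (intro min.mono order_refl of_nat_mono that)
    have "incseq (\<lambda>(k::nat) x. min (u x) (of_nat k))"
      by (simp add: incseq_def le_fun_def min_mono del: min.bounded_iff)
    then show "(SUP k::nat. (\<integral>\<^sup>+x. min (u x) (of_nat k) \<partial>lborel)) = (\<integral>\<^sup>+x. u x \<partial>lborel)"
      by (subst nn_integral_monotone_convergence_SUP[symmetric]) (auto simp: sup)
    show "incseq (\<lambda>k::nat. (\<integral>\<^sup>+x. min (u x) (of_nat k) \<partial>lborel))"
      by (simp add: incseq_def nn_integral_mono min_mono del: min.bounded_iff)
  qed
  have "(\<integral>\<^sup>+x. min (f x) (of_nat k) \<partial>lborel) * (\<integral>\<^sup>+x. min (g x) (of_nat k) \<partial>lborel) \<le> (\<integral>\<^sup>+x. h x \<partial>lborel)\<^sup>2" for k :: nat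
  proof (rule Prekopa_Leindler_real_bounded)
    fix x y
    have "min (f x) (of_nat k) * min (g y) (of_nat k) \<le> f x * g y" by (intro mult_mono) auto
    then show "min (f x) (of_nat k) * min (g y) (of_nat k) \<le> (h ((x + y) / 2))\<^sup>2"
      using le order_trans by blast
  next
    have "(SUP x. min (u x) (of_nat k)) \<le> (of_nat k :: ennreal)" for u :: "real \<Rightarrow> ennreal"
      by (intro SUP_least) auto
    then show "(SUP x. min (f x) (of_nat k)) < top" "(SUP x. min (g x) (of_nat k)) < top"
      by (metis le_less_trans of_nat_less_top)+
  qed auto
  \<comment> \<open>The two suprema are taken one after the other, which calls for independent
    indices; the common index \<open>max i j\<close> provides them.\<close>
  then have "(\<integral>\<^sup>+x. min (f x) (of_nat i) \<partial>lborel) * (\<integral>\<^sup>+x. min (g x) (of_nat j) \<partial>lborel) \<le> (\<integral>\<^sup>+x. h x \<partial>lborel)\<^sup>2" for i j :: nat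
    using mult_mono[OF incseqD[OF inc[of f], of i "max i j"] incseqD[OF inc[of g], of j "max i j"]] order_trans by fastforce
  then have "(SUP i::nat. (\<integral>\<^sup>+x. min (f x) (of_nat i) \<partial>lborel)) * (SUP j::nat. (\<integral>\<^sup>+x. min (g x) (of_nat j) \<partial>lborel)) \<le> (\<integral>\<^sup>+x. h x \<partial>lborel)\<^sup>2"
    unfolding SUP_mult_right_ennreal by (intro SUP_least) (simp add: SUP_mult_left_ennreal SUP_le_iff)
  then show ?thesis by (simp add: mono)
qed

text \<open>Induction on coordinates: for fixed values of the new coordinate, the induction
  hypothesis says that the partial integrals over the old ones again satisfy the hypothesis of the
  real case. Restricting to extensional functions matches the points of the product space.\<close>

lemma Prekopa_Leindler_PiM:
  fixes f g h :: "('i \<Rightarrow> real) \<Rightarrow> ennreal"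
  assumes "finite I"
    and "f \<in> borel_measurable (Pi\<^sub>M I (\<lambda>_. lborel))" "g \<in> borel_measurable (Pi\<^sub>M I (\<lambda>_. lborel))"
      "h \<in> borel_measurable (Pi\<^sub>M I (\<lambda>_. lborel))"
    and "\<And>x y. x \<in> extensional I \<Longrightarrow> y \<in> extensional I \<Longrightarrow> f x * g y \<le> (h (\<lambda>i\<in>I. (x i + y i) / 2))\<^sup>2"
  shows "(\<integral>\<^sup>+x. f x \<partial>Pi\<^sub>M I (\<lambda>_. lborel)) * (\<integral>\<^sup>+x. g x \<partial>Pi\<^sub>M I (\<lambda>_. lborel))
    \<le> (\<integral>\<^sup>+x. h x \<partial>Pi\<^sub>M I (\<lambda>_. lborel))\<^sup>2"
  using assms
proof (induction I arbitrary: f g h rule: finite_induct)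
  case empty
  interpret product_sigma_finite "\<lambda>_::'i. lborel :: real measure" by standard
  \<comment> \<open>The product over no coordinates is a point mass at the everywhere
    \<open>undefined\<close> function.\<close>
  show ?case
    using empty(4)[of "\<lambda>_. undefined" "\<lambda>_. undefined"] by (simp add: restrict_def nn_integral_empty)
next
  case (insert i I)
  interpret product_sigma_finite "\<lambda>_::'i. lborel :: real measure" by standard
  interpret I: finite_product_sigma_finite "\<lambda>_::'i. lborel :: real measure" I by standard fact
  have [measurable]: "(\<lambda>(y, x). x(i := y)) \<in> lborel \<Otimes>\<^sub>M Pi\<^sub>M I (\<lambda>_. lborel) \<rightarrow>\<^sub>M Pi\<^sub>M (insert i I) (\<lambda>_. lborel :: real measure)"
    by measurable
  have meas: "(\<lambda>y. \<integral>\<^sup>+x. u (x(i := y)) \<partial>Pi\<^sub>M I (\<lambda>_. lborel)) \<in> borel_measurable borel"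
    and meas': "\<And>y. (\<lambda>x. u (x(i := y))) \<in> borel_measurable (Pi\<^sub>M I (\<lambda>_. lborel))"
    if [measurable]: "u \<in> borel_measurable (Pi\<^sub>M (insert i I) (\<lambda>_. lborel))" for u :: "('i \<Rightarrow> real) \<Rightarrow> ennreal"
    by measurable
  have "(\<integral>\<^sup>+x. f (x(i := s)) \<partial>Pi\<^sub>M I (\<lambda>_. lborel)) * (\<integral>\<^sup>+x. g (x(i := t)) \<partial>Pi\<^sub>M I (\<lambda>_. lborel))
    \<le> (\<integral>\<^sup>+x. h (x(i := (s + t) / 2)) \<partial>Pi\<^sub>M I (\<lambda>_. lborel))\<^sup>2" for s t
  proof (rule insert.IH)
    fix x y :: "'i \<Rightarrow> real" assume "x \<in> extensional I" "y \<in> extensional I"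
    then have "x(i := s) \<in> extensional (insert i I)" "y(i := t) \<in> extensional (insert i I)"
      by (auto simp: extensional_def)
    from insert.prems(4)[OF this]
    have "f (x(i := s)) * g (y(i := t)) \<le> (h (\<lambda>j\<in>insert i I. ((x(i := s)) j + (y(i := t)) j) / 2))\<^sup>2" .
    also have "(\<lambda>j\<in>insert i I. ((x(i := s)) j + (y(i := t)) j) / 2) = (\<lambda>j\<in>I. (x j + y j) / 2)(i := (s + t) / 2)"
      using insert.hyps by (auto simp: fun_eq_iff restrict_def)
    finally show "f (x(i := s)) * g (y(i := t)) \<le> (h ((\<lambda>j\<in>I. (x j + y j) / 2)(i := (s + t) / 2)))\<^sup>2" .
  qed (intro meas' insert.prems)+
  then show ?case
    using insert.hyps insert.prems
    by (simp add: product_nn_integral_insert_rev) (intro Prekopa_Leindler_real meas)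
qed

text \<open>Multiplicative Brunn--Minkowski at ratio 1/2: Prekopa--Leindler for indicator functions,
  carried over by the coordinate map \<open>\<phi>\<close>.\<close>

lemma emeasure_lborel_midpoints:
  fixes A B C :: "'a::euclidean_space set"
  assumes [measurable]: "A \<in> sets borel" "B \<in> sets borel" "C \<in> sets borel"
    and mid: "\<And>a b. a \<in> A \<Longrightarrow> b \<in> B \<Longrightarrow> (1/2) *\<^sub>R (a + b) \<in> C"
  shows "emeasure lborel A * emeasure lborel B \<le> (emeasure lborel C)\<^sup>2"
proof -
  define \<phi> where "\<phi> = (\<lambda>f. \<Sum>b\<in>Basis. f b *\<^sub>R b :: 'a)"
  have [measurable]: "\<phi> \<in> Pi\<^sub>M Basis (\<lambda>_. lborel) \<rightarrow>\<^sub>M borel"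
    unfolding \<phi>_def by measurable
  have eq: "emeasure lborel X = (\<integral>\<^sup>+x. indicator X (\<phi> x) \<partial>Pi\<^sub>M Basis (\<lambda>_. lborel))" if [measurable]: "X \<in> sets borel" for X
    by (subst lborel_eq) (simp add: nn_integral_distr \<phi>_def[symmetric] flip: nn_integral_indicator)
  show ?thesis
    unfolding eq[OF assms(1)] eq[OF assms(2)] eq[OF assms(3)]
  proof (rule Prekopa_Leindler_PiM)
    fix x y :: "'a \<Rightarrow> real"
    have "\<phi> (\<lambda>i\<in>Basis. (x i + y i) / 2) = (1/2) *\<^sub>R (\<phi> x + \<phi> y)"
      by (simp add: \<phi>_def scaleR_sum_right sum.distrib[symmetric] scaleR_add_left[symmetric] add_divide_distrib cong: sum.cong)
    then show "(indicator A (\<phi> x) * indicator B (\<phi> y) :: ennreal) \<le> (indicator C (\<phi> (\<lambda>i\<in>Basis. (x i + y i) / 2)))\<^sup>2"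
      using mid[of "\<phi> x" "\<phi> y"] by (auto simp: indicator_def)
  qed auto
qed

text \<open>The midpoint inequality for \<open>E\<close> and its reflection, which has the same
  volume. This is the isodiametric mechanism: on half differences a bound on distances inside
  \<open>E\<close> becomes a bound on the norm.\<close>

lemma emeasure_lborel_half_differences:
  fixes E C :: "'a::euclidean_space set"
  assumes [measurable]: "E \<in> sets borel" "C \<in> sets borel"
    and diff: "\<And>x y. x \<in> E \<Longrightarrow> y \<in> E \<Longrightarrow> (1/2) *\<^sub>R (x - y) \<in> C"
  shows "emeasure lborel E \<le> emeasure lborel C"
proof -
  have m: "uminus -` E \<in> sets borel" by (rule measurable_sets_borel[OF _ assms(1)]) simp
  have "(lborel :: 'a measure) = distr lborel borel uminus"
    using lborel_affine[of "-1" "0::'a"] by (simp add: density_1)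
  then have "emeasure lborel E = emeasure (distr lborel borel uminus) E" by simp
  also have "\<dots> = emeasure lborel (uminus -` E)" by (simp add: emeasure_distr)
  finally have "emeasure lborel E * emeasure lborel E = emeasure lborel E * emeasure lborel (uminus -` E)" by simp
  also have "\<dots> \<le> (emeasure lborel C)\<^sup>2"
    using m diff by (intro emeasure_lborel_midpoints) (auto, metis diff_minus_eq_add minus_minus)
  finally have le: "emeasure lborel E * emeasure lborel E \<le> emeasure lborel C * emeasure lborel C"
    by (simp add: power2_eq_square)
  show ?thesis
  proof (cases "emeasure lborel C")
    case (real c)
    with le have "emeasure lborel E \<noteq> top"
      by (auto simp: ennreal_mult[symmetric] ennreal_top_mult top_unique)
    then obtain x where x: "emeasure lborel E = ennreal x" "x \<ge> 0" by (cases "emeasure lborel E") auto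
    with le real have "x * x \<le> c * c" by (simp add: ennreal_mult[symmetric])
    then have "x \<le> c" using real x by (metis power2_eq_square power2_le_imp_le)
    then show ?thesis using real x by (simp add: ennreal_leI)
  qed simp
qed

section \<open>Orthogonal invariance and cylinders\<close>

text \<open>An orthogonal map sends a disjoint Vitali packing by balls to one with the same radii. (The
  library's \<open>measure_orthogonal_image\<close> requires a well-ordered index type.)\<close>

lemma emeasure_lborel_open_le_orthogonal_image:
  fixes f :: "'a::euclidean_space \<Rightarrow> 'a"
  assumes f: "orthogonal_transformation f" and "open U"
  shows "emeasure lborel U \<le> emeasure lborel (f ` U)"
proof -
  define K where "K = {(x, r). 0 < r \<and> ball x r \<subseteq> U}"
  have "\<exists>i. i \<in> K \<and> x \<in> ball (fst i) (snd i) \<and> snd i < d" if "x \<in> U" "0 < d" for x d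
  proof -
    obtain e where e: "e > 0" "ball x e \<subseteq> U" using \<open>open U\<close> \<open>x \<in> U\<close> openE by blast
    have "ball x (min e (d/2)) \<subseteq> ball x e" by (intro subset_ball) auto
    then show ?thesis
      using e \<open>0 < d\<close> by (intro exI[of _ "(x, min e (d/2))"]) (auto simp: K_def)
  qed
  from Vitali_covering_theorem_balls[of U K fst snd, OF this]
  obtain C where C: "countable C" "C \<subseteq> K"
      "pairwise (\<lambda>i j. disjnt (ball (fst i) (snd i)) (ball (fst j) (snd j))) C"
      "negligible (U - (\<Union>i\<in>C. ball (fst i) (snd i)))" by blast
  define V where "V = (\<Union>i\<in>C. ball (fst i) (snd i))"
  have [measurable]: "open V" "U \<in> sets borel" using \<open>open U\<close> by (auto simp: V_def)
  have VU: "V \<subseteq> U" using C(2) by (fastforce simp: V_def K_def)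
  have fV: "f ` V = (\<Union>i\<in>C. ball (f (fst i)) (snd i))"
    by (simp add: V_def image_UN image_orthogonal_transformation_ball[OF f])
  have inj: "inj f" using f orthogonal_transformation_inj by blast
  have "U - V \<in> null_sets lborel"
    using C(4) by (simp add: V_def[symmetric] negligible_iff_null_sets null_sets_completion_iff)
  then have "emeasure lborel U = emeasure lborel V"
    using emeasure_Un_null_set[of V lborel "U - V"] VU by (simp add: Un_absorb1)
  also have "\<dots> = (\<integral>\<^sup>+i. emeasure lborel (ball (fst i) (snd i)) \<partial>count_space C)"
    unfolding V_def using C by (intro emeasure_UN_countable) (auto simp: disjoint_family_on_def pairwise_def disjnt_def)
  also have "\<dots> = (\<integral>\<^sup>+i. emeasure lborel (ball (f (fst i)) (snd i)) \<partial>count_space C)"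
    using C(2) by (intro nn_integral_cong) (auto simp: K_def emeasure_ball less_imp_le)
  also have "\<dots> = emeasure lborel (f ` V)"
    unfolding fV
  proof (rule emeasure_UN_countable[symmetric])
    show "disjoint_family_on (\<lambda>i. ball (f (fst i)) (snd i)) C"
      unfolding disjoint_family_on_def
    proof (intro ballI impI)
      fix i j assume ij: "i \<in> C" "j \<in> C" "i \<noteq> j"
      then have "ball (fst i) (snd i) \<inter> ball (fst j) (snd j) = {}"
        using C(3) by (auto simp: pairwise_def disjnt_def)
      then show "ball (f (fst i)) (snd i) \<inter> ball (f (fst j)) (snd j) = {}"
        by (simp add: image_orthogonal_transformation_ball[OF f, symmetric] image_Int[OF inj, symmetric])
    qed
  qed (use C in auto)
  also have "\<dots> \<le> emeasure lborel (f ` U)"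
  proof (rule emeasure_mono)
    show "f ` V \<subseteq> f ` U" using VU by auto
    have "open (f ` U)"
      using f \<open>open U\<close> by (simp add: open_surjective_linear_image orthogonal_transformation_linear orthogonal_transformation_surj)
    then show "f ` U \<in> sets lborel" by simp
  qed
  finally show ?thesis .
qed

text \<open>The one-sided estimate for \<open>f\<close> and for its inverse gives equality on the
  preimages of boxes, and boxes determine Lebesgue measure.\<close>

lemma distr_lborel_orthogonal:
  fixes f :: "'a::euclidean_space \<Rightarrow> 'a"
  assumes f: "orthogonal_transformation f"
  shows "distr lborel borel f = lborel"
proof (rule lborel_eqI[symmetric])
  have cont: "continuous_on UNIV f"
    using f by (intro linear_continuous_on) (simp add: orthogonal_transformation_linear linear_linear)
  then have [measurable]: "f \<in> borel_measurable borel" by (rule borel_measurable_continuous_onI)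
  fix l u :: 'a assume lu: "\<And>b. b \<in> Basis \<Longrightarrow> l \<bullet> b \<le> u \<bullet> b"
  let ?U = "f -` box l u"
  have "open ?U" using cont by (simp add: open_vimage open_box)
  have surj: "surj f" and bij: "bij f" using f orthogonal_transformation_surj orthogonal_transformation_bij by blast+
  have 1: "f ` ?U = box l u" using surj by simp
  have 2: "inv f ` box l u = ?U" using bij by (simp add: bij_vimage_eq_inv_image)
  have "emeasure lborel ?U = emeasure lborel (box l u)"
    using emeasure_lborel_open_le_orthogonal_image[OF f \<open>open ?U\<close>]
      emeasure_lborel_open_le_orthogonal_image[OF orthogonal_transformation_inv[OF f] open_box[of l u]]
    unfolding 1 2 by simp
  then show "emeasure (distr lborel borel f) (box l u) = ennreal (\<Prod>b\<in>Basis. (u - l) \<bullet> b)"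
    using lu by (simp add: emeasure_distr emeasure_lborel_box)
qed simp

text \<open>Here \<open>(norm x)\<^sup>2 - (x \<bullet> b)\<^sup>2\<close> is the squared distance
  to the axis. Splitting off the coordinate along \<open>b\<close> leaves a Euclidean ball in the
  remaining coordinates, with the index set \<open>Basis - {b}\<close> in place of a
  lower-dimensional type.\<close>

lemma emeasure_cylinder_Basis:
  fixes b :: "'a::euclidean_space"
  assumes b: "b \<in> Basis" and r: "0 < r" and uv: "u \<le> v"
  shows "emeasure lborel {x. u \<le> x \<bullet> b \<and> x \<bullet> b \<le> v \<and> (norm x)\<^sup>2 - (x \<bullet> b)\<^sup>2 \<le> r\<^sup>2} =
    ennreal (unit_ball_vol (real (DIM('a) - 1)) * r ^ (DIM('a) - 1) * (v - u))"
proof -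
  interpret product_sigma_finite "\<lambda>_::'a. lborel :: real measure" by standard
  define \<phi> where "\<phi> = (\<lambda>f. \<Sum>b\<in>Basis. f b *\<^sub>R b :: 'a)"
  define A where "A = Basis - {b}"
  have A: "finite A" "b \<notin> A" "insert b A = Basis" "card A = DIM('a) - 1"
    using b by (auto simp: A_def)
  have [measurable]: "\<phi> \<in> Pi\<^sub>M Basis (\<lambda>_. lborel) \<rightarrow>\<^sub>M borel"
    unfolding \<phi>_def by measurable
  then have [measurable]: "\<phi> \<in> Pi\<^sub>M (insert b A) (\<lambda>_. lborel) \<rightarrow>\<^sub>M borel"
    by (simp only: A(3))
  define S where "S = {x. u \<le> x \<bullet> b \<and> x \<bullet> b \<le> v \<and> (norm x)\<^sup>2 - (x \<bullet> b)\<^sup>2 \<le> r\<^sup>2}"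
  have [measurable]: "S \<in> sets borel" unfolding S_def by measurable
  have ph0: "\<phi> f \<bullet> i = f i" if "i \<in> Basis" for f i
    using that by (simp add: \<phi>_def inner_sum_left inner_Basis if_distrib cong: if_cong)
  then have ph1: "\<phi> f \<bullet> b = f b" for f using b by blast
  have ph2: "(norm (\<phi> f))\<^sup>2 - (\<phi> f \<bullet> b)\<^sup>2 = (\<Sum>i\<in>A. (f i)\<^sup>2)" for f
  proof -
    have "(norm (\<phi> f))\<^sup>2 = (\<Sum>i\<in>Basis. (f i)\<^sup>2)"
      by (subst power2_norm_eq_inner, subst euclidean_inner) (simp add: ph0 power2_eq_square)
    also have "\<dots> = (\<Sum>i\<in>A. (f i)\<^sup>2) + (f b)\<^sup>2"
      using A by (metis add.commute sum.insert)
    finally show ?thesis by (simp add: ph1)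
  qed
  have S_iff: "\<phi> f \<in> S \<longleftrightarrow> f b \<in> {u..v} \<and> (\<Sum>i\<in>A. (f i)\<^sup>2) \<le> r\<^sup>2" for f
    by (simp only: S_def mem_Collect_eq ph2) (simp add: ph1)
  have "emeasure lborel S = (\<integral>\<^sup>+x. indicator S (\<phi> x) \<partial>Pi\<^sub>M (insert b A) (\<lambda>_. lborel))"
    by (subst lborel_eq) (simp add: nn_integral_distr A \<phi>_def[symmetric] flip: nn_integral_indicator)
  also have "\<dots> = (\<integral>\<^sup>+y. \<integral>\<^sup>+x. indicator S (\<phi> (x(b := y))) \<partial>Pi\<^sub>M A (\<lambda>_. lborel) \<partial>lborel)"
    using A by (subst product_nn_integral_insert_rev) auto
  also have "\<dots> = (\<integral>\<^sup>+y. indicator {u..v} y * (\<integral>\<^sup>+x. indicator ({f. sqrt (\<Sum>i\<in>A. (f i)\<^sup>2) \<le> r} \<inter> space (Pi\<^sub>M A (\<lambda>_. lborel))) x \<partial>Pi\<^sub>M A (\<lambda>_. lborel)) \<partial>lborel)"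
  proof (intro nn_integral_cong, subst nn_integral_cmult[symmetric])
    fix y :: real
    have "(\<Sum>i\<in>A. ((x(b := y)) i)\<^sup>2) = (\<Sum>i\<in>A. (x i)\<^sup>2)" for x
      using A by (intro sum.cong) auto
    then show "(\<integral>\<^sup>+x. indicator S (\<phi> (x(b := y))) \<partial>Pi\<^sub>M A (\<lambda>_. lborel)) =
      (\<integral>\<^sup>+x. indicator {u..v} y * indicator ({f. sqrt (\<Sum>i\<in>A. (f i)\<^sup>2) \<le> r} \<inter> space (Pi\<^sub>M A (\<lambda>_. lborel))) x \<partial>Pi\<^sub>M A (\<lambda>_. lborel))"
      using r by (intro nn_integral_cong) (auto simp: indicator_def S_iff real_sqrt_le_iff' sum_nonneg)
  qed auto
  also have "\<dots> = (\<integral>\<^sup>+y. indicator {u..v} y * ennreal (unit_ball_vol (real (card A)) * r ^ card A) \<partial>(lborel :: real measure))"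
    using A r by (subst nn_integral_indicator) (auto simp: emeasure_cball_aux)
  also have "\<dots> = ennreal (unit_ball_vol (real (DIM('a) - 1)) * r ^ (DIM('a) - 1) * (v - u))"
    using uv r A by (simp add: nn_integral_multc ennreal_mult[symmetric] mult.commute)
  finally show ?thesis unfolding S_def .
qed

lemma emeasure_cylinder:
  fixes a :: "real^'n"
  assumes a: "norm a = 1" and r: "0 < r" and uv: "u \<le> v"
  shows "emeasure lborel {x. u \<le> x \<bullet> a \<and> x \<bullet> a \<le> v \<and> (norm x)\<^sup>2 - (x \<bullet> a)\<^sup>2 \<le> r\<^sup>2} =
    ennreal (unit_ball_vol (real (CARD('n) - 1)) * r ^ (CARD('n) - 1) * (v - u))"
proof -
  obtain b :: "real^'n" where b: "b \<in> Basis" using nonempty_Basis by blast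
  obtain f where f: "orthogonal_transformation f" "f b = a"
    using orthogonal_transformation_exists[of b a] a b by (auto simp: norm_Basis)
  have [measurable]: "f \<in> borel_measurable borel"
    using f by (intro borel_measurable_continuous_onI linear_continuous_on) (simp add: orthogonal_transformation_linear linear_linear)
  have ip: "f x \<bullet> a = x \<bullet> b" "norm (f x) = norm x" for x
    using f by (auto simp: orthogonal_transformation_def orthogonal_transformation_norm)
  have "emeasure lborel {x. u \<le> x \<bullet> a \<and> x \<bullet> a \<le> v \<and> (norm x)\<^sup>2 - (x \<bullet> a)\<^sup>2 \<le> r\<^sup>2} =
    emeasure (distr lborel borel f) {x. u \<le> x \<bullet> a \<and> x \<bullet> a \<le> v \<and> (norm x)\<^sup>2 - (x \<bullet> a)\<^sup>2 \<le> r\<^sup>2}"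
    by (simp add: distr_lborel_orthogonal[OF f(1)])
  also have "\<dots> = emeasure lborel {x. u \<le> x \<bullet> b \<and> x \<bullet> b \<le> v \<and> (norm x)\<^sup>2 - (x \<bullet> b)\<^sup>2 \<le> r\<^sup>2}"
    by (subst emeasure_distr) (auto simp: ip)
  also have "\<dots> = ennreal (unit_ball_vol (real (CARD('n) - 1)) * r ^ (CARD('n) - 1) * (v - u))"
    using emeasure_cylinder_Basis[OF b r uv] by simp
  finally show ?thesis .
qed

section \<open>Cone measure of small caps\<close>

text \<open>Surface measure of the unit sphere divided by the dimension: a spherical set gets the
  volume of the solid cone over it. The origin is removed because \<open>sgn 0 = 0\<close> is off
  the sphere.\<close>

definition cone_measure :: "'a::euclidean_space measure" where
  "cone_measure = distr (density lborel (indicator (cball 0 1 - {0}))) borel sgn"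

lemma sets_cone_measure [measurable_cong, simp]: "sets cone_measure = sets borel"
  and space_cone_measure [simp]: "space cone_measure = UNIV"
  by (auto simp: cone_measure_def)

lemma borel_measurable_sgn_euclidean [measurable]:
  "(sgn :: 'a::euclidean_space \<Rightarrow> 'a) \<in> borel_measurable borel"
  unfolding sgn_div_norm[abs_def] by measurable

lemma emeasure_cone_measure:
  assumes [measurable]: "K \<in> sets borel"
  shows "emeasure (cone_measure :: 'a::euclidean_space measure) K =
    emeasure lborel {x. x \<noteq> 0 \<and> norm x \<le> 1 \<and> sgn x \<in> K}"
proof -
  have "emeasure (cone_measure :: 'a measure) K =
    (\<integral>\<^sup>+x. indicator (cball 0 1 - {0}) x * indicator (sgn -` K) x \<partial>(lborel :: 'a measure))"
    using measurable_sets_borel[OF borel_measurable_sgn_euclidean assms]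
    by (simp add: cone_measure_def emeasure_distr) (subst emeasure_density, auto intro!: borel_measurable_indicator)
  also have "\<dots> = (\<integral>\<^sup>+x. indicator {x. x \<noteq> 0 \<and> norm x \<le> 1 \<and> sgn x \<in> K} x \<partial>(lborel :: 'a measure))"
    by (intro nn_integral_cong) (auto simp: indicator_def)
  finally show ?thesis by simp
qed

lemma emeasure_cone_measure_sphere:
  "emeasure (cone_measure :: 'a::euclidean_space measure) (sphere 0 1) = ennreal (unit_ball_vol DIM('a))"
proof -
  have "{x. x \<noteq> 0 \<and> norm x \<le> 1 \<and> sgn x \<in> sphere (0::'a) 1} = cball 0 1 - {0}"
    by (auto simp: norm_sgn)
  moreover have "emeasure lborel (cball (0::'a) 1 - {0}) = emeasure lborel (cball (0::'a) 1)"
    by (rule emeasure_Diff_null_set) auto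
  ultimately show ?thesis
    by (subst emeasure_cone_measure) (auto simp: emeasure_cball)
qed

lemma emeasure_cone_measure_Int_sphere:
  assumes [measurable]: "K \<in> sets borel"
  shows "emeasure (cone_measure :: 'a::euclidean_space measure) K = emeasure cone_measure (K \<inter> sphere 0 1)"
proof -
  have "{x. x \<noteq> 0 \<and> norm x \<le> 1 \<and> sgn x \<in> K} = {x::'a. x \<noteq> 0 \<and> norm x \<le> 1 \<and> sgn x \<in> K \<inter> sphere 0 1}"
    by (auto simp: norm_sgn)
  then show ?thesis by (simp add: emeasure_cone_measure)
qed

lemma finite_measure_cone_measure: "finite_measure (cone_measure :: 'a::euclidean_space measure)"
  by (rule finite_measureI)
     (simp add: emeasure_cone_measure_Int_sphere[of UNIV] emeasure_cone_measure_sphere)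

interpretation cone: finite_measure "cone_measure :: 'a::euclidean_space measure"
  by (rule finite_measure_cone_measure)

lemma emeasure_cone_scaled:
  fixes K :: "'a::euclidean_space set"
  assumes [measurable]: "K \<in> sets borel" and s: "0 < s"
  shows "emeasure lborel {x. x \<noteq> 0 \<and> norm x \<le> s \<and> sgn x \<in> K} = ennreal (s ^ DIM('a) * measure cone_measure K)"
proof -
  have [measurable]: "{x. x \<noteq> 0 \<and> norm x \<le> s \<and> sgn x \<in> K} \<in> sets borel" by measurable
  have "emeasure lborel {x. x \<noteq> 0 \<and> norm x \<le> s \<and> sgn x \<in> K} =
    emeasure (density (distr lborel borel (\<lambda>x. 0 + s *\<^sub>R x)) (\<lambda>_. \<bar>s\<bar> ^ DIM('a))) {x. x \<noteq> 0 \<and> norm x \<le> s \<and> sgn x \<in> K}"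
    using s by (subst lborel_affine[of s 0]) auto
  also have "\<dots> = ennreal (s ^ DIM('a)) * emeasure lborel ((\<lambda>x. s *\<^sub>R x) -` {x. x \<noteq> 0 \<and> norm x \<le> s \<and> sgn x \<in> K})"
    using s by (simp add: emeasure_density nn_integral_cmult emeasure_distr)
  also have "(\<lambda>x. s *\<^sub>R x) -` {x. x \<noteq> 0 \<and> norm x \<le> s \<and> sgn x \<in> K} = {x. x \<noteq> 0 \<and> norm x \<le> 1 \<and> sgn x \<in> K}"
    using s by (auto simp: sgn_scaleR)
  also have "emeasure lborel \<dots> = ennreal (measure cone_measure K)"
    by (simp add: emeasure_cone_measure[symmetric] cone.emeasure_eq_measure)
  finally show ?thesis using s by (simp add: ennreal_mult)
qed

lemma emeasure_cone_shell:
  fixes K :: "'a::euclidean_space set"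
  assumes [measurable]: "K \<in> sets borel" and s: "0 < s" "s < 1"
  shows "emeasure lborel {x. s < norm x \<and> norm x \<le> 1 \<and> sgn x \<in> K} = ennreal ((1 - s ^ DIM('a)) * measure cone_measure K)"
proof -
  have "{x. s < norm x \<and> norm x \<le> 1 \<and> sgn x \<in> K} =
    {x. x \<noteq> 0 \<and> norm x \<le> 1 \<and> sgn x \<in> K} - {x. x \<noteq> 0 \<and> norm x \<le> s \<and> sgn x \<in> K}"
    using s by auto
  also have "emeasure lborel \<dots> = ennreal (1 ^ DIM('a) * measure cone_measure K) - ennreal (s ^ DIM('a) * measure cone_measure K)"
    using emeasure_cone_scaled[OF assms(1), of 1] emeasure_cone_scaled[OF assms(1) s(1)] s
    by (subst emeasure_Diff) (auto)
  also have "\<dots> = ennreal ((1 - s ^ DIM('a)) * measure cone_measure K)"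
    using s by (subst ennreal_minus) (auto simp: algebra_simps)
  finally show ?thesis .
qed

lemma power2_norm_diff_scaleR:
  fixes x a :: "'a::real_inner"
  shows "(norm (x - c *\<^sub>R a))\<^sup>2 = (norm x)\<^sup>2 - 2 * c * (x \<bullet> a) + c\<^sup>2 * (norm a)\<^sup>2"
  by (simp add: power2_norm_eq_inner inner_diff_left inner_diff_right inner_commute)
     (simp add: power2_eq_square algebra_simps)

text \<open>A short solid cylinder about the axis through \<open>a\<close> fits into the shell of
  thickness \<open>r\<close> over the cap. Its height is about \<open>r\<close> and the shell takes
  a fraction of at most \<open>CARD('n) * r\<close> of the cone, so the thickness cancels and the
  flat volume of a ball of radius about \<open>r\<close> remains.\<close>

lemma cone_measure_cap_lower:
  fixes a :: "real^'n"
  assumes a: "norm a = 1" and r: "0 < r" "r < 1"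
  shows "unit_ball_vol (real (CARD('n) - 1)) * (r * (1 - r)\<^sup>2) ^ (CARD('n) - 1) * (1 - r)
    \<le> CARD('n) * measure cone_measure (cball a r)"
proof -
  \<comment> \<open>A chord of length \<open>r\<close> subtends an angle with squared sine
    \<open>r\<^sup>2 * (1 - r\<^sup>2 / 4)\<close>. One factor \<open>1 - r\<close> pays for the
    heights in \<open>D\<close>, known only to be at least \<open>1 - r\<close>; the other pays for
    \<open>1 - r\<^sup>2 / 4\<close>.\<close>
  define \<rho> where "\<rho> = r * (1 - r)\<^sup>2"
  define V where "V = unit_ball_vol (real (CARD('n) - 1)) * \<rho> ^ (CARD('n) - 1)"
  have [measurable]: "cball a r \<in> sets borel" by simp
  have V: "V \<ge> 0" using r by (auto simp: V_def \<rho>_def)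
  have \<rho>: "0 < \<rho>" "\<rho> \<le> r" using r by (auto simp: \<rho>_def mult_left_le power_le_one)
  have \<rho>2: "\<rho>\<^sup>2 \<le> r\<^sup>2" "\<rho>\<^sup>2 < 1" using \<rho> r by (auto simp: power_mono abs_square_less_1)
  have uv: "r - \<rho>\<^sup>2 \<ge> r * (1 - r)" using \<rho>2 by (simp add: power2_eq_square algebra_simps)
  \<comment> \<open>The top is lowered to \<open>1 - \<rho>\<^sup>2\<close> to keep \<open>D\<close>
    in the unit ball: \<open>(1 - \<rho>\<^sup>2)\<^sup>2 + \<rho>\<^sup>2 \<le> 1\<close>.\<close>
  define D where "D = {x. 1 - r \<le> x \<bullet> a \<and> x \<bullet> a \<le> 1 - \<rho>\<^sup>2 \<and> (norm x)\<^sup>2 - (x \<bullet> a)\<^sup>2 \<le> \<rho>\<^sup>2}"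
  have [measurable]: "D \<in> sets borel" unfolding D_def by measurable
  have "ennreal (V * (r - \<rho>\<^sup>2)) = emeasure lborel D"
    unfolding D_def using r \<rho> order_trans[OF _ uv, of 0] a
    by (subst emeasure_cylinder) (auto simp: V_def)
  \<comment> \<open>The deleted point is the only one of \<open>D\<close> with norm exactly
    \<open>1 - r\<close>, where the shell has a strict inequality.\<close>
  also have "\<dots> = emeasure lborel (D - {(1 - r) *\<^sub>R a})"
    by (rule emeasure_Diff_null_set[symmetric]) auto
  also have "\<dots> \<le> emeasure lborel {x. 1 - r < norm x \<and> norm x \<le> 1 \<and> sgn x \<in> cball a r}"
  proof (rule emeasure_mono)
    show "D - {(1 - r) *\<^sub>R a} \<subseteq> {x. 1 - r < norm x \<and> norm x \<le> 1 \<and> sgn x \<in> cball a r}"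
    proof
      fix x assume x: "x \<in> D - {(1 - r) *\<^sub>R a}"
      define t where "t = x \<bullet> a"
      have t: "1 - r \<le> t" "t \<le> 1 - \<rho>\<^sup>2" "(norm x)\<^sup>2 - t\<^sup>2 \<le> \<rho>\<^sup>2" using x by (auto simp: D_def t_def)
      have tn: "t \<le> norm x" using norm_cauchy_schwarz[of x a] a by (simp add: t_def)
      have n1: "norm x \<noteq> 1 - r"
      proof
        assume n: "norm x = 1 - r"
        then have "t = 1 - r" using t tn by simp
        then have "(norm (x - (1 - r) *\<^sub>R a))\<^sup>2 = 0"
          by (simp only: power2_norm_diff_scaleR n a t_def) (simp add: power2_eq_square algebra_simps)
        then have "x - (1 - r) *\<^sub>R a = 0" by (metis norm_eq_zero zero_eq_power2)
        then show False using x by simp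
      qed
      have "t\<^sup>2 \<le> (1 - \<rho>\<^sup>2)\<^sup>2" using t r by (intro power_mono) auto
      also have "\<dots> \<le> 1 - \<rho>\<^sup>2"
        using \<rho>2 by (simp add: power2_eq_square[of "1 - \<rho>\<^sup>2"] mult_left_le)
      finally have "(norm x)\<^sup>2 \<le> 1" using t by simp
      then have n2: "norm x \<le> 1" by (simp add: abs_square_le_1)
      have "(norm x * (1 - r\<^sup>2 / 2))\<^sup>2 \<le> t\<^sup>2"
      proof -
        have c: "0 \<le> (1 - r\<^sup>2 / 2)\<^sup>2" "(1 - r\<^sup>2 / 2)\<^sup>2 \<le> 1" using r
          by (auto simp: abs_square_le_1 abs_le_iff power_le_one intro: order_trans[of _ 1])
        have "(norm x)\<^sup>2 * (1 - r\<^sup>2 / 2)\<^sup>2 \<le> (t\<^sup>2 + \<rho>\<^sup>2) * (1 - r\<^sup>2 / 2)\<^sup>2"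
          using t by (intro mult_right_mono) auto
        also have "\<dots> \<le> t\<^sup>2 * (1 - r\<^sup>2 / 2)\<^sup>2 + \<rho>\<^sup>2" using c by (simp add: algebra_simps mult_left_le)
        also have "\<rho>\<^sup>2 \<le> t\<^sup>2 * (r\<^sup>2 * (1 - r\<^sup>2 / 4))"
        proof -
          have "\<rho>\<^sup>2 = (1 - r)\<^sup>2 * (r\<^sup>2 * (1 - r)\<^sup>2)" by (simp add: \<rho>_def power_mult_distrib power2_eq_square)
          also have "\<dots> \<le> t\<^sup>2 * (r\<^sup>2 * (1 - r\<^sup>2 / 4))"
          proof (intro mult_mono power_mono)
            show "(1 - r)\<^sup>2 \<le> 1 - r\<^sup>2 / 4"
              using r mult_left_le[of r r] by (simp add: power2_eq_square algebra_simps)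
          qed (use r t in auto)
          finally show ?thesis .
        qed
        finally have "(norm x)\<^sup>2 * (1 - r\<^sup>2 / 2)\<^sup>2 \<le> t\<^sup>2 * (1 - r\<^sup>2 / 2)\<^sup>2 + t\<^sup>2 * (r\<^sup>2 * (1 - r\<^sup>2 / 4))" by simp
        also have "\<dots> = t\<^sup>2 * ((1 - r\<^sup>2 / 2)\<^sup>2 + r\<^sup>2 * (1 - r\<^sup>2 / 4))" by (simp only: distrib_left)
        also have "(1 - r\<^sup>2 / 2)\<^sup>2 + r\<^sup>2 * (1 - r\<^sup>2 / 4) = 1" by (simp add: power2_eq_square algebra_simps)
        finally show ?thesis by (simp only: power_mult_distrib mult_1_right)
      qed
      then have m: "norm x * (1 - r\<^sup>2 / 2) \<le> t"
        by (rule power2_le_imp_le) (use t r in auto)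
      have x0: "norm x > 0" using tn t r by linarith
      have "(norm (a - sgn x))\<^sup>2 = 2 - 2 * (t / norm x)"
      proof -
        have "norm (sgn x) = 1" using x0 by (simp add: norm_sgn)
        moreover have "a \<bullet> sgn x = t / norm x"
          by (simp add: sgn_div_norm t_def inner_commute divide_inverse mult.commute)
        ultimately show ?thesis using power2_norm_diff_scaleR[of a 1 "sgn x"] a by simp
      qed
      also have "\<dots> \<le> r\<^sup>2" using m x0 by (simp add: field_simps)
      finally have "norm (a - sgn x) \<le> r" by (rule power2_le_imp_le) (use r in auto)
      then show "x \<in> {x. 1 - r < norm x \<and> norm x \<le> 1 \<and> sgn x \<in> cball a r}"
        using n1 n2 t tn by (auto simp: dist_norm)
    qed
  qed measurable
  also have "\<dots> = ennreal ((1 - (1 - r) ^ CARD('n)) * measure cone_measure (cball a r))"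
    using r by (subst emeasure_cone_shell) auto
  finally have "V * (r - \<rho>\<^sup>2) \<le> (1 - (1 - r) ^ CARD('n)) * measure cone_measure (cball a r)"
    using r by (subst (asm) ennreal_le_iff) (auto simp: power_le_one)
  also have "1 - (1 - r) ^ CARD('n) \<le> CARD('n) * r"
    using Bernoulli_inequality[of "-r" "CARD('n)"] r by simp
  finally have "V * (r - \<rho>\<^sup>2) \<le> r * (CARD('n) * measure cone_measure (cball a r))"
    by (simp add: mult_right_mono mult_ac)
  moreover have "V * (r * (1 - r)) \<le> V * (r - \<rho>\<^sup>2)" using V uv by (intro mult_left_mono)
  ultimately have "r * (V * (1 - r)) \<le> r * (CARD('n) * measure cone_measure (cball a r))" by (simp add: mult_ac)
  then show ?thesis using r by (simp add: V_def \<rho>_def)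
qed

text \<open>With shell thickness \<open>h\<close>, half differences have length at most \<open>(d + h) / 2\<close> and normal
  component at most \<open>(h + d\<^sup>2 / 2) / 2\<close>; choosing \<open>h = d * sqrt d\<close> below makes both errors negligible.\<close>

lemma cone_measure_le_diameter:
  fixes K :: "(real^'n) set"
  assumes [measurable]: "K \<in> sets borel" and K: "K \<subseteq> sphere 0 1" "K \<noteq> {}"
    and d: "\<And>x y. x \<in> K \<Longrightarrow> y \<in> K \<Longrightarrow> dist x y \<le> d" "0 < d" "d \<le> 1"
    and h: "0 < h" "h < 1"
  shows "(1 - (1 - h) ^ CARD('n)) * measure cone_measure K
    \<le> unit_ball_vol (real (CARD('n) - 1)) * ((d + h) / 2) ^ (CARD('n) - 1) * (h + d\<^sup>2 / 2)"
proof -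
  obtain a where a: "a \<in> K" using K by auto
  then have na: "norm a = 1" using K by auto
  define E where "E = {x::real^'n. 1 - h < norm x \<and> norm x \<le> 1 \<and> sgn x \<in> K}"
  have [measurable]: "E \<in> sets borel" unfolding E_def by measurable
  define \<tau> where "\<tau> = (h + d\<^sup>2 / 2) / 2"
  define D where "D = {x. - \<tau> \<le> x \<bullet> a \<and> x \<bullet> a \<le> \<tau> \<and> (norm x)\<^sup>2 - (x \<bullet> a)\<^sup>2 \<le> ((d + h) / 2)\<^sup>2}"
  have [measurable]: "D \<in> sets borel" unfolding D_def by measurable
  have ip: "(1 - h) * (1 - d\<^sup>2 / 2) \<le> x \<bullet> a" "x \<bullet> a \<le> 1" if x: "x \<in> E" for x
  proof -
    have n: "1 - h < norm x" "norm x \<le> 1" "sgn x \<in> K" using x by (auto simp: E_def)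
    have eq: "(norm (sgn x - a))\<^sup>2 = 2 - 2 * (sgn x \<bullet> a)"
      using power2_norm_diff_scaleR[of "sgn x" 1 a] na K n by auto
    have "(norm (sgn x - a))\<^sup>2 \<le> d\<^sup>2"
      using d(1)[OF n(3) a] by (intro power_mono) (auto simp: dist_norm)
    then have s: "1 - d\<^sup>2 / 2 \<le> sgn x \<bullet> a" using eq by simp
    have "norm x \<noteq> 0" using n h by linarith
    then have xa: "x \<bullet> a = norm x * (sgn x \<bullet> a)" by (simp add: sgn_div_norm)
    have "d\<^sup>2 \<le> 1" using d by (simp add: power_le_one)
    then show "(1 - h) * (1 - d\<^sup>2 / 2) \<le> x \<bullet> a"
      unfolding xa using n s h by (intro mult_mono) auto
    show "x \<bullet> a \<le> 1" using norm_cauchy_schwarz[of x a] n na by simp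
  qed
  have width: "1 - (1 - h) * (1 - d\<^sup>2 / 2) \<le> 2 * \<tau>"
    using h by (simp add: \<tau>_def algebra_simps)
  have "emeasure lborel E \<le> emeasure lborel D"
  proof (rule emeasure_lborel_half_differences)
    fix x y assume xy: "x \<in> E" "y \<in> E"
    have n: "1 - h < norm x" "norm x \<le> 1" "1 - h < norm y" "norm y \<le> 1" "sgn x \<in> K" "sgn y \<in> K"
      using xy by (auto simp: E_def)
    have "\<bar>(x - y) \<bullet> a\<bar> \<le> 2 * \<tau>"
      using ip[OF xy(1)] ip[OF xy(2)] width by (auto simp: inner_diff_left)
    moreover have "norm (x - y) \<le> d + h"
    proof -
      \<comment> \<open>An angular part, at most \<open>d\<close> because
        \<open>norm x \<le> 1\<close>, and a radial part, at most the thickness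
        \<open>h\<close>.\<close>
      have "x - y = norm x *\<^sub>R (sgn x - sgn y) + (norm x - norm y) *\<^sub>R sgn y"
      proof -
        have "norm z *\<^sub>R sgn z = z" for z :: "real^'n"
          by (cases "z = 0") (auto simp: sgn_div_norm)
        then show ?thesis by (simp add: algebra_simps)
      qed
      then have "norm (x - y) \<le> norm x * norm (sgn x - sgn y) + \<bar>norm x - norm y\<bar> * norm (sgn y)"
        by (metis norm_scaleR norm_triangle_ineq abs_norm_cancel)
      also have "norm x * norm (sgn x - sgn y) \<le> 1 * d"
        using n d by (intro mult_mono) (auto simp: dist_norm)
      also have "\<bar>norm x - norm y\<bar> * norm (sgn y) \<le> h * 1"
        using n h by (intro mult_mono) (auto simp: norm_sgn)
      finally show ?thesis by simp
    qed
    then have "(norm (x - y))\<^sup>2 \<le> (d + h)\<^sup>2" by (intro power_mono) auto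
    then have "(norm (x - y))\<^sup>2 - ((x - y) \<bullet> a)\<^sup>2 \<le> (d + h)\<^sup>2"
      using zero_le_power2[of "(x - y) \<bullet> a"] by linarith
    ultimately show "(1/2) *\<^sub>R (x - y) \<in> D"
      by (auto simp: D_def power_divide abs_le_iff)
  qed auto
  also have "emeasure lborel E = ennreal ((1 - (1 - h) ^ CARD('n)) * measure cone_measure K)"
    unfolding E_def using h by (subst emeasure_cone_shell) auto
  also have "emeasure lborel D = ennreal (unit_ball_vol (real (CARD('n) - 1)) * ((d + h) / 2) ^ (CARD('n) - 1) * (h + d\<^sup>2 / 2))"
  proof -
    have "\<tau> > 0" using d h by (auto simp: \<tau>_def intro: add_pos_nonneg)
    then have "emeasure lborel D = ennreal (unit_ball_vol (real (CARD('n) - 1)) * ((d + h) / 2) ^ (CARD('n) - 1) * (\<tau> - - \<tau>))"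
      unfolding D_def using d h na by (intro emeasure_cylinder) auto
    also have "\<tau> - - \<tau> = h + d\<^sup>2 / 2" by (simp add: \<tau>_def)
    finally show ?thesis .
  qed
  finally show ?thesis using d h by (subst (asm) ennreal_le_iff) auto
qed

section \<open>Asymptotic form of the two cap estimates\<close>

lemma one_minus_power_ge:
  fixes t :: real
  assumes "0 \<le> t" "t \<le> 1"
  shows "real n * t ^ (n - 1) * (1 - t) \<le> 1 - t ^ n"
proof -
  have "real n * t ^ (n - 1) = (\<Sum>i<n. t ^ (n - 1))" by simp
  also have "\<dots> \<le> (\<Sum>i<n. t ^ i)" using assms by (intro sum_mono power_decreasing) auto
  finally have "(1 - t) * (real n * t ^ (n - 1)) \<le> (1 - t) * (\<Sum>i<n. t ^ i)"
    using assms by (intro mult_left_mono) auto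
  then show ?thesis by (simp add: one_diff_power_eq mult_ac)
qed

lemma cone_measure_cap_lower_asymp:
  fixes e :: real
  assumes e: "e > 0"
  shows "\<exists>\<delta>>0. \<delta> < 1 \<and> (\<forall>(a::real^'n) r. norm a = 1 \<longrightarrow> 0 < r \<longrightarrow> r \<le> \<delta> \<longrightarrow>
    unit_ball_vol (real (CARD('n) - 1)) * r ^ (CARD('n) - 1) \<le> (1 + e) * (CARD('n) * measure cone_measure (cball a r)))"
proof -
  \<comment> \<open>This counts the lost factors \<open>1 - r\<close>: two for each of the
    directions across the cylinder and one for its height.\<close>
  define k where "k = 2 * (CARD('n) - 1) + 1"
  have "((\<lambda>r::real. (1 + e) * (1 - r) ^ k) \<longlongrightarrow> (1 + e) * (1 - 0) ^ k) (at_right 0)"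
    by (intro tendsto_intros)
  then have "eventually (\<lambda>r::real. (1 + e) * (1 - r) ^ k > 1) (at_right 0)"
    using e by (intro order_tendstoD) auto
  then obtain b :: real where b: "b > 0" "\<And>r. 0 < r \<Longrightarrow> r < b \<Longrightarrow> (1 + e) * (1 - r) ^ k > 1"
    by (auto simp: eventually_at_right_field)
  have *: "unit_ball_vol (real (CARD('n) - 1)) * r ^ (CARD('n) - 1) \<le> (1 + e) * (CARD('n) * measure cone_measure (cball a r))"
    if a: "norm (a::real^'n) = 1" and r: "0 < r" "r < b" "r < 1" for a r
  proof -
    define V where "V = unit_ball_vol (real (CARD('n) - 1)) * r ^ (CARD('n) - 1)"
    have "V \<ge> 0" using r by (simp add: V_def)
    then have "V * 1 \<le> V * ((1 + e) * (1 - r) ^ k)"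
      using b(2)[OF r(1,2)] by (intro mult_left_mono) auto
    also have "\<dots> = (1 + e) * (unit_ball_vol (real (CARD('n) - 1)) * (r * (1 - r)\<^sup>2) ^ (CARD('n) - 1) * (1 - r))"
      by (simp add: V_def k_def power_mult_distrib power_mult[symmetric] mult_ac)
    also have "\<dots> \<le> (1 + e) * (CARD('n) * measure cone_measure (cball a r))"
      using e cone_measure_cap_lower[OF a r(1,3)] by (intro mult_left_mono) auto
    finally show ?thesis by (simp add: V_def)
  qed
  have "min (b/2) (1/2) > 0" "min (b/2) (1/2) < b" "min (b/2) (1/2) < 1" using b by auto
  then show ?thesis
    by (intro exI[of _ "min (b/2) (1/2)"] conjI allI impI *) linarith+
qed

text \<open>Isodiametric inequality for small spherical sets, with relative error \<open>e\<close>.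
  It uses a positive bound \<open>d\<close> on distances instead of the diameter itself; sets of
  diameter 0 are then reached by a limit.\<close>

lemma cone_measure_le_diameter_asymp:
  fixes e :: real
  assumes e: "e > 0"
  shows "\<exists>\<delta>>0. \<forall>(K::(real^'n) set) d. K \<in> sets borel \<longrightarrow> K \<subseteq> sphere 0 1 \<longrightarrow> 0 < d \<longrightarrow> d \<le> \<delta> \<longrightarrow>
    (\<forall>x\<in>K. \<forall>y\<in>K. dist x y \<le> d) \<longrightarrow>
    CARD('n) * measure cone_measure K \<le> (1 + e) * (unit_ball_vol (real (CARD('n) - 1)) * (d / 2) ^ (CARD('n) - 1))"
proof -
  define k where "k = CARD('n) - 1"
  \<comment> \<open>The relative error after \<open>h = d * sqrt d\<close>: the first factor comes
    from the radius \<open>(d + h) / 2\<close>, the second from the height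
    \<open>h + d\<^sup>2 / 2\<close> compared with \<open>h\<close>, the denominator from the volume
    of the shell.\<close>
  define \<phi> where "\<phi> = (\<lambda>d::real. (1 + sqrt d) ^ k * (1 + sqrt d / 2) / (1 - d * sqrt d) ^ k)"
  have "(\<phi> \<longlongrightarrow> (1 + sqrt 0) ^ k * (1 + sqrt 0 / 2) / (1 - 0 * sqrt 0) ^ k) (at_right 0)"
    unfolding \<phi>_def by (intro tendsto_intros) auto
  then have "eventually (\<lambda>d. \<phi> d < 1 + e) (at_right 0)"
    using e by (intro order_tendstoD) auto
  then obtain b :: real where b: "b > 0" "\<And>d. 0 < d \<Longrightarrow> d < b \<Longrightarrow> \<phi> d < 1 + e"
    by (auto simp: eventually_at_right_field)
  have *: "CARD('n) * measure cone_measure K \<le> (1 + e) * (unit_ball_vol (real (CARD('n) - 1)) * (d / 2) ^ (CARD('n) - 1))"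
    if K: "K \<in> sets borel" "K \<subseteq> sphere 0 1" and d: "0 < d" "d < b" "d < 1"
      and diam: "\<forall>x\<in>K. \<forall>y\<in>K. dist x y \<le> d" for K :: "(real^'n) set" and d
  proof (cases "K = {}")
    case True
    then show ?thesis using d e by simp
  next
    case False
    define m where "m = measure cone_measure K"
    define c where "c = unit_ball_vol (real (CARD('n) - 1))"
    define V where "V = c * (d / 2) ^ k"
    define h where "h = d * sqrt d"
    have sd: "0 < sqrt d" "sqrt d < 1" using d by auto
    have h: "0 < h" "h < 1" using d sd mult_strict_mono[of d 1 "sqrt d" 1] by (auto simp: h_def)
    have "h * (CARD('n) * m * (1 - h) ^ k) \<le> (1 - (1 - h) ^ CARD('n)) * m"
      using mult_right_mono[OF one_minus_power_ge[of "1 - h" "CARD('n)"], of m] h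
      by (simp add: m_def k_def mult_ac)
    also have "\<dots> \<le> c * ((d + h) / 2) ^ k * (h + d\<^sup>2 / 2)"
      unfolding m_def k_def c_def using K False diam d h by (intro cone_measure_le_diameter) auto
    also have "(d + h) / 2 = (d / 2) * (1 + sqrt d)" by (simp add: h_def algebra_simps)
    also have "h + d\<^sup>2 / 2 = h * (1 + sqrt d / 2)"
    proof -
      have "sqrt d * sqrt d = d" using d by simp
      then show ?thesis by (simp add: h_def power2_eq_square algebra_simps)
    qed
    finally have "h * (CARD('n) * m * (1 - h) ^ k) \<le> h * (V * ((1 + sqrt d) ^ k * (1 + sqrt d / 2)))"
      by (simp only: V_def power_mult_distrib mult_ac)
    then have "CARD('n) * m * (1 - h) ^ k \<le> V * ((1 + sqrt d) ^ k * (1 + sqrt d / 2))"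
      using h by simp
    then have "CARD('n) * m \<le> V * \<phi> d"
      using h by (simp add: \<phi>_def h_def[symmetric] pos_le_divide_eq)
    also have "\<dots> \<le> V * (1 + e)"
      using b(2)[OF d(1,2)] d by (intro mult_left_mono) (auto simp: V_def c_def)
    finally show ?thesis by (simp add: m_def V_def c_def k_def mult_ac)
  qed
  have "min (b/2) (1/2) > 0" "min (b/2) (1/2) < b" "min (b/2) (1/2) < 1" using b by auto
  then show ?thesis
    by (intro exI[of _ "min (b/2) (1/2)"] conjI allI impI *) (assumption | linarith)+
qed

section \<open>Hausdorff measure of the sphere\<close>

text \<open>Hausdorff covers are \<open>nat\<close>-sequences, Vitali families are countable sets of
  balls. Indices outside the enumeration contribute nothing, which corresponds to padding the cover
  with empty sets.\<close>

lemma suminf_enumerate_countable: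
  fixes f :: "'i \<Rightarrow> ennreal"
  assumes I: "countable I"
  shows "(\<Sum>n. if n \<in> to_nat_on I ` I then f (from_nat_into I n) else 0) = (\<integral>\<^sup>+i. f i \<partial>count_space I)"
proof -
  let ?N = "to_nat_on I ` I"
  have bij: "bij_betw (to_nat_on I) I ?N"
    using inj_on_to_nat_on[OF I] by (simp add: bij_betw_def)
  have "(\<Sum>n. if n \<in> ?N then f (from_nat_into I n) else 0) =
      (\<integral>\<^sup>+n. f (from_nat_into I n) * indicator ?N n \<partial>count_space UNIV)"
    by (subst nn_integral_count_space_nat[symmetric]) (auto intro!: nn_integral_cong simp: indicator_def)
  also have "\<dots> = (\<integral>\<^sup>+n. f (from_nat_into I n) \<partial>count_space ?N)"
    by (simp add: nn_integral_count_space_indicator)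
  also have "\<dots> = (\<integral>\<^sup>+i. f i \<partial>count_space I)"
    using I by (subst nn_integral_bij_count_space[OF bij, symmetric]) (auto intro!: nn_integral_cong)
  finally show ?thesis .
qed

lemma UN_enumerate_countable:
  assumes I: "countable I"
  shows "(\<Union>n. if n \<in> to_nat_on I ` I then B (from_nat_into I n) else {}) = (\<Union>i\<in>I. B i)"
proof -
  have "(\<Union>n. if n \<in> to_nat_on I ` I then B (from_nat_into I n) else {}) = (\<Union>n\<in>to_nat_on I ` I. B (from_nat_into I n))"
    by auto
  also have "\<dots> = (\<Union>i\<in>I. B (from_nat_into I (to_nat_on I i)))" by blast
  also have "\<dots> = (\<Union>i\<in>I. B i)" using I by (intro SUP_cong) auto
  finally show ?thesis .
qed

lemma emeasure_UN_le_count_space: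
  assumes I: "countable I" and [measurable]: "\<And>i. i \<in> I \<Longrightarrow> B i \<in> sets M"
  shows "emeasure M (\<Union>i\<in>I. B i) \<le> (\<integral>\<^sup>+i. emeasure M (B i) \<partial>count_space I)"
proof -
  let ?C = "\<lambda>n. if n \<in> to_nat_on I ` I then B (from_nat_into I n) else {}"
  have "emeasure M (\<Union>n. ?C n) \<le> (\<Sum>n. emeasure M (?C n))"
    using I by (intro emeasure_subadditive_countably) auto
  also have "\<dots> = (\<Sum>n. if n \<in> to_nat_on I ` I then emeasure M (B (from_nat_into I n)) else 0)"
    by (intro suminf_cong) auto
  also have "\<dots> = (\<integral>\<^sup>+i. emeasure M (B i) \<partial>count_space I)"
    by (rule suminf_enumerate_countable[OF I])
  finally show ?thesis by (simp only: UN_enumerate_countable[OF I])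
qed

section \<open>Calculus of the Hausdorff premeasure and the lower bound\<close>

definition hausdorff_weight :: "nat \<Rightarrow> 'a::metric_space set \<Rightarrow> ennreal" where
  "hausdorff_weight k B = (if B = {} then 0 else ennreal (unit_ball_vol (real k) * (diameter B / 2) ^ k))"

lemma hausdorff_weight_empty [simp]: "hausdorff_weight k {} = 0"
  by (simp add: hausdorff_weight_def)

lemma hausdorff_premeasure_le_suminf:
  assumes "A \<subseteq> (\<Union>i. C i)" "\<And>i. bounded (C i)" "\<And>i. diameter (C i) \<le> \<delta>"
  shows "hausdorff_premeasure k \<delta> A \<le> (\<Sum>i. hausdorff_weight k (C i))"
  unfolding hausdorff_premeasure_def hausdorff_weight_def by (rule INF_lower) (use assms in auto)

lemma hausdorff_premeasure_less_obtain:
  assumes "hausdorff_premeasure k \<delta> A < c"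
  obtains C where "A \<subseteq> (\<Union>i. C i)" "\<And>i. bounded (C i)" "\<And>i. diameter (C i) \<le> \<delta>"
    "(\<Sum>i. hausdorff_weight k (C i)) < c"
  using assms unfolding hausdorff_premeasure_def hausdorff_weight_def INF_less_iff by auto

lemma hausdorff_premeasure_le_count_space:
  assumes "countable I" "0 \<le> \<delta>" "A \<subseteq> (\<Union>i\<in>I. B i)" "\<And>i. i \<in> I \<Longrightarrow> bounded (B i)" "\<And>i. i \<in> I \<Longrightarrow> diameter (B i) \<le> \<delta>"
  shows "hausdorff_premeasure k \<delta> A \<le> (\<integral>\<^sup>+i. hausdorff_weight k (B i) \<partial>count_space I)"
proof -
  let ?C = "\<lambda>n. if n \<in> to_nat_on I ` I then B (from_nat_into I n) else {}"
  have "hausdorff_premeasure k \<delta> A \<le> (\<Sum>n. hausdorff_weight k (?C n))"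
    using assms by (intro hausdorff_premeasure_le_suminf) (auto simp: UN_enumerate_countable simp del: UN_iff)
  also have "\<dots> = (\<Sum>n. if n \<in> to_nat_on I ` I then hausdorff_weight k (B (from_nat_into I n)) else 0)"
    by (intro suminf_cong) auto
  also have "\<dots> = (\<integral>\<^sup>+i. hausdorff_weight k (B i) \<partial>count_space I)"
    by (rule suminf_enumerate_countable[OF assms(1)])
  finally show ?thesis .
qed

lemma hausdorff_premeasure_Un_le:
  assumes "bounded B" "diameter B \<le> \<delta>" "A \<subseteq> B \<union> A'"
  shows "hausdorff_premeasure k \<delta> A \<le> hausdorff_weight k B + hausdorff_premeasure k \<delta> A'"
proof (rule ennreal_le_epsilon)
  fix e :: real assume e: "0 < e" and fin: "hausdorff_weight k B + hausdorff_premeasure k \<delta> A' < top"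
  then have "hausdorff_premeasure k \<delta> A' < hausdorff_premeasure k \<delta> A' + ennreal e"
    by (cases "hausdorff_premeasure k \<delta> A'") (auto simp: ennreal_plus[symmetric] ennreal_less_iff simp del: ennreal_plus)
  then obtain C where C: "A' \<subseteq> (\<Union>i. C i)" "\<And>i. bounded (C i)" "\<And>i. diameter (C i) \<le> \<delta>"
    "(\<Sum>i. hausdorff_weight k (C i)) < hausdorff_premeasure k \<delta> A' + ennreal e"
    by (rule hausdorff_premeasure_less_obtain) auto
  have "hausdorff_premeasure k \<delta> A \<le> (\<Sum>i. hausdorff_weight k (case_nat B C i))"
  proof (rule hausdorff_premeasure_le_suminf)
    show "A \<subseteq> (\<Union>i. case_nat B C i)"
    proof
      fix x assume "x \<in> A"
      then consider "x \<in> B" | i where "x \<in> C i" using assms C by blast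
      then show "x \<in> (\<Union>i. case_nat B C i)"
      proof cases
        case 1
        then have "x \<in> case_nat B C 0" by simp
        then show ?thesis by blast
      next
        case (2 i)
        then have "x \<in> case_nat B C (Suc i)" by simp
        then show ?thesis by blast
      qed
    qed
  qed (use assms C in \<open>auto split: nat.split\<close>)
  also have "\<dots> = hausdorff_weight k B + (\<Sum>i. hausdorff_weight k (C i))"
    by (subst suminf_offset[of _ 1]) auto
  also have "\<dots> \<le> hausdorff_weight k B + hausdorff_premeasure k \<delta> A' + ennreal e"
    using C(4) by (simp add: add.assoc add_left_mono less_imp_le)
  finally show "hausdorff_premeasure k \<delta> A \<le> hausdorff_weight k B + hausdorff_premeasure k \<delta> A' + ennreal e" .
qed

lemma hausdorff_premeasure_mono:
  assumes "A \<subseteq> A'"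
  shows "hausdorff_premeasure k \<delta> A \<le> hausdorff_premeasure k \<delta> A'"
  unfolding hausdorff_premeasure_def by (rule INF_superset_mono) (use assms in auto)

lemma hausdorff_premeasure_finite_Un_le:
  assumes "finite F" "\<And>i. i \<in> F \<Longrightarrow> bounded (B i)" "\<And>i. i \<in> F \<Longrightarrow> diameter (B i) \<le> \<delta>" "A \<subseteq> (\<Union>i\<in>F. B i) \<union> A'"
  shows "hausdorff_premeasure k \<delta> A \<le> (\<Sum>i\<in>F. hausdorff_weight k (B i)) + hausdorff_premeasure k \<delta> A'"
  using assms
proof (induction F arbitrary: A rule: finite_induct)
  case empty
  then show ?case using hausdorff_premeasure_mono[of A A'] by simp
next
  case (insert i F)
  have "hausdorff_premeasure k \<delta> A \<le> hausdorff_weight k (B i) + hausdorff_premeasure k \<delta> (A - B i)"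
    by (rule hausdorff_premeasure_Un_le) (simp_all add: insert.prems)
  also have "hausdorff_premeasure k \<delta> (A - B i) \<le> (\<Sum>i\<in>F. hausdorff_weight k (B i)) + hausdorff_premeasure k \<delta> A'"
  proof (rule insert.IH)
    show "A - B i \<subseteq> (\<Union>i\<in>F. B i) \<union> A'" using insert.prems(3) by blast
  qed (simp_all add: insert.prems)
  finally show ?case using insert.hyps by (simp add: add.assoc add_left_mono)
qed

text \<open>Each covering set is replaced by the trace of its closure on the sphere: it becomes
  Borel without any increase in diameter. The isodiametric bound and countable subadditivity then
  compare the total weight with the mass of \<open>cone_measure\<close>.\<close>

lemma hausdorff_measure_sphere_ge:
  shows "ennreal (real CARD('n) * unit_ball_vol (real CARD('n))) \<le> hausdorff_measure (CARD('n) - 1) (sphere (0::real^'n) 1)"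
proof -
  let ?n = "real CARD('n)" and ?k = "CARD('n) - 1" and ?S = "sphere (0::real^'n) 1"
  have main: "ennreal (?n * unit_ball_vol ?n) \<le> ennreal (1 + e) * hausdorff_measure ?k ?S" if e: "e > 0" for e :: real
  proof -
    from cone_measure_le_diameter_asymp[OF e, where 'n='n]
    obtain \<delta> where \<delta>: "\<delta> > 0" and diam: "\<forall>(K::(real^'n) set) d. K \<in> sets borel \<longrightarrow> K \<subseteq> ?S \<longrightarrow> 0 < d \<longrightarrow> d \<le> \<delta> \<longrightarrow>
      (\<forall>x\<in>K. \<forall>y\<in>K. dist x y \<le> d) \<longrightarrow>
      ?n * measure cone_measure K \<le> (1 + e) * (unit_ball_vol (real ?k) * (d / 2) ^ ?k)"
      by (elim exE conjE)
    have cov: "ennreal (?n * unit_ball_vol ?n) \<le> ennreal (1 + e) * (\<Sum>i. hausdorff_weight ?k (C i))"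
      if C: "?S \<subseteq> (\<Union>i. C i)" "\<And>i. bounded (C i)" "\<And>i. diameter (C i) \<le> \<delta> / 2" for C :: "nat \<Rightarrow> (real^'n) set"
    proof -
      define K where "K = (\<lambda>i. closure (C i) \<inter> ?S)"
      have K [measurable]: "K i \<in> sets borel" for i by (auto simp: K_def intro!: borel_closed)
      have each: "ennreal ?n * emeasure cone_measure (K i) \<le> ennreal (1 + e) * hausdorff_weight ?k (C i)" for i
      proof (cases "C i = {}")
        case True
        then show ?thesis by (simp add: K_def)
      next
        case False
        have d0: "0 \<le> diameter (C i)" by (simp add: C diameter_ge_0)
        have "?n * measure cone_measure (K i) \<le> (1 + e) * (unit_ball_vol (real ?k) * (diameter (C i) / 2) ^ ?k)"
        \<comment> \<open>The estimate requires \<open>d > 0\<close>, but the piece may be a single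
          point; so \<open>d\<close> decreases to the diameter. The cover was restricted to
          diameters at most \<open>\<delta> / 2\<close> to leave room for such \<open>d\<close>
          below \<open>\<delta>\<close>.\<close>
        proof (rule tendsto_lowerbound)
          show "((\<lambda>d. (1 + e) * (unit_ball_vol (real ?k) * (d / 2) ^ ?k)) \<longlongrightarrow>
            (1 + e) * (unit_ball_vol (real ?k) * (diameter (C i) / 2) ^ ?k)) (at_right (diameter (C i)))"
            by (intro tendsto_intros) auto
          have "eventually (\<lambda>d. diameter (C i) < d \<and> d < \<delta>) (at_right (diameter (C i)))"
            using C(3)[of i] \<delta> by (auto simp: eventually_at_right_field intro!: exI[of _ \<delta>])
          then show "eventually (\<lambda>d. ?n * measure cone_measure (K i) \<le> (1 + e) * (unit_ball_vol (real ?k) * (d / 2) ^ ?k)) (at_right (diameter (C i)))"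
          proof eventually_elim
            case (elim d)
            show ?case
            proof (rule diam[rule_format])
              fix x y assume "x \<in> K i" "y \<in> K i"
              then have "dist x y \<le> diameter (closure (C i))"
                using C(2) by (intro diameter_bounded_bound) (auto simp: K_def bounded_closure)
              then show "dist x y \<le> d" using elim C(2) by (simp add: diameter_closure)
            qed (use elim d0 in \<open>auto simp: K_def\<close>)
          qed
        qed simp
        then have "ennreal (?n * measure cone_measure (K i)) \<le> ennreal ((1 + e) * (unit_ball_vol (real ?k) * (diameter (C i) / 2) ^ ?k))"
          by (rule ennreal_leI)
        then show ?thesis using False e d0
          by (simp add: hausdorff_weight_def cone.emeasure_eq_measure ennreal_mult)
      qed
      have "ennreal (?n * unit_ball_vol ?n) = ennreal ?n * emeasure cone_measure ?S"
        by (simp add: emeasure_cone_measure_sphere ennreal_mult)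
      also have "emeasure cone_measure ?S \<le> emeasure cone_measure (\<Union>i. K i)"
      proof (rule emeasure_mono)
        show "?S \<subseteq> (\<Union>i. K i)"
        proof
          fix x assume x: "x \<in> ?S"
          then obtain i where "x \<in> C i" using C(1) by blast
          then have "x \<in> K i" using x closure_subset[of "C i"] by (auto simp only: K_def)
          then show "x \<in> (\<Union>i. K i)" by blast
        qed
      qed auto
      also have "\<dots> \<le> (\<Sum>i. emeasure cone_measure (K i))"
        by (intro emeasure_subadditive_countably) auto
      finally have "ennreal (?n * unit_ball_vol ?n) \<le> (\<Sum>i. ennreal ?n * emeasure cone_measure (K i))"
        by (simp add: mult_left_mono)
      also have "\<dots> \<le> (\<Sum>i. ennreal (1 + e) * hausdorff_weight ?k (C i))"
        by (intro suminf_le each) auto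
      finally show ?thesis by simp
    qed
    \<comment> \<open>With the factor moved to the left, the right-hand side is exactly the quantity
      whose infimum is the premeasure.\<close>
    have "ennreal (1 / (1 + e)) * ennreal (?n * unit_ball_vol ?n) \<le> (\<Sum>i. hausdorff_weight ?k (C i))"
      if "?S \<subseteq> (\<Union>i. C i)" "\<And>i. bounded (C i)" "\<And>i. diameter (C i) \<le> \<delta> / 2" for C :: "nat \<Rightarrow> (real^'n) set"
    proof -
      have "ennreal (1 / (1 + e)) * ennreal (?n * unit_ball_vol ?n) \<le> ennreal (1 / (1 + e)) * (ennreal (1 + e) * (\<Sum>i. hausdorff_weight ?k (C i)))"
        using cov[OF that] by (rule mult_left_mono) simp
      also have "\<dots> = (\<Sum>i. hausdorff_weight ?k (C i))"
        using e by (subst mult.assoc[symmetric], subst ennreal_mult[symmetric]) auto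
      finally show ?thesis .
    qed
    then have "ennreal (1 / (1 + e)) * ennreal (?n * unit_ball_vol ?n) \<le> hausdorff_premeasure ?k (\<delta> / 2) ?S"
      unfolding hausdorff_premeasure_def hausdorff_weight_def by (intro INF_greatest) auto
    also have "\<dots> \<le> hausdorff_measure ?k ?S"
      unfolding hausdorff_measure_def using \<delta> by (intro SUP_upper) auto
    finally have "ennreal (1 + e) * (ennreal (1 / (1 + e)) * ennreal (?n * unit_ball_vol ?n)) \<le> ennreal (1 + e) * hausdorff_measure ?k ?S"
      by (rule mult_left_mono) simp
    also have "ennreal (1 + e) * (ennreal (1 / (1 + e)) * ennreal (?n * unit_ball_vol ?n)) = ennreal (?n * unit_ball_vol ?n)"
      using e by (subst mult.assoc[symmetric], subst ennreal_mult[symmetric]) auto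
    finally show ?thesis .
  qed
  show ?thesis
  proof (cases "hausdorff_measure ?k ?S")
    case (real r)
    have "?n * unit_ball_vol ?n \<le> (1 + e) * r" if "e > 0" for e :: real
    proof -
      have "ennreal (?n * unit_ball_vol ?n) \<le> ennreal (1 + e) * ennreal r"
        using main[OF that] by (simp only: real)
      also have "\<dots> = ennreal ((1 + e) * r)" using that real by (intro ennreal_mult[symmetric]) auto
      finally show ?thesis using that real by (subst (asm) ennreal_le_iff) auto
    qed
    then have "eventually (\<lambda>e. ?n * unit_ball_vol ?n \<le> (1 + e) * r) (at_right 0)"
      by (auto simp: eventually_at_right_field intro: exI[of _ 1])
    moreover have "((\<lambda>e. (1 + e) * r) \<longlongrightarrow> (1 + 0) * r) (at_right 0)" by (intro tendsto_intros)
    ultimately have "?n * unit_ball_vol ?n \<le> (1 + 0) * r"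
      by (intro tendsto_lowerbound) auto
    then show ?thesis using real by (simp add: ennreal_leI)
  qed simp
qed

section \<open>Upper bound by Vitali coverings\<close>

lemma measure_cone_measure_Int_sphere:
  assumes "K \<in> sets borel"
  shows "measure cone_measure (K \<inter> sphere 0 1) = measure (cone_measure :: 'a::euclidean_space measure) K"
  using emeasure_cone_measure_Int_sphere[OF assms] by (simp add: measure_def)

text \<open>Centres on the sphere and radii up to \<open>\<rho>\<close> bring the cap estimates into
  play; staying inside \<open>U\<close> lets disjoint balls be charged to the measure of
  \<open>U\<close>.\<close>

lemma sphere_Vitali_cover:
  fixes U :: "'a::euclidean_space set"
  assumes U: "open U" and \<rho>: "0 < \<rho>"
  obtains C where "countable C" "\<forall>a r. (a, r) \<in> C \<longrightarrow> norm a = 1 \<and> 0 < r \<and> r \<le> \<rho> \<and> cball a r \<subseteq> U"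
    "disjoint_family_on (\<lambda>i. cball (fst i) (snd i)) C"
    "U \<inter> sphere 0 1 \<subseteq> (\<Union>i\<in>C. cball (fst i) (5 * snd i))"
proof -
  define K where "K = {(a, r). norm a = 1 \<and> 0 < r \<and> r \<le> \<rho> \<and> cball a r \<subseteq> U}"
  have cov: "U \<inter> sphere 0 1 \<subseteq> (\<Union>i\<in>K. cball (fst i) (snd i))"
  proof
    fix x assume x: "x \<in> U \<inter> sphere 0 1"
    then obtain r where r: "r > 0" "cball x r \<subseteq> U" using U open_contains_cball by blast
    have "cball x (min r \<rho>) \<subseteq> cball x r" by (intro subset_cball) auto
    then have "(x, min r \<rho>) \<in> K" using x r \<rho> by (auto simp: K_def)
    moreover have "x \<in> cball x (min r \<rho>)" using r \<rho> by auto
    ultimately show "x \<in> (\<Union>i\<in>K. cball (fst i) (snd i))" by force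
  qed
  have "0 < snd i \<and> snd i \<le> \<rho>" if "i \<in> K" for i using that by (auto simp: K_def)
  from Vitali_covering_lemma_cballs[OF cov this] obtain C where C: "countable C" "C \<subseteq> K"
    "pairwise (\<lambda>i j. disjnt (cball (fst i) (snd i)) (cball (fst j) (snd j))) C"
    "U \<inter> sphere 0 1 \<subseteq> (\<Union>i\<in>C. cball (fst i) (5 * snd i))" .
  show ?thesis
  proof (rule that[OF C(1) _ _ C(4)])
    show "\<forall>a r. (a, r) \<in> C \<longrightarrow> norm a = 1 \<and> 0 < r \<and> r \<le> \<rho> \<and> cball a r \<subseteq> U"
      using C(2) unfolding K_def by blast
    show "disjoint_family_on (\<lambda>i. cball (fst i) (snd i)) C"
      using C(3) by (simp add: disjoint_family_on_def pairwise_def disjnt_def)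
  qed
qed

text \<open>A Vitali family covers only after fivefold enlargement, which spoils the constant by a
  power of 5. Bounds are therefore stated for all open \<open>U\<close>: after removing finitely
  many closed caps an open set remains, to which the current bound applies again.\<close>

lemma hausdorff_premeasure_sphere_le:
  assumes e: "0 < e" and \<delta>: "0 < \<delta>"
  shows "hausdorff_premeasure (CARD('n) - 1) \<delta> (sphere (0::real^'n) 1)
    \<le> ennreal ((1 + e) * (real CARD('n) * unit_ball_vol (real CARD('n))))"
proof -
  let ?S = "sphere (0::real^'n) 1" and ?M = "measure (cone_measure :: (real^'n) measure)"
  define n where "n = real CARD('n)"
  define k where "k = CARD('n) - 1"
  define V where "V = unit_ball_vol (real k)"
  \<comment> \<open>\<open>c0\<close> is the price of enlarging caps fivefold. \<open>L\<close> is a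
    doubling constant for caps; its extra factor 2 is the relative error of the diameter estimate,
    used with error 1.\<close>
  define c0 where "c0 = 5 ^ k * (1 + e)"
  define L where "L = 2 * c0"
  have pos: "V \<ge> 0" "n > 0" "c0 > 0" "L > 0" "1 + e \<le> c0" "1 \<le> L"
  proof -
    have "(1::real) \<le> 5 ^ k" by simp
    then have "1 * (1 + e) \<le> 5 ^ k * (1 + e)" using e by (intro mult_right_mono) auto
    then show "1 + e \<le> c0" by (simp add: c0_def)
    then show "c0 > 0" "L > 0" "1 \<le> L" using e by (auto simp: L_def)
  qed (auto simp: V_def n_def)
  from cone_measure_cap_lower_asymp[OF e, where 'n='n]
  obtain \<delta>1 where \<delta>1: "\<delta>1 > 0" "\<forall>(a::real^'n) r. norm a = 1 \<longrightarrow> 0 < r \<longrightarrow> r \<le> \<delta>1 \<longrightarrow>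
      V * r ^ k \<le> (1 + e) * (n * ?M (cball a r))"
    unfolding n_def k_def V_def by (elim exE conjE)
  from cone_measure_le_diameter_asymp[of 1, where 'n='n]
  obtain \<delta>2 where \<delta>2: "\<delta>2 > 0" "\<forall>(K::(real^'n) set) d. K \<in> sets borel \<longrightarrow> K \<subseteq> ?S \<longrightarrow> 0 < d \<longrightarrow> d \<le> \<delta>2 \<longrightarrow>
      (\<forall>x\<in>K. \<forall>y\<in>K. dist x y \<le> d) \<longrightarrow> n * ?M K \<le> (1 + 1) * (V * (d / 2) ^ k)"
    unfolding n_def k_def V_def by (auto simp only: zero_less_one simp_thms)
  \<comment> \<open>Enlarged caps have radius \<open>5 * r\<close>, hence diameter
    \<open>10 * r\<close>, which must meet both the diameter restriction and the range of the
    diameter estimate.\<close>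
  define \<rho> where "\<rho> = min \<delta>1 (min (\<delta> / 10) (\<delta>2 / 10))"
  have \<rho>: "\<rho> > 0" "\<rho> \<le> \<delta>1" "10 * \<rho> \<le> \<delta>" "10 * \<rho> \<le> \<delta>2" using \<delta> \<delta>1 \<delta>2 by (auto simp: \<rho>_def)
  have cap: "V * r ^ k \<le> (1 + e) * (n * ?M (cball a r))"
    and cap5: "?M (cball a (5 * r)) \<le> L * ?M (cball a r)"
    if ar: "norm a = 1" "0 < r" "r \<le> \<rho>" for a r
  proof -
    show 1: "V * r ^ k \<le> (1 + e) * (n * ?M (cball a r))"
      using \<delta>1(2)[rule_format, OF ar(1,2)] ar \<rho> by simp
    have "n * ?M (cball a (5 * r) \<inter> ?S) \<le> (1 + 1) * (V * (10 * r / 2) ^ k)"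
    proof (rule \<delta>2(2)[rule_format])
      fix x y assume "x \<in> cball a (5 * r) \<inter> ?S" "y \<in> cball a (5 * r) \<inter> ?S"
      then show "dist x y \<le> 10 * r"
        using dist_triangle2[of x y a] by (auto simp: dist_commute)
    qed (use ar \<rho> in \<open>auto intro!: borel_closed\<close>)
    also have "\<dots> = 2 * 5 ^ k * (V * r ^ k)" by (simp add: power_mult_distrib)
    also have "\<dots> \<le> 2 * 5 ^ k * ((1 + e) * (n * ?M (cball a r)))" using 1 by (intro mult_left_mono) auto
    also have "\<dots> = n * (L * ?M (cball a r))" by (simp add: L_def c0_def)
    finally show "?M (cball a (5 * r)) \<le> L * ?M (cball a r)"
      using pos by (simp add: measure_cone_measure_Int_sphere)
  qed
  have weight: "hausdorff_weight k (cball a r) = ennreal (V * r ^ k)" if "0 < r" for a :: "real^'n" and r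
    using that by (simp add: hausdorff_weight_def V_def)

  have crude: "hausdorff_premeasure k \<delta> (U \<inter> ?S) \<le> ennreal (c0 * (n * ?M U))" if U: "open U" for U
  proof -
    from sphere_Vitali_cover[OF U \<rho>(1)]
    obtain C where C: "countable C" "\<forall>a r. (a, r) \<in> C \<longrightarrow> norm a = 1 \<and> 0 < r \<and> r \<le> \<rho> \<and> cball a r \<subseteq> U"
      "disjoint_family_on (\<lambda>i. cball (fst i) (snd i)) C"
      "U \<inter> ?S \<subseteq> (\<Union>i\<in>C. cball (fst i) (5 * snd i))" .
    have "hausdorff_premeasure k \<delta> (U \<inter> ?S) \<le> (\<integral>\<^sup>+i. hausdorff_weight k (cball (fst i) (5 * snd i)) \<partial>count_space C)"
    proof (rule hausdorff_premeasure_le_count_space[OF C(1) _ C(4)])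
      fix i assume "i \<in> C"
      then have "0 < snd i" "snd i \<le> \<rho>" using C(2)[rule_format, of "fst i" "snd i"] by auto
      then show "diameter (cball (fst i) (5 * snd i)) \<le> \<delta>" using \<rho> by simp
    qed (use \<delta> in auto)
    also have "\<dots> \<le> (\<integral>\<^sup>+i. ennreal (c0 * n) * emeasure cone_measure (cball (fst i) (snd i)) \<partial>count_space C)"
    proof (rule nn_integral_mono)
      fix i assume "i \<in> space (count_space C)"
      then have i: "norm (fst i) = 1" "0 < snd i" "snd i \<le> \<rho>" using C(2)[rule_format, of "fst i" "snd i"] by auto
      have "V * (5 * snd i) ^ k = 5 ^ k * (V * snd i ^ k)" by (simp add: power_mult_distrib)
      also have "\<dots> \<le> 5 ^ k * ((1 + e) * (n * ?M (cball (fst i) (snd i))))"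
        using cap[OF i] by (intro mult_left_mono) auto
      also have "\<dots> = (c0 * n) * ?M (cball (fst i) (snd i))" by (simp add: c0_def)
      finally show "hausdorff_weight k (cball (fst i) (5 * snd i)) \<le> ennreal (c0 * n) * emeasure cone_measure (cball (fst i) (snd i))"
        using i pos by (simp add: weight cone.emeasure_eq_measure ennreal_mult[symmetric] ennreal_leI)
    qed
    also have "\<dots> = ennreal (c0 * n) * emeasure cone_measure (\<Union>i\<in>C. cball (fst i) (snd i))"
      using C by (subst emeasure_UN_countable) (auto simp: nn_integral_cmult)
    also have "\<dots> \<le> ennreal (c0 * n) * emeasure cone_measure U"
    proof (intro mult_left_mono emeasure_mono)
      show "(\<Union>i\<in>C. cball (fst i) (snd i)) \<subseteq> U" using C(2) by (intro UN_least) auto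
    qed (use U in auto)
    finally show ?thesis
      using pos by (simp add: cone.emeasure_eq_measure ennreal_mult[symmetric] mult.assoc)
  qed

  \<comment> \<open>The enlarged caps cover \<open>U \<inter> ?S\<close>, so by doubling the
    disjoint family itself carries at least the fraction \<open>1 / L\<close> of the measure. If no
    finite part reached half of that, the whole family would carry at most
    \<open>1 / (2 * L)\<close>.\<close>
  have select: "\<exists>F. finite F \<and> (\<forall>(a, r)\<in>F. norm a = 1 \<and> 0 < r \<and> r \<le> \<rho> \<and> cball a r \<subseteq> U) \<and>
      disjoint_family_on (\<lambda>i. cball (fst i) (snd i)) F \<and>
      ?M U \<le> 2 * L * ?M (\<Union>i\<in>F. cball (fst i) (snd i))" if U: "open U" for U
  proof (rule ccontr)
    assume neg: "\<not> ?thesis"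
    from sphere_Vitali_cover[OF U \<rho>(1)]
    obtain C where C: "countable C" "\<forall>a r. (a, r) \<in> C \<longrightarrow> norm a = 1 \<and> 0 < r \<and> r \<le> \<rho> \<and> cball a r \<subseteq> U"
      "disjoint_family_on (\<lambda>i. cball (fst i) (snd i)) C"
      "U \<inter> ?S \<subseteq> (\<Union>i\<in>C. cball (fst i) (5 * snd i))" .
    have fin: "2 * L * ?M (\<Union>i\<in>F. cball (fst i) (snd i)) < ?M U" if F: "F \<subseteq> C" "finite F" for F
    proof (rule ccontr)
      assume "\<not> 2 * L * ?M (\<Union>i\<in>F. cball (fst i) (snd i)) < ?M U"
      moreover have "disjoint_family_on (\<lambda>i. cball (fst i) (snd i)) F"
        using C(3) F(1) by (rule disjoint_family_on_mono[rotated])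
      moreover have "\<forall>(a, r)\<in>F. norm a = 1 \<and> 0 < r \<and> r \<le> \<rho> \<and> cball a r \<subseteq> U"
        using C(2) F(1) by blast
      ultimately show False using neg F(2) unfolding not_less by blast
    qed
    have "?M (\<Union>i\<in>C. cball (fst i) (snd i)) \<le> ?M U / (2 * L)"
    proof (rule measure_UN_bound[OF C(1)])
      fix F assume "F \<subseteq> C" "finite F"
      then show "?M (\<Union>i\<in>F. cball (fst i) (snd i)) \<le> ?M U / (2 * L)"
        using fin[of F] pos by (simp add: pos_le_divide_eq mult.commute)
    qed (auto simp: cone.fmeasurable_eq_sets)
    moreover have "?M U \<le> L * ?M (\<Union>i\<in>C. cball (fst i) (snd i))"
    proof -
      have [measurable]: "(\<Union>i\<in>C. cball (fst i) (snd i)) \<in> sets borel"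
        "(\<Union>i\<in>C. cball (fst i) (5 * snd i)) \<in> sets borel"
        using C(1) by (auto intro!: sets.countable_UN')
      have "emeasure cone_measure U = emeasure cone_measure (U \<inter> ?S)"
        using U by (intro emeasure_cone_measure_Int_sphere) auto
      also have "\<dots> \<le> emeasure cone_measure (\<Union>i\<in>C. cball (fst i) (5 * snd i))"
        using C(4) by (intro emeasure_mono) auto
      also have "\<dots> \<le> (\<integral>\<^sup>+i. emeasure cone_measure (cball (fst i) (5 * snd i)) \<partial>count_space C)"
        by (intro emeasure_UN_le_count_space C(1)) auto
      also have "\<dots> \<le> (\<integral>\<^sup>+i. ennreal L * emeasure cone_measure (cball (fst i) (snd i)) \<partial>count_space C)"
      proof (rule nn_integral_mono)
        fix i assume "i \<in> space (count_space C)"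
        then have i: "norm (fst i) = 1" "0 < snd i" "snd i \<le> \<rho>" using C(2)[rule_format, of "fst i" "snd i"] by auto
        show "emeasure cone_measure (cball (fst i) (5 * snd i)) \<le> ennreal L * emeasure cone_measure (cball (fst i) (snd i))"
          using cap5[OF i] pos by (simp add: cone.emeasure_eq_measure ennreal_mult[symmetric] ennreal_leI)
      qed
      also have "\<dots> = ennreal L * emeasure cone_measure (\<Union>i\<in>C. cball (fst i) (snd i))"
        using C by (subst emeasure_UN_countable) (auto simp: nn_integral_cmult)
      finally show ?thesis
        using pos by (simp add: cone.emeasure_eq_measure ennreal_mult[symmetric])
    qed
    ultimately have "?M U \<le> L * (?M U / (2 * L))" using pos by (meson mult_left_mono order_trans less_imp_le)
    then have "?M U \<le> ?M U / 2" using pos by simp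
    \<comment> \<open>The empty subfamily also falls short, strictly, so the measure is positive and
      cannot be bounded by its half.\<close>
    moreover have "0 < ?M U" using fin[of "{}"] by simp
    ultimately show False by simp
  qed

  \<comment> \<open>The fraction of the measure that \<open>select\<close> guarantees for finitely
    many caps.\<close>
  define \<theta> where "\<theta> = 1 / (2 * L)"
  have \<theta>: "0 < \<theta>" "\<theta> < 1" using pos by (auto simp: \<theta>_def)
  text \<open>Covering the selected caps efficiently and their complement by the old bound improves the
    constant \<open>c\<close>; iterating drives it from the crude value \<open>c0\<close> down to \<open>1 + e\<close>.\<close>
  have step: "hausdorff_premeasure k \<delta> (U \<inter> ?S) \<le> ennreal ((1 + e + (c - (1 + e)) * (1 - \<theta>)) * (n * ?M U))"
    if c: "1 + e \<le> c" and bound: "\<And>U. open U \<Longrightarrow> hausdorff_premeasure k \<delta> (U \<inter> ?S) \<le> ennreal (c * (n * ?M U))"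
      and U: "open U" for c U
  proof -
    obtain F where F: "finite F" "\<forall>(a, r)\<in>F. norm a = 1 \<and> 0 < r \<and> r \<le> \<rho> \<and> cball a r \<subseteq> U"
      "disjoint_family_on (\<lambda>i. cball (fst i) (snd i)) F"
      "?M U \<le> 2 * L * ?M (\<Union>i\<in>F. cball (fst i) (snd i))"
      using select[OF U] by blast
    define B where "B = (\<Union>i\<in>F. cball (fst i) (snd i))"
    have B: "closed B" using F(1) by (auto simp: B_def)
    then have [measurable]: "B \<in> sets borel" "U \<in> sets borel" using U by auto
    have BU: "B \<subseteq> U" using F(2) by (fastforce simp: B_def)
    have i: "norm (fst i) = 1" "0 < snd i" "snd i \<le> \<rho>" if "i \<in> F" for i
      using F(2) that by (auto simp: case_prod_beta)
    have "hausdorff_premeasure k \<delta> (U \<inter> ?S) \<le>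
      (\<Sum>i\<in>F. hausdorff_weight k (cball (fst i) (snd i))) + hausdorff_premeasure k \<delta> ((U - B) \<inter> ?S)"
    proof (rule hausdorff_premeasure_finite_Un_le[OF F(1)])
      fix j assume "j \<in> F"
      then show "diameter (cball (fst j) (snd j)) \<le> \<delta>" using i[of j] \<rho> by simp
    qed (auto simp: B_def)
    also have "(\<Sum>i\<in>F. hausdorff_weight k (cball (fst i) (snd i))) \<le> ennreal ((1 + e) * (n * ?M B))"
    proof -
      have "(\<Sum>i\<in>F. hausdorff_weight k (cball (fst i) (snd i))) = ennreal (\<Sum>i\<in>F. V * snd i ^ k)"
      proof (subst sum_ennreal[symmetric])
        show "0 \<le> V * snd j ^ k" if "j \<in> F" for j
          using i(2)[OF that] pos by simp
      qed (use i in \<open>simp add: weight\<close>)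
      also have "(\<Sum>i\<in>F. V * snd i ^ k) \<le> (\<Sum>i\<in>F. (1 + e) * (n * ?M (cball (fst i) (snd i))))"
        using i by (intro sum_mono cap) auto
      also have "\<dots> = (1 + e) * (n * ?M B)"
        unfolding B_def using F by (subst cone.finite_measure_finite_Union) (auto simp: sum_distrib_left)
      finally show ?thesis by (simp add: ennreal_leI)
    qed
    also have "hausdorff_premeasure k \<delta> ((U - B) \<inter> ?S) \<le> ennreal (c * (n * ?M (U - B)))"
      using U B by (intro bound) auto
    also have "?M (U - B) = ?M U - ?M B"
      using BU by (intro cone.finite_measure_Diff) auto
    also have "ennreal ((1 + e) * (n * ?M B)) + ennreal (c * (n * (?M U - ?M B))) =
        ennreal (c * (n * ?M U) - (c - (1 + e)) * (n * ?M B))"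
      using e c pos cone.finite_measure_mono[OF BU]
      by (subst ennreal_plus[symmetric]) (auto simp: algebra_simps)
    also have "\<dots> \<le> ennreal (c * (n * ?M U) - (c - (1 + e)) * (n * (\<theta> * ?M U)))"
    proof (intro ennreal_leI diff_left_mono mult_left_mono)
      show "\<theta> * ?M U \<le> ?M B" using F(4) pos by (simp add: B_def \<theta>_def pos_divide_le_eq mult.commute)
    qed (use c pos in auto)
    also have "c * (n * ?M U) - (c - (1 + e)) * (n * (\<theta> * ?M U)) = (1 + e + (c - (1 + e)) * (1 - \<theta>)) * (n * ?M U)"
      by (simp add: algebra_simps)
    finally show ?thesis by (simp add: add_mono)
  qed

  have iterate: "hausdorff_premeasure k \<delta> (U \<inter> ?S) \<le> ennreal ((1 + e + (c0 - (1 + e)) * (1 - \<theta>) ^ j) * (n * ?M U))"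
    if "open U" for j U
    using that
  proof (induction j arbitrary: U)
    case 0
    then show ?case using crude by simp
  next
    case (Suc j)
    have "1 + e \<le> 1 + e + (c0 - (1 + e)) * (1 - \<theta>) ^ j" using pos \<theta> by simp
    from step[OF this Suc.IH Suc.prems] show ?case by (simp add: mult_ac)
  qed
  have "(\<lambda>j. ennreal ((1 + e + (c0 - (1 + e)) * (1 - \<theta>) ^ j) * (n * ?M UNIV))) \<longlonglongrightarrow>
      ennreal ((1 + e + (c0 - (1 + e)) * 0) * (n * ?M UNIV))"
    using \<theta> by (intro tendsto_intros tendsto_ennrealI LIMSEQ_power_zero) auto
  then have "hausdorff_premeasure k \<delta> (UNIV \<inter> ?S) \<le> ennreal ((1 + e + (c0 - (1 + e)) * 0) * (n * ?M UNIV))"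
    using iterate[of UNIV] by (intro LIMSEQ_le_const) auto
  moreover have "?M UNIV = unit_ball_vol n"
    using measure_cone_measure_Int_sphere[of "UNIV :: (real^'n) set"] emeasure_cone_measure_sphere[where 'a="real^'n"]
    by (simp add: n_def measure_def)
  ultimately show ?thesis by (simp add: n_def k_def)
qed

lemma hausdorff_measure_sphere:
  "hausdorff_measure (CARD('n) - 1) (sphere (0::real^'n) 1) = ennreal (real CARD('n) * unit_ball_vol (real CARD('n)))"
proof (rule antisym[OF _ hausdorff_measure_sphere_ge])
  show "hausdorff_measure (CARD('n) - 1) (sphere (0::real^'n) 1) \<le> ennreal (real CARD('n) * unit_ball_vol (real CARD('n)))"
    unfolding hausdorff_measure_def
  proof (rule SUP_least)
    fix \<delta> :: real assume "\<delta> \<in> {0<..}"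
    then have \<delta>: "0 < \<delta>" by simp
    have "eventually (\<lambda>e. hausdorff_premeasure (CARD('n) - 1) \<delta> (sphere (0::real^'n) 1)
        \<le> ennreal ((1 + e) * (real CARD('n) * unit_ball_vol (real CARD('n))))) (at_right 0)"
      by (rule eventually_mono[OF eventually_at_right_less[of 0]]) (rule hausdorff_premeasure_sphere_le[OF _ \<delta>])
    moreover have "((\<lambda>e. ennreal ((1 + e) * (real CARD('n) * unit_ball_vol (real CARD('n))))) \<longlongrightarrow>
        ennreal ((1 + 0) * (real CARD('n) * unit_ball_vol (real CARD('n))))) (at_right 0)"
      by (intro tendsto_ennrealI tendsto_intros)
    ultimately have "hausdorff_premeasure (CARD('n) - 1) \<delta> (sphere (0::real^'n) 1)
        \<le> ennreal ((1 + 0) * (real CARD('n) * unit_ball_vol (real CARD('n))))"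
      by (intro tendsto_lowerbound) auto
    then show "hausdorff_premeasure (CARD('n) - 1) \<delta> (sphere (0::real^'n) 1)
        \<le> ennreal (real CARD('n) * unit_ball_vol (real CARD('n)))" by simp
  qed
qed

lemma unit_sphere_area_eq: "unit_sphere_area TYPE(real^'n) = real CARD('n) * unit_ball_vol (real CARD('n))"
  using hausdorff_measure_sphere[where 'n='n] by (simp add: unit_sphere_area_def)

section \<open>Level sets of the Green kernel\<close>

text \<open>Convexity between the points 1 and \<open>u\<close>. For
  \<open>\<theta> = \<rho> ^ (DIM('a) - 2)\<close>, dividing by \<open>\<theta>\<close> produces the
  level \<open>1 / \<theta> - 1\<close> plus the bracket term, exactly the expression that bounds
  the singular term from below on a level set.\<close>

lemma powr_neg_Jensen:
  fixes k u \<theta> :: real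
  assumes k: "0 \<le> k" and u: "0 < u" and \<theta>: "0 \<le> \<theta>" "\<theta> \<le> 1"
  shows "(1 - \<theta> + \<theta> * u) powr (- k) \<le> 1 - \<theta> + \<theta> * u powr (- k)"
proof -
  have "convex_on {0<..} (\<lambda>t::real. t powr (- k))"
  proof (rule f''_ge0_imp_convex)
    show "((\<lambda>t. t powr (- k)) has_real_derivative (- k) * t powr (- k - 1)) (at t)" if "t \<in> {0<..}" for t
      using that by (auto intro!: derivative_eq_intros)
    show "((\<lambda>t. (- k) * t powr (- k - 1)) has_real_derivative (- k) * ((- k - 1) * t powr (- k - 1 - 1))) (at t)" if "t \<in> {0<..}" for t
      using that by (auto intro!: derivative_eq_intros)
    show "0 \<le> (- k) * ((- k - 1) * t powr (- k - 1 - 1))" if "t \<in> {0<..}" for t :: real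
    proof -
      have "(- k) * ((- k - 1) * t powr (- k - 1 - 1)) = k * ((k + 1) * t powr (- k - 1 - 1))"
        by (simp add: algebra_simps)
      then show ?thesis using k by simp
    qed
  qed auto
  from convex_onD[OF this \<theta>, of 1 u] show ?thesis using u by (simp add: algebra_simps)
qed

definition green_kernel :: "'a::euclidean_space \<Rightarrow> 'a \<Rightarrow> real" where
  "green_kernel x y = 1 / norm (x - y) ^ (DIM('a) - 2) - 1 / green_bracket x y ^ (DIM('a) - 2)"

lemma green_fun_eq: "green_fun x (y::'a::euclidean_space) = green_const TYPE('a) * green_kernel x y"
  by (simp add: green_fun_def green_kernel_def)

text \<open>In this form the bracket visibly exceeds \<open>norm (x - y)\<close> for two points of
  the open ball.\<close>

lemma green_bracket_radicand:
  fixes x y :: "'a::euclidean_space"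
  shows "1 - 2 * (x \<bullet> y) + (norm x)\<^sup>2 * (norm y)\<^sup>2 = (norm (x - y))\<^sup>2 + (1 - (norm x)\<^sup>2) * (1 - (norm y)\<^sup>2)"
  by (simp add: power2_norm_eq_inner inner_diff_left inner_diff_right inner_commute algebra_simps)

lemma green_bracket_pos:
  fixes x y :: "'a::euclidean_space"
  assumes "norm x < 1" "norm y < 1"
  shows "0 < (norm (x - y))\<^sup>2 + (1 - (norm x)\<^sup>2) * (1 - (norm y)\<^sup>2)" "0 < green_bracket x y"
    "norm (x - y) < green_bracket x y"
proof -
  have "0 < (1 - (norm x)\<^sup>2) * (1 - (norm y)\<^sup>2)"
    using assms by (intro mult_pos_pos) (simp_all add: abs_square_less_1)
  then have lt: "(norm (x - y))\<^sup>2 < (norm (x - y))\<^sup>2 + (1 - (norm x)\<^sup>2) * (1 - (norm y)\<^sup>2)" by simp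
  then show pos: "0 < (norm (x - y))\<^sup>2 + (1 - (norm x)\<^sup>2) * (1 - (norm y)\<^sup>2)"
    using zero_le_power2[of "norm (x - y)"] by linarith
  then show "0 < green_bracket x y" by (simp add: green_bracket_def green_bracket_radicand)
  show "norm (x - y) < green_bracket x y"
    unfolding green_bracket_def green_bracket_radicand using lt by (rule real_less_rsqrt)
qed

lemma green_kernel_pos:
  fixes x y :: "'a::euclidean_space"
  assumes "norm x < 1" "norm y < 1" "x \<noteq> y" "DIM('a) \<ge> 3"
  shows "0 < green_kernel x y"
proof -
  have "norm (x - y) ^ (DIM('a) - 2) < green_bracket x y ^ (DIM('a) - 2)"
    using assms green_bracket_pos[OF assms(1,2)] by (intro power_strict_mono) auto
  then show ?thesis
    using assms green_bracket_pos[OF assms(1,2)] unfolding green_kernel_def diff_gt_0_iff_gt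
    by (intro divide_strict_left_mono mult_pos_pos zero_less_power) auto
qed

text \<open>Division by zero erases the singular term and leaves the negative one. The pole thus
  lies in no superlevel set of nonnegative level.\<close>

lemma green_kernel_diag:
  fixes x :: "'a::euclidean_space"
  assumes "norm x < 1" "DIM('a) \<ge> 3"
  shows "green_kernel x x < 0"
  using green_bracket_pos(2)[OF assms(1,1)] assms(2) by (simp add: green_kernel_def power_0_left)

text \<open>The final inequality of the ball estimate, with \<open>a\<close> for the squared norm of
  the pole and \<open>\<tau>\<close> for the power of \<open>\<rho>\<close> given by the dimension.
  Equality holds at \<open>a = 0\<close>, in accordance with the level sets being balls for the
  central pole.\<close>

lemma green_level_centre_ineq:
  fixes a \<rho> \<tau> :: real
  assumes "0 \<le> a" "a < 1" "0 < \<rho>" "\<rho> < 1" "0 < \<tau>" "\<tau> < 1"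
  shows "(\<rho>\<^sup>2 - \<tau>) * (1 - a * \<tau>) + (1 - a)\<^sup>2 * \<tau> \<le> \<rho>\<^sup>2 * (1 - a * \<tau>)\<^sup>2"
proof -
  have "\<rho>\<^sup>2 < 1" using assms by (simp add: abs_square_less_1)
  then have "0 \<le> \<tau> * a * ((1 - a) * (2 - \<rho>\<^sup>2 - \<tau>) + a * ((1 - \<rho>\<^sup>2) * (1 - \<tau>)))"
    using assms by (intro mult_nonneg_nonneg add_nonneg_nonneg) auto
  also have "\<dots> = \<rho>\<^sup>2 * (1 - a * \<tau>)\<^sup>2 - ((\<rho>\<^sup>2 - \<tau>) * (1 - a * \<tau>) + (1 - a)\<^sup>2 * \<tau>)"
    by (simp add: power2_eq_square algebra_simps)
  finally show ?thesis by simp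
qed

text \<open>Convexity bounds \<open>|x - y|\<^sup>2\<close> on the level set by a function affine in \<open>[x, y]\<^sup>2\<close>. Since
  \<open>|y - \<mu> x|\<^sup>2\<close> is an affine combination of \<open>|x - y|\<^sup>2\<close> and \<open>[x, y]\<^sup>2\<close>, the value of \<open>\<mu>\<close> is the one for
  which the bracket cancels.\<close>

lemma green_level_subset_ball:
  fixes x y :: "'a::euclidean_space"
  assumes n: "DIM('a) \<ge> 3" and x: "norm x < 1" and y: "norm y < 1" and \<rho>: "0 < \<rho>" "\<rho> < 1"
    and lev: "1 / \<rho> ^ (DIM('a) - 2) - 1 < green_kernel x y"
  defines "\<mu> \<equiv> (1 - \<rho> ^ DIM('a)) / (1 - (norm x)\<^sup>2 * \<rho> ^ DIM('a))"
  shows "norm (y - \<mu> *\<^sub>R x) < \<rho>"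
proof -
  define m where "m = DIM('a) - 2"
  define k where "k = real m / 2"
  define \<theta> where "\<theta> = \<rho> ^ m"
  define \<tau> where "\<tau> = \<rho> ^ DIM('a)"
  define a where "a = (norm x)\<^sup>2"
  define Y where "Y = (norm y)\<^sup>2"
  define P where "P = x \<bullet> y"
  define A where "A = (norm (x - y))\<^sup>2"
  define u where "u = 1 - 2 * P + a * Y"
  have m: "m > 0" "DIM('a) = m + 2" using n by (auto simp: m_def)
  have k: "k > 0" using m by (simp add: k_def)
  have \<theta>: "0 < \<theta>" "\<theta> < 1" using \<rho> m by (auto simp: \<theta>_def power_less_one_iff)
  have \<tau>: "\<tau> = \<rho>\<^sup>2 * \<theta>" "0 < \<tau>" "\<tau> < 1"
  proof -
    show "\<tau> = \<rho>\<^sup>2 * \<theta>" by (simp only: \<tau>_def \<theta>_def m(2) power_add mult.commute)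
    show "0 < \<tau>" "\<tau> < 1" using \<rho> unfolding \<tau>_def by (simp_all add: power_less_one_iff)
  qed
  have a: "0 \<le> a" "a < 1" using x by (auto simp: a_def abs_square_less_1)
  have u: "0 < u" using green_bracket_pos(1)[OF x y] by (simp add: u_def a_def Y_def P_def green_bracket_radicand)
  have A_eq: "A = a - 2 * P + Y"
    by (simp add: A_def a_def P_def Y_def power2_norm_eq_inner inner_diff_left inner_diff_right inner_commute)
  have pow: "1 / t ^ m = (t\<^sup>2) powr (- k)" if "t > 0" for t :: real
  proof -
    have "(t\<^sup>2) powr (- k) = (t powr 2) powr (- k)" using that by simp
    also have "\<dots> = t powr (- real m)" unfolding powr_powr by (simp add: k_def)
    also have "\<dots> = 1 / t ^ m" using that by (simp add: powr_minus powr_realpow divide_inverse)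
    finally show ?thesis by simp
  qed
  have xy: "x \<noteq> y"
  proof
    assume "x = y"
    then have "green_kernel x y < 0" using green_kernel_diag[OF x n] by simp
    moreover have "1 \<le> 1 / \<rho> ^ m" using \<theta> by (simp add: \<theta>_def)
    ultimately show False using lev by (simp add: m_def)
  qed
  have "(\<rho>\<^sup>2 * (1 - \<theta> + \<theta> * u)) powr (- k) = (1 - \<theta> + \<theta> * u) powr (- k) / \<theta>"
  proof -
    have "(\<rho>\<^sup>2) powr (- k) = 1 / \<theta>" using pow[OF \<rho>(1)] by (simp add: \<theta>_def)
    moreover have "0 \<le> 1 - \<theta> + \<theta> * u" using \<theta> u by simp
    ultimately show ?thesis by (simp add: powr_mult)
  qed
  also have "\<dots> \<le> (1 - \<theta> + \<theta> * u powr (- k)) / \<theta>"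
    using powr_neg_Jensen[of k u \<theta>] k u \<theta> by (intro divide_right_mono) auto
  also have "\<dots> = 1 / \<theta> - 1 + u powr (- k)" using \<theta> by (simp add: field_simps)
  also have "\<dots> < A powr (- k)"
  proof -
    have "green_bracket x y ^ 2 = u"
      using u by (simp add: green_bracket_def u_def a_def P_def Y_def)
    then have "green_kernel x y = A powr (- k) - u powr (- k)"
      using pow[of "norm (x - y)"] pow[of "green_bracket x y"] xy green_bracket_pos(2)[OF x y]
      by (simp add: green_kernel_def m_def[symmetric] A_def)
    then show ?thesis using lev by (simp add: \<theta>_def m_def)
  qed
  finally have "(\<rho>\<^sup>2 * (1 - \<theta> + \<theta> * u)) powr (- k) < A powr (- k)" .
  then have "A < \<rho>\<^sup>2 * (1 - \<theta> + \<theta> * u)"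
  proof (rule contrapos_pp)
    assume "\<not> A < \<rho>\<^sup>2 * (1 - \<theta> + \<theta> * u)"
    moreover have "0 < \<rho>\<^sup>2 * (1 - \<theta> + \<theta> * u)" using \<rho> \<theta> u by (intro mult_pos_pos add_pos_pos) auto
    ultimately have "A powr (- k) \<le> (\<rho>\<^sup>2 * (1 - \<theta> + \<theta> * u)) powr (- k)"
      using k by (intro powr_mono2') auto
    then show "\<not> (\<rho>\<^sup>2 * (1 - \<theta> + \<theta> * u)) powr (- k) < A powr (- k)" by simp
  qed
  then have Au: "A - \<tau> * u < \<rho>\<^sup>2 - \<tau>" by (simp add: \<tau>(1) algebra_simps)
  \<comment> \<open>The denominator of \<open>\<mu>\<close>. After multiplication by
    \<open>q\<^sup>2\<close> the quantities \<open>A\<close> and \<open>u\<close> enter only through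
    \<open>A - \<tau> * u\<close>, which has just been bounded.\<close>
  define q where "q = 1 - a * \<tau>"
  have "a * \<tau> < 1" using a \<tau> mult_strict_mono'[of a 1 \<tau> 1] by simp
  then have q: "0 < q" by (simp add: q_def)
  have \<mu>: "\<mu> * q = 1 - \<tau>" using q by (simp add: \<mu>_def q_def a_def \<tau>_def)
  have "(norm (y - \<mu> *\<^sub>R x))\<^sup>2 = Y - 2 * \<mu> * P + \<mu>\<^sup>2 * a"
    by (simp add: Y_def P_def a_def power2_norm_eq_inner inner_diff_left inner_diff_right inner_commute)
       (simp add: power2_eq_square)
  then have "(norm (y - \<mu> *\<^sub>R x))\<^sup>2 * q\<^sup>2 = (Y - 2 * \<mu> * P + \<mu>\<^sup>2 * a) * q\<^sup>2" by (simp only:)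
  also have "\<dots> = Y * q\<^sup>2 - 2 * (\<mu> * q) * P * q + (\<mu> * q)\<^sup>2 * a"
    by (simp add: power2_eq_square algebra_simps)
  also have "\<dots> = (A - \<tau> * u) * q + (1 - a)\<^sup>2 * \<tau>"
    unfolding \<mu> by (simp add: q_def A_eq u_def power2_eq_square algebra_simps)
  also have "\<dots> < (\<rho>\<^sup>2 - \<tau>) * q + (1 - a)\<^sup>2 * \<tau>" using Au q by simp
  also have "\<dots> \<le> \<rho>\<^sup>2 * q\<^sup>2" unfolding q_def using a \<rho> \<tau> by (intro green_level_centre_ineq) auto
  finally have "(norm (y - \<mu> *\<^sub>R x))\<^sup>2 < \<rho>\<^sup>2" using q by simp
  then show ?thesis using \<rho>(1) by (intro power_less_imp_less_base[of _ 2 \<rho>]) auto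
qed

section \<open>Measurability and volumes of superlevel sets\<close>

lemma borel_measurable_ball_measure:
  assumes "f \<in> borel_measurable borel"
  shows "f \<in> borel_measurable (ball_measure :: 'a::euclidean_space measure)"
proof -
  have "f \<in> borel_measurable (completion lborel)" using assms by (intro measurable_completion) simp
  then show ?thesis by (rule measurable_restrict_space1)
qed

lemma emeasure_ball_measure_borel:
  fixes X :: "'a::euclidean_space set"
  assumes "X \<in> sets borel" "X \<subseteq> ball 0 1"
  shows "emeasure ball_measure X = emeasure lborel X"
proof -
  have "emeasure ball_measure X = emeasure lebesgue X"
    using assms by (intro emeasure_restrict_space) auto
  also have "\<dots> = emeasure lborel X" using assms by simp
  finally show ?thesis .
qed

lemma finite_measure_ball_measure: "finite_measure (ball_measure :: 'a::euclidean_space measure)"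
  by (rule finite_measure_lebesgue_on) simp

lemma space_ball_measure [simp]: "space (ball_measure :: 'a::euclidean_space measure) = ball 0 1"
  by (simp add: space_restrict_space)

lemma green_bracket_measurable [measurable]:
  "(\<lambda>z :: 'a::euclidean_space \<times> 'a. green_bracket (fst z) (snd z)) \<in> borel_measurable borel"
  unfolding green_bracket_def by (intro borel_measurable_continuous_onI continuous_intros)

lemma green_kernel_measurable_pair [measurable]:
  "(\<lambda>z :: 'a::euclidean_space \<times> 'a. green_kernel (fst z) (snd z)) \<in> borel_measurable borel"
  unfolding green_kernel_def
  by (intro borel_measurable_diff borel_measurable_divide borel_measurable_power green_bracket_measurable
       borel_measurable_continuous_onI continuous_intros)

lemma green_kernel_measurable [measurable]:
  "green_kernel (x :: 'a::euclidean_space) \<in> borel_measurable borel"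
proof -
  have "(\<lambda>y. (x, y)) \<in> borel_measurable borel"
    by (intro borel_measurable_continuous_onI continuous_intros)
  from measurable_compose[OF this green_kernel_measurable_pair] show ?thesis by simp
qed

lemma green_kernel_zero: "green_kernel 0 (y :: 'a::euclidean_space) = 1 / norm y ^ (DIM('a) - 2) - 1"
  by (simp add: green_kernel_def green_bracket_def)

text \<open>The radius solves \<open>1 / \<rho> ^ (DIM('a) - 2) - 1 = t\<close>. Level 0 gives
  radius 1, hence the condition on \<open>t\<close> for strictness. The centre is missing because
  \<open>1 / 0 = 0\<close> makes the kernel negative there.\<close>

lemma green_level_radius:
  assumes n: "DIM('a::euclidean_space) \<ge> 3" and t: "0 \<le> t"
  shows "\<exists>\<rho>::real. 0 < \<rho> \<and> \<rho> \<le> 1 \<and> (t > 0 \<longrightarrow> \<rho> < 1) \<and> 1 / \<rho> ^ (DIM('a) - 2) - 1 = t \<and>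
    \<rho> ^ DIM('a) = (1 / (1 + t)) powr (real DIM('a) / real (DIM('a) - 2)) \<and>
    {y \<in> ball (0::'a) 1. t < green_kernel 0 y} = ball 0 \<rho> - {0}"
proof -
  define m where "m = DIM('a) - 2"
  have m: "m > 0" using n by (simp add: m_def)
  define \<rho> where "\<rho> = (1 / (1 + t)) powr (1 / real m)"
  have \<rho>0: "\<rho> > 0" using t by (simp add: \<rho>_def)
  have \<rho>m: "\<rho> ^ m = 1 / (1 + t)"
    using t m \<rho>0 by (simp add: powr_realpow[symmetric]) (simp add: \<rho>_def powr_powr)
  have \<rho>1: "\<rho> \<le> 1" using t powr_mono2[of "1 / real m" "1 / (1 + t)" 1] by (simp add: \<rho>_def)
  show ?thesis
  proof (intro exI[of _ \<rho>] conjI impI)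
    show "\<rho> < 1" if "t > 0"
    proof -
      have "\<rho> \<noteq> 1" using \<rho>m that by auto
      then show ?thesis using \<rho>1 by simp
    qed
    show lev: "1 / \<rho> ^ (DIM('a) - 2) - 1 = t" using \<rho>m t by (simp add: m_def)
    show "\<rho> ^ DIM('a) = (1 / (1 + t)) powr (real DIM('a) / real (DIM('a) - 2))"
      using \<rho>0 by (simp add: powr_realpow[symmetric]) (simp add: \<rho>_def powr_powr m_def)
    show "{y \<in> ball (0::'a) 1. t < green_kernel 0 y} = ball 0 \<rho> - {0}"
    proof (rule set_eqI)
      fix y :: 'a
      show "y \<in> {y \<in> ball 0 1. t < green_kernel 0 y} \<longleftrightarrow> y \<in> ball 0 \<rho> - {0}"
      proof (cases "y = 0")
        case True
        then show ?thesis using m t by (simp add: green_kernel_zero m_def[symmetric] power_0_left)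
      next
        case False
        then have "t < green_kernel 0 y \<longleftrightarrow> 1 / \<rho> ^ m < 1 / norm y ^ m"
          unfolding green_kernel_zero m_def by (subst lev[symmetric]) simp
        also have "\<dots> \<longleftrightarrow> norm y ^ m < \<rho> ^ m" using False \<rho>0 by (simp add: field_simps)
        also have "\<dots> \<longleftrightarrow> norm y < \<rho>" using power_mono_iff[of \<rho> "norm y" m] m \<rho>0 by (meson less_imp_le not_le norm_ge_zero)
        finally show ?thesis using False \<rho>1 by auto
      qed
    qed
  qed (use \<rho>0 \<rho>1 in auto)
qed

lemma emeasure_green_level_zero:
  assumes n: "DIM('a::euclidean_space) \<ge> 3" and t: "0 \<le> t"
  shows "emeasure ball_measure {y \<in> ball (0::'a) 1. t < green_kernel 0 y} =
    ennreal (unit_ball_vol (real DIM('a)) * (1 / (1 + t)) powr (real DIM('a) / real (DIM('a) - 2)))"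
proof -
  from green_level_radius[OF n t] obtain \<rho> where \<rho>: "0 < \<rho>" "\<rho> \<le> 1" "t > 0 \<longrightarrow> \<rho> < 1" "1 / \<rho> ^ (DIM('a) - 2) - 1 = t"
    "\<rho> ^ DIM('a) = (1 / (1 + t)) powr (real DIM('a) / real (DIM('a) - 2))"
    "{y \<in> ball (0::'a) 1. t < green_kernel 0 y} = ball 0 \<rho> - {0}" by (elim exE conjE)
  have "ball (0::'a) \<rho> \<subseteq> ball 0 1" using \<rho> by (intro subset_ball)
  then have "emeasure ball_measure (ball (0::'a) \<rho> - {0}) = emeasure lborel (ball (0::'a) \<rho> - {0})"
    by (intro emeasure_ball_measure_borel) auto
  also have "\<dots> = emeasure lborel (ball (0::'a) \<rho>)" by (rule emeasure_Diff_null_set) auto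
  finally show ?thesis using \<rho> by (simp add: emeasure_ball)
qed

lemma emeasure_green_level_le:
  fixes x :: "'a::euclidean_space"
  assumes n: "DIM('a) \<ge> 3" and x: "norm x < 1" and t: "0 \<le> t"
  shows "emeasure ball_measure {y \<in> ball 0 1. t < green_kernel x y}
    \<le> emeasure ball_measure {y \<in> ball (0::'a) 1. t < green_kernel 0 y}"
proof -
  from green_level_radius[OF n t] obtain \<rho> where \<rho>: "0 < \<rho>" "\<rho> \<le> 1" "t > 0 \<longrightarrow> \<rho> < 1" "1 / \<rho> ^ (DIM('a) - 2) - 1 = t"
    "\<rho> ^ DIM('a) = (1 / (1 + t)) powr (real DIM('a) / real (DIM('a) - 2))"
    "{y \<in> ball (0::'a) 1. t < green_kernel 0 y} = ball 0 \<rho> - {0}" by (elim exE conjE)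
  \<comment> \<open>At level 0 the radius is 1 and the unit ball itself serves; the shifted centre
    comes from an estimate valid only for \<open>\<rho> < 1\<close>.\<close>
  define z where "z = (if t = 0 then 0 else ((1 - \<rho> ^ DIM('a)) / (1 - (norm x)\<^sup>2 * \<rho> ^ DIM('a))) *\<^sub>R x)"
  have [measurable]: "{y \<in> ball 0 1. t < green_kernel x y} \<in> sets borel" by measurable
  have "emeasure ball_measure {y \<in> ball 0 1. t < green_kernel x y} = emeasure lborel {y \<in> ball 0 1. t < green_kernel x y}"
    by (intro emeasure_ball_measure_borel) auto
  also have "\<dots> \<le> emeasure lborel (ball z \<rho>)"
  proof (rule emeasure_mono)
    show "{y \<in> ball 0 1. t < green_kernel x y} \<subseteq> ball z \<rho>"
    proof
      fix y assume y: "y \<in> {y \<in> ball 0 1. t < green_kernel x y}"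
      show "y \<in> ball z \<rho>"
      proof (cases "t = 0")
        case True
        then have "\<rho> ^ (DIM('a) - 2) = 1" using \<rho> by simp
        then have "\<not> \<rho> < 1" using n \<rho>(1) power_less_one_iff[of \<rho> "DIM('a) - 2"] by simp
        then have "\<rho> = 1" using \<rho>(2) by simp
        then show ?thesis using True y by (simp add: z_def)
      next
        case False
        then have "norm (y - z) < \<rho>"
          unfolding z_def using green_level_subset_ball[OF n x _ \<rho>(1), of y] \<rho> t y by simp
        then show ?thesis by (simp add: dist_norm norm_minus_commute)
      qed
    qed
  qed simp
  also have "\<dots> = emeasure ball_measure {y \<in> ball (0::'a) 1. t < green_kernel 0 y}"
    unfolding emeasure_green_level_zero[OF n t] using \<rho>(1,5) by (simp add: emeasure_ball)
  finally show ?thesis .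
qed

text \<open>By the layer cake formula, the integral depends only on the measures of superlevel sets
  at nonnegative levels, whence the positive parts. Allowing two measure spaces serves two purposes:
  comparing poles, and transferring the integral for the central pole to an interval.\<close>

lemma nn_integral_powr_mono_level:
  fixes f :: "'a \<Rightarrow> real" and g :: "'b \<Rightarrow> real"
  assumes M: "sigma_finite_measure M" and N: "sigma_finite_measure N"
    and [measurable]: "f \<in> borel_measurable M" "g \<in> borel_measurable N"
    and le: "\<And>t. 0 \<le> t \<Longrightarrow> emeasure M {x \<in> space M. t < f x} \<le> emeasure N {x \<in> space N. t < g x}"
    and q: "0 < q"
  shows "(\<integral>\<^sup>+x. ennreal (max 0 (f x) powr q) \<partial>M) \<le> (\<integral>\<^sup>+x. ennreal (max 0 (g x) powr q) \<partial>N)"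
proof -
  have iff: "ennreal t < ennreal (max 0 s powr q) \<longleftrightarrow> t powr (1 / q) < s" if t: "0 \<le> t" for s t
  proof -
    have "ennreal t < ennreal (max 0 s powr q) \<longleftrightarrow> t < max 0 s powr q" using t by (simp add: ennreal_less_iff)
    also have "\<dots> \<longleftrightarrow> (t powr (1 / q)) powr q < max 0 s powr q" using q t by (simp add: powr_powr)
    also have "\<dots> \<longleftrightarrow> t powr (1 / q) < max 0 s"
    proof
      assume *: "(t powr (1 / q)) powr q < max 0 s powr q"
      show "t powr (1 / q) < max 0 s"
      proof (rule ccontr)
        assume "\<not> t powr (1 / q) < max 0 s"
        then have "max 0 s powr q \<le> (t powr (1 / q)) powr q" using q by (intro powr_mono2) auto
        then show False using * by simp
      qed
    qed (use q in \<open>auto intro!: powr_less_mono2\<close>)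
    also have "\<dots> \<longleftrightarrow> t powr (1 / q) < s"
    proof -
      have "\<not> t powr (1 / q) < 0" by (simp add: not_less)
      then show ?thesis unfolding less_max_iff_disj by blast
    qed
    finally show ?thesis .
  qed
  have "(\<integral>\<^sup>+x. ennreal (max 0 (f x) powr q) \<partial>M) =
    (\<integral>\<^sup>+t. indicator {0..} t * emeasure M {x \<in> space M. ennreal t < ennreal (max 0 (f x) powr q)} \<partial>lborel)"
    using M by (intro nn_integral_layer_cake) auto
  also have "\<dots> \<le> (\<integral>\<^sup>+t. indicator {0..} t * emeasure N {x \<in> space N. ennreal t < ennreal (max 0 (g x) powr q)} \<partial>lborel)"
    by (intro nn_integral_mono) (auto simp: indicator_def iff intro!: le)
  also have "\<dots> = (\<integral>\<^sup>+x. ennreal (max 0 (g x) powr q) \<partial>N)"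
    using N by (intro nn_integral_layer_cake[symmetric]) auto
  finally show ?thesis .
qed

section \<open>The integral for the central pole\<close>

lemma nn_integral_powr_Ioo:
  fixes b c r :: real
  assumes "0 \<le> c" "0 < r" "0 \<le> b"
  shows "(\<integral>\<^sup>+u. ennreal (c * r * u powr (r - 1)) * indicator {0<..<b} u \<partial>lborel) = ennreal (c * b powr r)"
proof -
  have "((\<lambda>u. (c * r) * u powr (r - 1)) has_integral (c * r) * (b powr (r - 1 + 1) / (r - 1 + 1))) {0..b}"
    using assms by (intro has_integral_mult_right has_integral_powr_from_0) auto
  then have "(\<integral>\<^sup>+u. ennreal (indicator {0..b} u * (c * r * u powr (r - 1))) \<partial>lborel) = ennreal (c * b powr r)"
    using assms by (subst nn_integral_has_integral_lebesgue) auto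
  moreover have "(\<integral>\<^sup>+u. ennreal (c * r * u powr (r - 1)) * indicator {0<..<b} u \<partial>lborel) =
    (\<integral>\<^sup>+u. ennreal (indicator {0..b} u * (c * r * u powr (r - 1))) \<partial>lborel)"
    by (intro nn_integral_cong_AE AE_I[of _ _ "{0, b}"])
       (auto simp: indicator_def emeasure_lborel_countable)
  ultimately show ?thesis by simp
qed

text \<open>The integral over the unit ball of the \<open>q\<close>-th power of
  \<open>green_kernel 0\<close>: a Beta value times the volume of the ball, written with Gamma
  functions.\<close>

definition green_power_integral :: "nat \<Rightarrow> real \<Rightarrow> real" where
  "green_power_integral n q = pi powr (real n / 2) * Gamma (1 + q) * Gamma ((real n - q * (real n - 2)) / (real n - 2)) /
          (Gamma (1 + real n / 2) * Gamma (real n / (real n - 2)))"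

text \<open>In place of polar coordinates, the variable \<open>u = norm y ^ (DIM('a) - 2)\<close> is
  introduced through its distribution: the kernel becomes \<open>1 / u - 1\<close>, the superlevel
  sets have equal measure, and the comparison lemma in both directions gives equality.\<close>

lemma nn_integral_green_kernel_zero:
  assumes n: "DIM('a::euclidean_space) \<ge> 3" and q: "0 < q" "q < real DIM('a) / (real DIM('a) - 2)"
  shows "(\<integral>\<^sup>+y. ennreal (max 0 (green_kernel (0::'a) y) powr q) \<partial>ball_measure) = ennreal (green_power_integral DIM('a) q)"
proof -
  define r where "r = real DIM('a) / (real DIM('a) - 2)"
  define V where "V = unit_ball_vol (real DIM('a))"
  have r: "r > 0" "real (DIM('a) - 2) = real DIM('a) - 2" using n by (auto simp: r_def)
  have V: "V \<ge> 0" by (simp add: V_def)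
  \<comment> \<open>The distribution of \<open>u\<close> under the volume of the ball: the mass of
    \<open>u < b\<close> is \<open>V * b powr r\<close>, which is differentiated here.\<close>
  define N where "N = density lborel (\<lambda>u. ennreal (V * r * u powr (r - 1)) * indicator {0<..<1} u)"
  have dens [measurable]: "(\<lambda>u::real. ennreal (V * r * u powr (r - 1)) * indicator {0<..<1} u) \<in> borel_measurable lborel"
    by measurable
  have "emeasure N (space N) = ennreal V"
    using nn_integral_powr_Ioo[of V r 1] V r by (simp add: N_def emeasure_density)
  then have "finite_measure N" by (intro finite_measureI) simp
  then have sfN: "sigma_finite_measure N" by (simp add: finite_measure.axioms)
  have sfM: "sigma_finite_measure (ball_measure :: 'a measure)"
    using finite_measure_ball_measure by (rule finite_measure.axioms)
  have level: "emeasure N {u \<in> space N. t < 1 / u - 1} = emeasure (ball_measure :: 'a measure) {y \<in> space ball_measure. t < green_kernel 0 y}"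
    if t: "0 \<le> t" for t
  proof -
    have "emeasure N {u \<in> space N. t < 1 / u - 1} =
      (\<integral>\<^sup>+u. ennreal (V * r * u powr (r - 1)) * indicator {0<..<1} u * indicator {u. t < 1 / u - 1} u \<partial>lborel)"
      by (simp add: N_def emeasure_density)
    also have "\<dots> = (\<integral>\<^sup>+u. ennreal (V * r * u powr (r - 1)) * indicator {0<..<1 / (1 + t)} u \<partial>lborel)"
    proof (rule nn_integral_cong)
      fix u :: real
      have "0 < u \<and> u < 1 \<and> t < 1 / u - 1 \<longleftrightarrow> 0 < u \<and> u < 1 / (1 + t)"
      proof (cases "0 < u")
        case True
        then have "t < 1 / u - 1 \<longleftrightarrow> u < 1 / (1 + t)" using t by (simp add: field_simps)
        moreover have "1 / (1 + t) \<le> 1" using t by simp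
        then have "u < 1 / (1 + t) \<Longrightarrow> u < 1" by linarith
        ultimately show ?thesis by blast
      qed simp
      then show "ennreal (V * r * u powr (r - 1)) * indicator {0<..<1} u * indicator {u. t < 1 / u - 1} u =
        ennreal (V * r * u powr (r - 1)) * indicator {0<..<1 / (1 + t)} u"
        by (auto simp: indicator_def)
    qed
    also have "\<dots> = ennreal (V * (1 / (1 + t)) powr r)" using V r t by (intro nn_integral_powr_Ioo) auto
    finally show ?thesis using emeasure_green_level_zero[OF n t] r by (simp add: V_def r_def)
  qed
  have meas: "(\<lambda>u::real. 1 / u - 1) \<in> borel_measurable N" by (simp add: N_def)
  have meas': "green_kernel (0::'a) \<in> borel_measurable ball_measure"
    by (intro borel_measurable_ball_measure) measurable
  have "(\<integral>\<^sup>+y. ennreal (max 0 (green_kernel (0::'a) y) powr q) \<partial>ball_measure) = (\<integral>\<^sup>+u. ennreal (max 0 (1 / u - 1) powr q) \<partial>N)"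
    using level q(1)
    by (intro antisym nn_integral_powr_mono_level sfM sfN meas meas') simp_all
  also have "\<dots> = (\<integral>\<^sup>+u. ennreal (V * r * u powr (r - 1)) * indicator {0<..<1} u * ennreal (max 0 (1 / u - 1) powr q) \<partial>lborel)"
    unfolding N_def by (subst nn_integral_density) auto
  also have "\<dots> = (\<integral>\<^sup>+u. ennreal (indicator {0..1} u * (V * r * (u powr (r - q - 1) * (1 - u) powr (q + 1 - 1)))) \<partial>lborel)"
  proof (rule nn_integral_cong_AE)
    have "AE u in lborel. u \<notin> {0, 1::real}" by (intro AE_not_in countable_imp_null_set_lborel) auto
    then show "AE u in lborel. ennreal (V * r * u powr (r - 1)) * indicator {0<..<1} u * ennreal (max 0 (1 / u - 1) powr q) =
      ennreal (indicator {0..1} u * (V * r * (u powr (r - q - 1) * (1 - u) powr (q + 1 - 1))))"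
    proof eventually_elim
      case (elim u)
      show ?case
      proof (cases "0 < u \<and> u < 1")
        case True
        then have "max 0 (1 / u - 1) powr q = (1 - u) powr q / u powr q"
          by (simp add: max_def powr_divide[symmetric] diff_divide_distrib)
        moreover have "u powr (r - 1) = u powr (r - q - 1) * u powr q"
          by (simp add: powr_add[symmetric])
        ultimately show ?thesis using True V r by (simp add: ennreal_mult[symmetric] mult.assoc)
      qed (use elim in \<open>auto simp: indicator_def\<close>)
    qed
  qed
  \<comment> \<open>The upper bound on \<open>q\<close> says \<open>r - q > 0\<close>, that is,
    integrability at the pole.\<close>
  also have "\<dots> = ennreal (V * r * Beta (r - q) (q + 1))"
  proof (rule nn_integral_has_integral_lebesgue)
    show "((\<lambda>u. V * r * (u powr (r - q - 1) * (1 - u) powr (q + 1 - 1))) has_integral V * r * Beta (r - q) (q + 1)) {0..1}"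
      using q by (intro has_integral_mult_right has_integral_Beta_real) (auto simp: r_def)
  qed (use V r in auto)
  also have "V * r * Beta (r - q) (q + 1) = green_power_integral DIM('a) q"
  proof -
    have B: "Beta (r - q) (q + 1) = Gamma (r - q) * Gamma (q + 1) / (r * Gamma r)"
    proof -
      have "r \<notin> \<int>\<^sub>\<le>\<^sub>0"
      proof
        assume "r \<in> \<int>\<^sub>\<le>\<^sub>0"
        then have "r \<le> 0" by (rule nonpos_Ints_nonpos)
        then show False using r(1) by simp
      qed
      then show ?thesis by (simp add: Beta_def Gamma_plus1)
    qed
    have "V * r * Beta (r - q) (q + 1) = V * Gamma (r - q) * Gamma (q + 1) / Gamma r"
      unfolding B using r by simp
    moreover have "r - q = (real DIM('a) - q * (real DIM('a) - 2)) / (real DIM('a) - 2)"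
      using n by (simp add: r_def diff_divide_distrib)
    ultimately show ?thesis
      by (simp add: V_def unit_ball_vol_def green_power_integral_def r_def add.commute mult_ac)
  qed
  finally show ?thesis .
qed

section \<open>Bounds for the Green operator\<close>

text \<open>Division by 0 gives infinity in \<open>ennreal\<close>, so the equation itself rules out
  \<open>p = 0\<close> and every \<open>q \<le> 0\<close>, for which
  \<open>ennreal q = 0\<close>.\<close>

lemma conjugate_exponents_cases:
  fixes p :: ennreal and q :: real
  assumes "1 / p + 1 / ennreal q = 1"
  obtains "p = \<infinity>" "q = 1" | P where "p = ennreal P" "1 < P" "1 < q" "1 / P + 1 / q = 1"
proof -
  have q: "q > 0"
  proof (rule ccontr)
    assume "\<not> q > 0"
    then have "ennreal q = 0" by (simp add: ennreal_neg)
    then show False using assms by (simp add: divide_ennreal_def)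
  qed
  have q1: "1 / ennreal q = ennreal (1 / q)"
    using q divide_ennreal[of 1 q] by simp
  show ?thesis
  proof (cases p)
    case top
    then have "ennreal (1 / q) = 1" using assms q1 by (simp add: divide_ennreal_def)
    then have "q = 1" using q by simp
    then show ?thesis using that(1) top by simp
  next
    case (real P)
    have P: "P > 0"
    proof (rule ccontr)
      assume "\<not> P > 0"
      then have "p = 0" using real by simp
      then show False using assms by (simp add: divide_ennreal_def)
    qed
    have "1 / p = ennreal (1 / P)" using real P divide_ennreal[of 1 P] by simp
    then have "ennreal (1 / P + 1 / q) = 1" using assms q1 P q by (simp add: ennreal_plus)
    then have s: "1 / P + 1 / q = 1" by (simp only: ennreal_eq_1)
    have "1 / P < 1" "1 / q < 1" using s P q zero_less_divide_1_iff[of P] zero_less_divide_1_iff[of q] by linarith+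
    then have "1 < P" "1 < q" using P q by (simp_all add: divide_less_eq)
    then show ?thesis using that(2) real s by simp
  qed
qed

lemma Holder_Lp_norm:
  fixes f g :: "'a \<Rightarrow> real"
  assumes conj: "1 / p + 1 / ennreal q = 1"
    and [measurable]: "f \<in> borel_measurable M" "g \<in> borel_measurable M"
    and f: "\<And>x. 0 \<le> f x" "(\<integral>\<^sup>+x. ennreal (f x powr q) \<partial>M) = ennreal F" "0 \<le> F"
    and g: "Lp_norm p M g < \<infinity>"
  shows "(\<integral>\<^sup>+x. ennreal (f x * \<bar>g x\<bar>) \<partial>M) \<le> ennreal (F powr (1 / q)) * Lp_norm p M g"
  using conj
proof (cases rule: conjugate_exponents_cases)
  case 1
  define N where "N = Lp_norm p M g"
  have "AE x in M. ennreal \<bar>g x\<bar> \<le> N"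
    using esssup_AE[of "\<lambda>x. ennreal \<bar>g x\<bar>" M] 1 by (simp add: N_def Lp_norm_def)
  then have "(\<integral>\<^sup>+x. ennreal (f x * \<bar>g x\<bar>) \<partial>M) \<le> (\<integral>\<^sup>+x. ennreal (f x) * N \<partial>M)"
    by (intro nn_integral_mono_AE) (auto simp: ennreal_mult f intro: mult_left_mono elim!: eventually_mono)
  also have "\<dots> = (\<integral>\<^sup>+x. ennreal (f x powr q) \<partial>M) * N"
    using 1 f(1) by (simp add: nn_integral_multc)
  finally show ?thesis using 1 f by (simp add: N_def)
next
  case (2 P)
  have PI: "p \<noteq> \<infinity>" "enn2real p = P" using 2 by auto
  have fin: "(\<integral>\<^sup>+x. ennreal (\<bar>g x\<bar> powr P) \<partial>M) \<noteq> \<infinity>"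
    using g PI by (auto simp: Lp_norm_def)
  define G where "G = enn2real (\<integral>\<^sup>+x. ennreal (\<bar>g x\<bar> powr P) \<partial>M)"
  have G: "(\<integral>\<^sup>+x. ennreal (\<bar>g x\<bar> powr P) \<partial>M) = ennreal G" "G \<ge> 0"
    using fin by (auto simp: G_def less_top)
  have norm: "Lp_norm p M g = ennreal (G powr (1 / P))"
    using fin PI by (simp add: Lp_norm_def G_def)
  show ?thesis
  \<comment> \<open>Young's inequality is applied after dividing by both norms, so vanishing norms
    are treated apart.\<close>
  proof (cases "F = 0 \<or> G = 0")
    case True
    have "AE x in M. f x * \<bar>g x\<bar> = 0"
      using True
    proof
      assume "F = 0"
      then have "(\<integral>\<^sup>+x. ennreal (f x powr q) \<partial>M) = 0" using f(2) by simp
      then have "AE x in M. ennreal (f x powr q) = 0" by (subst (asm) nn_integral_0_iff_AE) auto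
      then show ?thesis by eventually_elim (simp add: powr_nonneg_iff powr_eq_0_iff)
    next
      assume "G = 0"
      then have "(\<integral>\<^sup>+x. ennreal (\<bar>g x\<bar> powr P) \<partial>M) = 0" using G(1) by simp
      then have "AE x in M. ennreal (\<bar>g x\<bar> powr P) = 0" by (subst (asm) nn_integral_0_iff_AE) auto
      then show ?thesis by eventually_elim (simp add: powr_nonneg_iff powr_eq_0_iff)
    qed
    then have "(\<integral>\<^sup>+x. ennreal (f x * \<bar>g x\<bar>) \<partial>M) = 0"
      by (subst nn_integral_0_iff_AE) (auto elim!: eventually_mono)
    then show ?thesis by simp
  next
    case False
    then have FG: "F > 0" "G > 0" using f G by auto
    define a b where "a = F powr (1 / q)" and "b = G powr (1 / P)"
    have ab: "a > 0" "b > 0" "a powr q = F" "b powr P = G"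
      using FG 2 by (auto simp: a_def b_def powr_powr)
    have pt: "f x * \<bar>g x\<bar> \<le> (a * b / (P * G)) * \<bar>g x\<bar> powr P + (a * b / (q * F)) * f x powr q" for x
    proof -
      have "(\<bar>g x\<bar> / b) * (f x / a) \<le> (\<bar>g x\<bar> / b) powr P / P + (f x / a) powr q / q"
        using 2 f(1) ab by (intro Youngs_inequality) auto
      then have "(a * b) * ((\<bar>g x\<bar> / b) * (f x / a)) \<le> (a * b) * ((\<bar>g x\<bar> / b) powr P / P + (f x / a) powr q / q)"
        using ab by (intro mult_left_mono) auto
      also have "(a * b) * ((\<bar>g x\<bar> / b) * (f x / a)) = f x * \<bar>g x\<bar>" using ab by simp
      also have "(a * b) * ((\<bar>g x\<bar> / b) powr P / P + (f x / a) powr q / q) =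
          (a * b / (P * G)) * \<bar>g x\<bar> powr P + (a * b / (q * F)) * f x powr q"
        using ab f(1) by (simp add: powr_divide distrib_left mult.commute)
      finally show ?thesis .
    qed
    define A B where "A = a * b / (P * G)" and "B = a * b / (q * F)"
    have AB: "A \<ge> 0" "B \<ge> 0" using ab FG 2 by (auto simp: A_def B_def)
    have "(\<integral>\<^sup>+x. ennreal (f x * \<bar>g x\<bar>) \<partial>M) \<le>
      (\<integral>\<^sup>+x. ennreal A * ennreal (\<bar>g x\<bar> powr P) + ennreal B * ennreal (f x powr q) \<partial>M)"
    proof (rule nn_integral_mono)
      fix x
      have "ennreal (f x * \<bar>g x\<bar>) \<le> ennreal (A * \<bar>g x\<bar> powr P + B * f x powr q)"
        unfolding A_def B_def using pt by (rule ennreal_leI)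
      also have "\<dots> = ennreal A * ennreal (\<bar>g x\<bar> powr P) + ennreal B * ennreal (f x powr q)"
        using AB by (simp add: ennreal_mult ennreal_plus)
      finally show "ennreal (f x * \<bar>g x\<bar>) \<le> ennreal A * ennreal (\<bar>g x\<bar> powr P) + ennreal B * ennreal (f x powr q)" .
    qed
    also have "\<dots> = ennreal A * ennreal G + ennreal B * ennreal F"
      by (simp add: nn_integral_add nn_integral_cmult f G)
    also have "\<dots> = ennreal (A * G + B * F)"
      using AB FG by (simp add: ennreal_mult ennreal_plus)
    also have "A * G + B * F = a * b * (1 / P + 1 / q)"
      using FG by (simp add: A_def B_def distrib_left)
    also have "\<dots> = a * b" using 2 by simp
    finally show ?thesis by (simp add: norm a_def b_def ennreal_mult)
  qed
qed

section \<open>Pointwise bounds and integrability\<close>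

lemma AE_ball_measure_neq: "AE y in (ball_measure :: 'a::euclidean_space measure). y \<noteq> x"
proof (rule AE_I)
  show "{y \<in> space ball_measure. \<not> y \<noteq> x} \<subseteq> {x} \<inter> ball 0 1" by auto
  have "{x} \<inter> ball 0 1 \<in> sets (borel :: 'a measure)" by simp
  then show "emeasure ball_measure ({x} \<inter> ball 0 1) = 0"
    by (subst emeasure_ball_measure_borel) (auto simp: Int_insert_left)
  show "{x} \<inter> ball 0 1 \<in> sets (ball_measure :: 'a measure)"
    by (subst sets_restrict_space_iff) auto
qed

lemma green_power_integral_pos:
  assumes "n \<ge> 3" "0 < q" "q < real n / (real n - 2)"
  shows "0 < green_power_integral n q"
proof -
  have "q * (real n - 2) < real n" using assms by (simp add: pos_less_divide_eq)
  then show ?thesis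
    using assms unfolding green_power_integral_def
    by (intro divide_pos_pos mult_pos_pos Gamma_real_pos) auto
qed

lemma nn_integral_green_kernel_le:
  fixes x :: "'a::euclidean_space"
  assumes n: "DIM('a) \<ge> 3" and q: "0 < q" "q < real DIM('a) / (real DIM('a) - 2)" and x: "norm x < 1"
  shows "(\<integral>\<^sup>+y. ennreal (max 0 (green_kernel x y) powr q) \<partial>ball_measure) \<le> ennreal (green_power_integral DIM('a) q)"
proof -
  have sf: "sigma_finite_measure (ball_measure :: 'a measure)"
    using finite_measure_ball_measure by (rule finite_measure.axioms)
  have meas: "green_kernel z \<in> borel_measurable ball_measure" for z :: 'a
    by (intro borel_measurable_ball_measure) measurable
  have "(\<integral>\<^sup>+y. ennreal (max 0 (green_kernel x y) powr q) \<partial>ball_measure)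
    \<le> (\<integral>\<^sup>+y. ennreal (max 0 (green_kernel (0::'a) y) powr q) \<partial>ball_measure)"
    using emeasure_green_level_le[OF n x] q
    by (intro nn_integral_powr_mono_level sf meas) simp_all
  then show ?thesis by (simp add: nn_integral_green_kernel_zero[OF n q])
qed

lemma green_const_nonneg: "DIM('a::euclidean_space) \<ge> 3 \<Longrightarrow> 0 \<le> green_const TYPE('a)"
  by (simp add: green_const_def unit_sphere_area_def)

lemma green_fun_ball_measurable:
  "green_fun (x :: 'a::euclidean_space) \<in> borel_measurable ball_measure"
  unfolding green_fun_eq[abs_def]
  by (intro borel_measurable_ball_measure) measurable

text \<open>The absolute value stays inside the integral, so that one estimate yields both
  integrability and the operator bound.\<close>

lemma nn_integral_green_fun_mult_le:
  fixes x :: "'a::euclidean_space"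
  assumes n: "DIM('a) \<ge> 3" and q: "q < real DIM('a) / (real DIM('a) - 2)" and conj: "1 / p + 1 / ennreal q = 1"
    and x: "norm x < 1" and g: "g \<in> Lp_space p ball_measure"
  shows "(\<integral>\<^sup>+y. ennreal \<bar>green_fun x y * g y\<bar> \<partial>ball_measure) \<le>
    ennreal (green_const TYPE('a) * green_power_integral DIM('a) q powr (1 / q)) * Lp_norm p ball_measure g"
proof -
  define c where "c = green_const TYPE('a)"
  define I where "I = green_power_integral DIM('a) q"
  have c: "c \<ge> 0" using green_const_nonneg[OF n] by (simp add: c_def)
  have q0: "0 < q" using conj by (cases rule: conjugate_exponents_cases) auto
  have I: "I > 0" using green_power_integral_pos[OF n q0 q] by (simp add: I_def)
  have [measurable]: "g \<in> borel_measurable ball_measure" and gf: "Lp_norm p ball_measure g < \<infinity>"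
    using g by (auto simp: Lp_space_def)
  have [measurable]: "green_kernel x \<in> borel_measurable ball_measure"
    by (intro borel_measurable_ball_measure) measurable
  define F where "F = enn2real (\<integral>\<^sup>+y. ennreal (max 0 (green_kernel x y) powr q) \<partial>ball_measure)"
  have le: "(\<integral>\<^sup>+y. ennreal (max 0 (green_kernel x y) powr q) \<partial>ball_measure) \<le> ennreal I"
    unfolding I_def by (rule nn_integral_green_kernel_le[OF n q0 q x])
  then have F: "(\<integral>\<^sup>+y. ennreal (max 0 (green_kernel x y) powr q) \<partial>ball_measure) = ennreal F"
    unfolding F_def by (metis ennreal_enn2real ennreal_less_top order_le_less_trans)
  have FI: "0 \<le> F" "F \<le> I" using le I by (auto simp: F_def enn2real_leI)
  have "(\<integral>\<^sup>+y. ennreal \<bar>green_fun x y * g y\<bar> \<partial>ball_measure) = (\<integral>\<^sup>+y. ennreal c * ennreal (max 0 (green_kernel x y) * \<bar>g y\<bar>) \<partial>ball_measure)"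
  \<comment> \<open>Off the diagonal the kernel is positive, so its absolute value agrees with the
    positive part almost everywhere.\<close>
  proof (rule nn_integral_cong_AE)
    show "AE y in ball_measure. ennreal \<bar>green_fun x y * g y\<bar> = ennreal c * ennreal (max 0 (green_kernel x y) * \<bar>g y\<bar>)"
      using AE_ball_measure_neq[of x] AE_space
    proof eventually_elim
      case (elim y)
      then have "0 < green_kernel x y" using x n by (intro green_kernel_pos) auto
      then show ?case using c
        by (simp add: green_fun_eq c_def[symmetric] abs_mult ennreal_mult[symmetric] mult.assoc)
    qed
  qed
  also have "\<dots> = ennreal c * (\<integral>\<^sup>+y. ennreal (max 0 (green_kernel x y) * \<bar>g y\<bar>) \<partial>ball_measure)"
    by (rule nn_integral_cmult) measurable
  also have "\<dots> \<le> ennreal c * (ennreal (F powr (1 / q)) * Lp_norm p ball_measure g)"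
    using F FI gf by (intro mult_left_mono Holder_Lp_norm[OF conj]) auto
  also have "\<dots> \<le> ennreal c * (ennreal (I powr (1 / q)) * Lp_norm p ball_measure g)"
    using FI q0 by (intro mult_left_mono mult_right_mono ennreal_leI powr_mono2) auto
  also have "\<dots> = ennreal (c * I powr (1 / q)) * Lp_norm p ball_measure g"
    using c by (simp add: ennreal_mult mult.assoc)
  finally show ?thesis by (simp add: c_def I_def)
qed

lemma integrable_green_fun_mult:
  fixes x :: "'a::euclidean_space"
  assumes n: "DIM('a) \<ge> 3" and q: "q < real DIM('a) / (real DIM('a) - 2)" and conj: "1 / p + 1 / ennreal q = 1"
    and x: "norm x < 1" and g: "g \<in> Lp_space p ball_measure"
  shows "integrable ball_measure (\<lambda>y. green_fun x y * g y)"
proof (rule integrableI_bounded)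
  have "g \<in> borel_measurable ball_measure" using g by (simp add: Lp_space_def)
  then show "(\<lambda>y. green_fun x y * g y) \<in> borel_measurable ball_measure"
    by (intro borel_measurable_times green_fun_ball_measurable)
  have "ennreal (green_const TYPE('a) * green_power_integral DIM('a) q powr (1 / q)) * Lp_norm p ball_measure g < \<infinity>"
    using g by (auto simp: Lp_space_def ennreal_mult_less_top)
  then show "(\<integral>\<^sup>+y. ennreal (norm (green_fun x y * g y)) \<partial>ball_measure) < \<infinity>"
    using nn_integral_green_fun_mult_le[OF assms] by (simp add: le_less_trans)
qed

lemma green_op_bound:
  fixes x :: "'a::euclidean_space"
  assumes n: "DIM('a) \<ge> 3" and q: "q < real DIM('a) / (real DIM('a) - 2)" and conj: "1 / p + 1 / ennreal q = 1"
    and x: "norm x < 1" and g: "g \<in> Lp_space p ball_measure"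
  shows "ennreal \<bar>green_op g x\<bar> \<le>
    ennreal (green_const TYPE('a) * green_power_integral DIM('a) q powr (1 / q)) * Lp_norm p ball_measure g"
proof -
  have "ennreal (norm (green_op g x)) \<le> (\<integral>\<^sup>+y. ennreal (norm (green_fun x y * g y)) \<partial>ball_measure)"
    unfolding green_op_def by (intro integral_norm_bound_ennreal integrable_green_fun_mult[OF assms])
  also have "\<dots> \<le> ennreal (green_const TYPE('a) * green_power_integral DIM('a) q powr (1 / q)) * Lp_norm p ball_measure g"
    using nn_integral_green_fun_mult_le[OF assms] by simp
  finally show ?thesis by simp
qed

lemma green_op_measurable:
  fixes g :: "'a::euclidean_space \<Rightarrow> real"
  assumes [measurable]: "g \<in> borel_measurable ball_measure"
  shows "green_op g \<in> borel_measurable ball_measure"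
proof -
  interpret finite_measure "ball_measure :: 'a measure" by (rule finite_measure_ball_measure)
  \<comment> \<open>The joint measurability of the kernel is a Borel statement; the identity passes
    from Lebesgue measurable to Borel sets in each factor.\<close>
  have id: "(\<lambda>x. x) \<in> (ball_measure :: 'a measure) \<rightarrow>\<^sub>M borel"
    by (intro borel_measurable_ball_measure) simp
  have pair: "(\<lambda>z. (fst z, snd z)) \<in> (ball_measure :: 'a measure) \<Otimes>\<^sub>M (ball_measure :: 'a measure) \<rightarrow>\<^sub>M borel"
  proof (rule borel_measurable_Pair)
    show "fst \<in> borel_measurable ((ball_measure :: 'a measure) \<Otimes>\<^sub>M (ball_measure :: 'a measure))"
      by (rule measurable_compose[OF measurable_fst id])
    show "snd \<in> borel_measurable ((ball_measure :: 'a measure) \<Otimes>\<^sub>M (ball_measure :: 'a measure))"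
      by (rule measurable_compose[OF measurable_snd id])
  qed
  have [measurable]: "(\<lambda>z. green_kernel (fst z) (snd z)) \<in> borel_measurable ((ball_measure :: 'a measure) \<Otimes>\<^sub>M (ball_measure :: 'a measure))"
    using measurable_compose[OF pair green_kernel_measurable_pair] by simp
  have "(\<lambda>(x, y). green_fun x y * g y) \<in> borel_measurable ((ball_measure :: 'a measure) \<Otimes>\<^sub>M (ball_measure :: 'a measure))"
    unfolding green_fun_eq case_prod_beta by measurable
  then show ?thesis unfolding green_op_def by (rule borel_measurable_lebesgue_integral)
qed

lemma Lp_norm_green_op_le:
  fixes g :: "'a::euclidean_space \<Rightarrow> real"
  assumes n: "DIM('a) \<ge> 3" and q: "q < real DIM('a) / (real DIM('a) - 2)" and conj: "1 / p + 1 / ennreal q = 1"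
    and g: "g \<in> Lp_space p ball_measure"
  shows "Lp_norm \<infinity> ball_measure (green_op g) \<le>
    ennreal (green_const TYPE('a) * green_power_integral DIM('a) q powr (1 / q)) * Lp_norm p ball_measure g"
proof -
  have "g \<in> borel_measurable ball_measure" using g by (simp add: Lp_space_def)
  from green_op_measurable[OF this] have [measurable]: "green_op g \<in> borel_measurable ball_measure" .
  have "esssup ball_measure (\<lambda>x. ennreal \<bar>green_op g x\<bar>) \<le>
    ennreal (green_const TYPE('a) * green_power_integral DIM('a) q powr (1 / q)) * Lp_norm p ball_measure g"
    using green_op_bound[OF n q conj _ g] by (intro esssup_I AE_I2) auto
  then show ?thesis by (simp add: Lp_norm_def)
qed

lemma green_op_Lp_space:
  fixes g :: "'a::euclidean_space \<Rightarrow> real"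
  assumes n: "DIM('a) \<ge> 3" and q: "q < real DIM('a) / (real DIM('a) - 2)" and conj: "1 / p + 1 / ennreal q = 1"
    and g: "g \<in> Lp_space p ball_measure"
  shows "green_op g \<in> Lp_space \<infinity> ball_measure"
proof -
  have "ennreal (green_const TYPE('a) * green_power_integral DIM('a) q powr (1 / q)) * Lp_norm p ball_measure g < \<infinity>"
    using g by (auto simp: Lp_space_def ennreal_mult_less_top)
  then show ?thesis
    using Lp_norm_green_op_le[OF assms] green_op_measurable[of g] g
    by (auto simp: Lp_space_def intro: le_less_trans)
qed

section \<open>Sharpness\<close>

lemma tendsto_green_kernel_zero:
  fixes y :: "'a::euclidean_space"
  assumes y: "y \<noteq> 0" and X: "X \<longlonglongrightarrow> 0"
  shows "(\<lambda>k. green_kernel (X k) y) \<longlonglongrightarrow> green_kernel 0 y"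
proof -
  have "(\<lambda>k. green_bracket (X k) y) \<longlonglongrightarrow> green_bracket 0 y"
    unfolding green_bracket_def by (intro tendsto_intros X)
  moreover have "green_bracket 0 y \<noteq> 0" by (simp add: green_bracket_def)
  ultimately show ?thesis
    unfolding green_kernel_def using y by (intro tendsto_intros X) auto
qed

text \<open>The equality case of Hoelder's inequality, where \<open>g\<close> is proportional to the
  power \<open>q - 1\<close> of the kernel. Nonnegativity is recorded because the sharpness argument
  uses Fatou's lemma.\<close>

lemma green_op_extremal:
  assumes n: "DIM('a::euclidean_space) \<ge> 3" and q: "q < real DIM('a) / (real DIM('a) - 2)" and conj: "1 / p + 1 / ennreal q = 1"
  shows "\<exists>g :: 'a \<Rightarrow> real. (\<forall>y. 0 \<le> g y) \<and> g \<in> borel_measurable ball_measure \<and> Lp_norm p ball_measure g = 1 \<and>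
    (\<integral>\<^sup>+y. ennreal (max 0 (green_kernel 0 y) * g y) \<partial>ball_measure) = ennreal (green_power_integral DIM('a) q powr (1 / q))"
proof -
  define I where "I = green_power_integral DIM('a) q"
  have q1: "1 \<le> q" using conj by (cases rule: conjugate_exponents_cases) auto
  then have q0: "0 < q" by simp
  have I: "I > 0" using green_power_integral_pos[OF n q0 q] by (simp add: I_def)
  define f where "f = (\<lambda>y::'a. max 0 (green_kernel 0 y))"
  \<comment> \<open>The divisor is the norm of the numerator for exponent \<open>p\<close>: its
    exponent \<open>1 - 1 / q\<close> equals \<open>1 / p\<close>, read as 0 when \<open>p\<close>
    is infinite.\<close>
  define g where "g = (\<lambda>y. f y powr (q - 1) / I powr (1 - 1 / q))"
  have fm [measurable]: "f \<in> borel_measurable ball_measure"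
    unfolding f_def by (intro borel_measurable_ball_measure) measurable
  have gm [measurable]: "g \<in> borel_measurable ball_measure" unfolding g_def by measurable
  have f0: "0 \<le> f y" for y by (simp add: f_def)
  have fq: "(\<integral>\<^sup>+y. ennreal (f y powr q) \<partial>ball_measure) = ennreal I"
    unfolding f_def I_def by (rule nn_integral_green_kernel_zero[OF n q0 q])
  have fpos: "AE y in ball_measure. 0 < f y"
    using AE_ball_measure_neq[of "0::'a"] AE_space
  proof eventually_elim
    case (elim y)
    then have "0 < green_kernel 0 y" using n by (intro green_kernel_pos) auto
    then show ?case by (simp add: f_def)
  qed
  have g0: "0 \<le> g y" for y by (simp add: g_def)
  have norm: "Lp_norm p ball_measure g = 1"
    using conj
  proof (cases rule: conjugate_exponents_cases)
    case 1
    \<comment> \<open>Here \<open>g\<close> is 1 only almost everywhere: \<open>0 powr 0 = 0\<close>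
      makes it vanish where \<open>f\<close> does.\<close>
    have "esssup ball_measure (\<lambda>y. ennreal \<bar>g y\<bar>) = esssup (ball_measure :: 'a measure) (\<lambda>y. 1)"
    proof (rule esssup_AE_cong)
      show "AE y in ball_measure. ennreal \<bar>g y\<bar> = 1"
        using fpos by eventually_elim (use 1 I in \<open>simp add: g_def\<close>)
    qed auto
    also have "\<dots> = 1"
    proof (rule esssup_const)
      have "emeasure (ball_measure :: 'a measure) (ball 0 1) = ennreal (unit_ball_vol (real DIM('a)))"
        by (subst emeasure_ball_measure_borel) (auto simp: emeasure_ball)
      then show "emeasure (ball_measure :: 'a measure) (space ball_measure) \<noteq> 0"
        using unit_ball_vol_pos[of "real DIM('a)"] by (simp add: ennreal_eq_0_iff not_le)
    qed
    finally show ?thesis using 1 by (simp add: Lp_norm_def)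
  next
    case (2 P)
    have e: "(q - 1) * P = q" "(1 - 1 / q) * P = 1"
    proof -
      have "1 - 1 / q = 1 / P" using 2 by simp
      then have "(1 - 1 / q) * P = 1 / P * P" by (simp only:)
      then show 1: "(1 - 1 / q) * P = 1" using 2 by simp
      have "q * (1 - 1 / q) = q - 1" using 2 by (simp add: right_diff_distrib)
      then have "(q - 1) * P = q * ((1 - 1 / q) * P)" by (simp only: mult.assoc[symmetric])
      then show "(q - 1) * P = q" by (simp only: 1 mult_1_right)
    qed
    have "\<bar>g y\<bar> powr P = (1 / I) * f y powr q" for y
      using I f0[of y] by (simp add: g_def powr_divide powr_powr e)
    then have "(\<integral>\<^sup>+y. ennreal (\<bar>g y\<bar> powr P) \<partial>ball_measure) = (\<integral>\<^sup>+y. ennreal (1 / I) * ennreal (f y powr q) \<partial>ball_measure)"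
      using I by (simp add: ennreal_mult[symmetric])
    also have "\<dots> = ennreal (1 / I) * ennreal I" by (simp add: nn_integral_cmult fq)
    also have "\<dots> = 1" using I by (subst ennreal_mult[symmetric]) auto
    finally show ?thesis using 2 by (simp add: Lp_norm_def)
  qed
  have "(\<integral>\<^sup>+y. ennreal (max 0 (green_kernel 0 y) * g y) \<partial>ball_measure) = (\<integral>\<^sup>+y. ennreal (1 / I powr (1 - 1 / q)) * ennreal (f y powr q) \<partial>ball_measure)"
  proof (rule nn_integral_cong)
    fix y
    have "f y * f y powr (q - 1) = f y powr q" if "f y > 0"
      using that by (simp add: powr_mult_base)
    then have "f y * f y powr (q - 1) = f y powr q" using f0[of y] by (cases "f y = 0") auto
    moreover have "max 0 (green_kernel 0 y) = f y" by (simp add: f_def)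
    ultimately show "ennreal (max 0 (green_kernel 0 y) * g y) = ennreal (1 / I powr (1 - 1 / q)) * ennreal (f y powr q)"
      by (simp add: g_def ennreal_mult[symmetric])
  qed
  also have "\<dots> = ennreal (1 / I powr (1 - 1 / q)) * ennreal I" by (simp add: nn_integral_cmult fq)
  also have "\<dots> = ennreal (1 / I powr (1 - 1 / q) * I)" using I by (intro ennreal_mult[symmetric]) auto
  also have "1 / I powr (1 - 1 / q) * I = I powr (1 / q)"
    using I powr_diff[of I 1 "1 - 1 / q"] by simp
  finally show ?thesis using g0 gm norm unfolding I_def by blast
qed

text \<open>An essential supremum need not control the value at 0, where the extremal bound is
  expected. Since balls about 0 have positive measure, good points accumulate there.\<close>

lemma AE_ball_measure_obtain_seq:
  assumes "AE x in (ball_measure :: 'a::euclidean_space measure). P x"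
  obtains X :: "nat \<Rightarrow> 'a::euclidean_space" where "\<And>k. P (X k)" "\<And>k. norm (X k) < 1" "X \<longlonglongrightarrow> 0"
proof -
  have "\<exists>x. P x \<and> norm x < 1 / real (Suc k)" for k
  proof (rule ccontr)
    assume neg: "\<not> (\<exists>x. P x \<and> norm x < 1 / real (Suc k))"
    let ?B = "ball (0::'a) (1 / real (Suc k))"
    have sub: "?B \<subseteq> ball 0 1" by (intro subset_ball) simp
    have B: "?B \<in> sets (ball_measure :: 'a measure)" using sub by (subst sets_restrict_space_iff) auto
    have "AE x in (ball_measure :: 'a measure). x \<notin> ?B"
      using assms by eventually_elim (use neg in auto)
    then have "emeasure (ball_measure :: 'a measure) ?B = 0"
      using AE_iff_null_sets[OF B] by auto
    moreover have "emeasure (ball_measure :: 'a measure) ?B = ennreal (unit_ball_vol (real DIM('a)) * (1 / real (Suc k)) ^ DIM('a))"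
      using sub by (subst emeasure_ball_measure_borel) (auto simp: emeasure_ball)
    ultimately have "unit_ball_vol (real DIM('a)) * (1 / real (Suc k)) ^ DIM('a) \<le> 0"
      by (simp only: ennreal_eq_0_iff)
    moreover have "0 < unit_ball_vol (real DIM('a)) * (1 / real (Suc k)) ^ DIM('a)"
      by (intro mult_pos_pos zero_less_power) auto
    ultimately show False by linarith
  qed
  then obtain X where X: "\<And>k. P (X k) \<and> norm (X k) < 1 / real (Suc k)" by metis
  have lim: "X \<longlonglongrightarrow> 0"
  proof (rule Lim_null_comparison)
    show "eventually (\<lambda>k. norm (X k) \<le> inverse (real (Suc k))) sequentially"
      using X by (intro always_eventually allI) (simp add: less_imp_le inverse_eq_divide)
    show "(\<lambda>k. inverse (real (Suc k))) \<longlonglongrightarrow> 0" by (rule LIMSEQ_inverse_real_of_nat)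
  qed
  have "norm (X k) < 1" for k
    using X[of k] by (auto elim!: less_le_trans)
  then show ?thesis using that[of X] X lim by blast
qed

text \<open>Along poles tending to 0 at which the essential bound holds, the kernels converge
  pointwise off 0. With a nonnegative \<open>g\<close>, Fatou's lemma transfers the bound to pole 0
  without recourse to continuity of \<open>green_op g\<close>.\<close>

lemma Lp_norm_green_op_ge:
  fixes g :: "'a::euclidean_space \<Rightarrow> real"
  assumes n: "DIM('a) \<ge> 3" and q: "q < real DIM('a) / (real DIM('a) - 2)" and conj: "1 / p + 1 / ennreal q = 1"
    and g: "g \<in> Lp_space p ball_measure" and g0: "\<And>y. 0 \<le> g y"
  shows "ennreal (green_const TYPE('a)) * (\<integral>\<^sup>+y. ennreal (max 0 (green_kernel 0 y) * g y) \<partial>ball_measure)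
    \<le> Lp_norm \<infinity> ball_measure (green_op g)"
proof -
  define c where "c = green_const TYPE('a)"
  define L where "L = Lp_norm \<infinity> ball_measure (green_op g)"
  have c: "c \<ge> 0" using green_const_nonneg[OF n] by (simp add: c_def)
  have gm [measurable]: "g \<in> borel_measurable ball_measure" using g by (simp add: Lp_space_def)
  have km [measurable]: "green_kernel z \<in> borel_measurable ball_measure" for z :: 'a
    by (intro borel_measurable_ball_measure) measurable
  have "AE x in ball_measure. ennreal \<bar>green_op g x\<bar> \<le> L"
    unfolding L_def Lp_norm_def using esssup_AE[of "\<lambda>x. ennreal \<bar>green_op g x\<bar>" ball_measure] by simp
  from AE_ball_measure_obtain_seq[OF this] obtain X where
    X: "\<And>k. ennreal \<bar>green_op g (X k)\<bar> \<le> L" "\<And>k. norm (X k) < 1" "X \<longlonglongrightarrow> 0" by metis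
  have each: "(\<integral>\<^sup>+y. ennreal (c * green_kernel (X k) y * g y) \<partial>ball_measure) \<le> L" for k
  proof -
    have "(\<integral>\<^sup>+y. ennreal (green_fun (X k) y * g y) \<partial>ball_measure) = ennreal (green_op g (X k))"
      unfolding green_op_def
    proof (rule nn_integral_eq_integral)
      show "AE y in ball_measure. 0 \<le> green_fun (X k) y * g y"
        using AE_ball_measure_neq[of "X k"] AE_space
      proof eventually_elim
        case (elim y)
        then have "0 < green_kernel (X k) y" using X(2)[of k] n by (intro green_kernel_pos) auto
        then show ?case using c g0[of y] by (simp add: green_fun_eq c_def[symmetric])
      qed
    qed (rule integrable_green_fun_mult[OF n q conj X(2) g])
    also have "\<dots> \<le> ennreal \<bar>green_op g (X k)\<bar>" by (intro ennreal_leI) simp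
    also have "\<dots> \<le> L" by (rule X(1))
    finally show ?thesis by (simp add: green_fun_eq c_def)
  qed
  have "ennreal c * (\<integral>\<^sup>+y. ennreal (max 0 (green_kernel 0 y) * g y) \<partial>ball_measure) =
      (\<integral>\<^sup>+y. ennreal c * ennreal (max 0 (green_kernel 0 y) * g y) \<partial>ball_measure)"
    by (rule nn_integral_cmult[symmetric]) measurable
  also have "\<dots> = (\<integral>\<^sup>+y. liminf (\<lambda>k. ennreal (c * green_kernel (X k) y * g y)) \<partial>ball_measure)"
  proof (rule nn_integral_cong_AE)
    show "AE y in ball_measure. ennreal c * ennreal (max 0 (green_kernel 0 y) * g y) = liminf (\<lambda>k. ennreal (c * green_kernel (X k) y * g y))"
      using AE_ball_measure_neq[of 0] AE_space
    proof eventually_elim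
      case (elim y)
      then have pos: "0 < green_kernel 0 y" using n by (intro green_kernel_pos) auto
      have "(\<lambda>k. ennreal (c * green_kernel (X k) y * g y)) \<longlonglongrightarrow> ennreal (c * green_kernel 0 y * g y)"
        using elim by (intro tendsto_ennrealI tendsto_intros tendsto_green_kernel_zero X) auto
      then have "liminf (\<lambda>k. ennreal (c * green_kernel (X k) y * g y)) = ennreal (c * green_kernel 0 y * g y)"
        by (intro lim_imp_Liminf) auto
      then show ?case using pos c g0[of y] by (simp add: ennreal_mult[symmetric] mult.assoc)
    qed
  qed
  also have "\<dots> \<le> liminf (\<lambda>k. \<integral>\<^sup>+y. ennreal (c * green_kernel (X k) y * g y) \<partial>ball_measure)"
    by (rule nn_integral_liminf) measurable
  also have "\<dots> \<le> liminf (\<lambda>k. L)"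
    using each by (intro Liminf_mono always_eventually allI)
  also have "\<dots> = L" by (simp add: Liminf_const)
  finally show ?thesis by (simp add: c_def L_def)
qed

lemma Lp_operator_norm_green_op:
  assumes n: "DIM('a::euclidean_space) \<ge> 3" and q: "q < real DIM('a) / (real DIM('a) - 2)" and conj: "1 / p + 1 / ennreal q = 1"
  shows "Lp_operator_norm p (ball_measure :: 'a measure) \<infinity> ball_measure green_op =
    ennreal (green_const TYPE('a) * green_power_integral DIM('a) q powr (1 / q))"
proof (rule antisym)
  show "Lp_operator_norm p (ball_measure :: 'a measure) \<infinity> ball_measure green_op \<le>
    ennreal (green_const TYPE('a) * green_power_integral DIM('a) q powr (1 / q))"
    unfolding Lp_operator_norm_def
  proof (rule SUP_least)
    fix g :: "'a \<Rightarrow> real" assume "g \<in> {f \<in> Lp_space p ball_measure. Lp_norm p ball_measure f = 1}"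
    then show "Lp_norm \<infinity> ball_measure (green_op g) \<le> ennreal (green_const TYPE('a) * green_power_integral DIM('a) q powr (1 / q))"
      using Lp_norm_green_op_le[OF n q conj, of g] by simp
  qed
  from green_op_extremal[OF n q conj]
  obtain g :: "'a \<Rightarrow> real" where g: "\<forall>y. 0 \<le> g y" "g \<in> borel_measurable ball_measure" "Lp_norm p ball_measure g = 1"
    "(\<integral>\<^sup>+y. ennreal (max 0 (green_kernel 0 y) * g y) \<partial>ball_measure) = ennreal (green_power_integral DIM('a) q powr (1 / q))"
    by (elim exE conjE)
  have gL: "g \<in> Lp_space p ball_measure" using g by (simp add: Lp_space_def)
  have "ennreal (green_const TYPE('a) * green_power_integral DIM('a) q powr (1 / q)) \<le> Lp_norm \<infinity> ball_measure (green_op g)"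
    using Lp_norm_green_op_ge[OF n q conj gL g(1)[rule_format]] green_const_nonneg[OF n] by (simp add: g(4) ennreal_mult)
  also have "\<dots> \<le> Lp_operator_norm p (ball_measure :: 'a measure) \<infinity> ball_measure green_op"
    unfolding Lp_operator_norm_def using gL g by (intro SUP_upper) auto
  finally show "ennreal (green_const TYPE('a) * green_power_integral DIM('a) q powr (1 / q)) \<le>
    Lp_operator_norm p (ball_measure :: 'a measure) \<infinity> ball_measure green_op" .
qed

section \<open>The value for bounded data, and the theorem\<close>

lemma green_power_integral_1:
  assumes "n \<ge> 3"
  shows "green_power_integral n 1 = unit_ball_vol (real n) * (real n - 2) / 2"
proof -
  \<comment> \<open>At exponent 1 the two Gamma arguments are \<open>s\<close> and
    \<open>s + 1\<close>, so their quotient reduces to \<open>1 / s\<close>.\<close>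
  define s where "s = 2 / (real n - 2)"
  have s: "s > 0" using assms by (simp add: s_def)
  have "s \<notin> \<int>\<^sub>\<le>\<^sub>0"
  proof
    assume "s \<in> \<int>\<^sub>\<le>\<^sub>0"
    then have "s \<le> 0" by (rule nonpos_Ints_nonpos)
    then show False using s by simp
  qed
  then have "Gamma (s + 1) = s * Gamma s" by (rule Gamma_plus1)
  moreover have "real n / (real n - 2) = s + 1" "(real n - 1 * (real n - 2)) / (real n - 2) = s"
    using assms by (simp_all add: s_def field_simps)
  moreover have "Gamma s > 0" using s by (rule Gamma_real_pos)
  moreover have "Gamma (1 + 1 :: real) = 1" using Gamma_fact[of 1, where 'a=real] by simp
  ultimately have "green_power_integral n 1 = unit_ball_vol (real n) / s"
    unfolding green_power_integral_def by (simp add: unit_ball_vol_def add.commute)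
  then show ?thesis by (simp add: s_def)
qed


theorem theorem1p1:
  fixes n :: nat and p :: ennreal and q :: real
  assumes "CARD('n::finite) = n" and "n \<ge> 3"
    and "p > ennreal (real n / 2)"
    and "1 / p + 1 / ennreal q = 1"
  shows "1 \<le> q \<and> q < real n / (real n - 2) \<and>
    (\<forall>g \<in> Lp_space p (ball_measure :: (real^'n) measure).
       (\<forall>x \<in> ball 0 1. integrable ball_measure (\<lambda>y. green_fun x y * g y)) \<and>
       green_op g \<in> Lp_space \<infinity> ball_measure) \<and>
    Lp_operator_norm p (ball_measure :: (real^'n) measure) \<infinity> ball_measure green_op =
      ennreal (green_const TYPE(real^'n) *
        (pi powr (real n / 2) * Gamma (1 + q) * Gamma ((real n - q * (real n - 2)) / (real n - 2)) /
          (Gamma (1 + real n / 2) * Gamma (real n / (real n - 2)))) powr (1 / q)) \<and>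
    Lp_operator_norm \<infinity> (ball_measure :: (real^'n) measure) \<infinity> ball_measure green_op =
      ennreal (1 / (2 * real n))"
proof (intro conjI ballI)
  have D: "DIM(real^'n) = n" using assms(1) by simp
  have n3: "DIM(real^'n) \<ge> 3" using assms(2) D by simp
  have q: "1 \<le> q \<and> q < real n / (real n - 2)"
    using assms(4)
  proof (cases rule: conjugate_exponents_cases)
    case 1
    then show ?thesis using assms(2) by simp
  next
    case (2 P)
    then have "real n / 2 < P" using assms(3) by (simp add: ennreal_less_iff)
    \<comment> \<open>Conjugacy converts this into \<open>1 / q > 1 - 2 / n\<close>, the
      integrability threshold of the kernel power.\<close>
    then have "1 / P < 2 / real n" using assms(2) 2 by (simp add: field_simps)
    then have "1 - 2 / real n < 1 / q" using 2(4) by linarith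
    then have "q < real n / (real n - 2)" using assms(2) 2(3) by (simp add: field_simps)
    then show ?thesis using 2(3) by simp
  qed
  then show "1 \<le> q" "q < real n / (real n - 2)" by auto
  then have q': "q < real DIM(real^'n) / (real DIM(real^'n) - 2)" by (simp only: D)
  show "integrable ball_measure (\<lambda>y. green_fun x y * g y)"
    if "g \<in> Lp_space p ball_measure" "x \<in> ball 0 1" for g and x :: "real^'n"
    using that by (intro integrable_green_fun_mult[OF n3 q' assms(4)]) auto
  show "green_op g \<in> Lp_space \<infinity> ball_measure" if "g \<in> Lp_space p ball_measure" for g :: "real^'n \<Rightarrow> real"
    using that by (rule green_op_Lp_space[OF n3 q' assms(4)])
  show "Lp_operator_norm p (ball_measure :: (real^'n) measure) \<infinity> ball_measure green_op =
      ennreal (green_const TYPE(real^'n) *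
        (pi powr (real n / 2) * Gamma (1 + q) * Gamma ((real n - q * (real n - 2)) / (real n - 2)) /
          (Gamma (1 + real n / 2) * Gamma (real n / (real n - 2)))) powr (1 / q))"
    using Lp_operator_norm_green_op[OF n3 q' assms(4)] unfolding D green_power_integral_def .
  \<comment> \<open>The last claim is independent of the given \<open>p\<close>: the general formula
    is applied to the conjugate pair infinity and 1.\<close>
  have "1 < real DIM(real^'n) / (real DIM(real^'n) - 2)" using n3 by simp
  moreover have "1 / \<infinity> + 1 / ennreal 1 = 1" by simp
  ultimately have "Lp_operator_norm \<infinity> (ball_measure :: (real^'n) measure) \<infinity> ball_measure green_op =
      ennreal (green_const TYPE(real^'n) * green_power_integral n 1 powr (1 / 1))"
    using Lp_operator_norm_green_op[OF n3] unfolding D by blast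
  also have "green_const TYPE(real^'n) * green_power_integral n 1 powr (1 / 1) = 1 / (2 * real n)"
  proof -
    \<comment> \<open>The sphere area \<open>n * V\<close> from the Hausdorff measure meets the
      kernel integral \<open>V * (n - 2) / 2\<close>; both \<open>V\<close> and \<open>n - 2\<close>
      cancel.\<close>
    define V where "V = unit_ball_vol (real n)"
    have "V > 0" by (simp add: V_def)
    moreover have "green_const TYPE(real^'n) = 1 / ((real n - 2) * (real n * V))"
      unfolding green_const_def unit_sphere_area_eq D assms(1) V_def ..
    ultimately show ?thesis
      using assms(2) by (simp add: green_power_integral_1 V_def[symmetric] field_simps)
  qed
  finally show "Lp_operator_norm \<infinity> (ball_measure :: (real^'n) measure) \<infinity> ball_measure green_op =
      ennreal (1 / (2 * real n))" .
qed

end
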